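(* For every integer $d\ge 8$ there exists a $d$-dimensional, negatively curved Riemannian manifold $N^d=\mathbb{R}^+\times_g\mathbb{S}^{d-1}$ (for a suitable function $g\in C^\infty(\mathbb{R})$ that is odd, with $g'(0)=1$ and $g>0$ on $(0,\infty)$) such that the Cauchy problem for wave maps from Minkowski space $\mathbb{R}^{1,d}$ into $N^d$ admits a solution which develops from smooth Cauchy data of compact support and forms a singularity in finite time.
   Context: $\mathbb{R}^{1,d}$ is Minkowski space with metric $\eta=-dt^2+dx_1^2+\dots+dx_d^2$. $N^d=\mathbb{R}^+\times_g\mathbb{S}^{d-1}$ is the warped product with polar coordinates $(u,\theta)\in\mathbb{R}^+\times\mathbb{S}^{d-1}$ and metric $h=du^2+g(u)^2d\theta^2$, where $d\theta^2$ is the standard metric on $\mathbb{S}^{d-1}$; under the stated assumptions on $g$ the metric extends smoothly to the pole $u=0$, which is regarded as a point of $N^d$. "Negatively curved" means that all sectional curvatures are negative. A wave map $U:\mathbb{R}^{1,d}\supset\Omega\to N^d$ is a map solving the wave maps equation, i.e. the Euler–Lagrange equation of the action $\int \eta^{\mu\nu}h_{ab}(U)\partial_\mu U^a\partial_\nu U^b$. For corotational maps $U(t,r,\omega)=(u(t,r),\omega)$ (in spherical coordinates $(t,r,\omega)$ on $\mathbb{R}^{1,d}$) this reduces to $$\Big(\partial_t^2-\partial_r^2-\frac{d-1}{r}\partial_r\Big)u(t,r)+\frac{d-1}{r^2}g(u(t,r))g'(u(t,r))=0.$$ Cauchy data at $t=0$ have compact support if, outside a compact subset of $\mathbb{R}^d$,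 the map $U(0,\cdot)$ equals the pole $u=0$ and $\partial_tU(0,\cdot)$ vanishes. "Forms a singularity in finite time" means: there is a finite $T>0$ such that the solution $U$ with the given data is smooth on a relatively open subset of $[0,T)\times\mathbb{R}^d$ containing $\{0\}\times\mathbb{R}^d$ and the backward lightcone $\{(t,x): 0\le t<T,\ |x|\le T-t\}$, and its spatial gradient at the origin $x=0$ is unbounded as $t\to T^-$. *)

theory Defs
  imports "HOL-Analysis.Analysis"
begin

section \<open>Smooth functions\<close>

text \<open>Derivatives are taken within \<open>S\<close>. The sets \<open>S\<close> occurring below are open, or relatively open
  in a half-open slab \<open>{0..<T} \<times> UNIV\<close>; there the derivative is unique, and at the boundary
  \<open>t = 0\<close> it is the one-sided one, so \<open>smooth_on\<close> means smooth up to \<open>t = 0\<close>.\<close>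

definition dir_deriv ::
  "'a set \<Rightarrow> ('a::real_normed_vector \<Rightarrow> 'b::real_normed_vector) \<Rightarrow> 'a \<Rightarrow> 'a \<Rightarrow> 'b" where
  "dir_deriv S f v x = frechet_derivative f (at x within S) v"

primrec Ck_on ::
  "nat \<Rightarrow> 'a set \<Rightarrow> ('a::real_normed_vector \<Rightarrow> 'b::real_normed_vector) \<Rightarrow> bool" where
  "Ck_on 0 S f \<longleftrightarrow> continuous_on S f"
| "Ck_on (Suc k) S f \<longleftrightarrow> f differentiable_on S \<and> (\<forall>v. Ck_on k S (dir_deriv S f v))"

definition smooth_on ::
  "'a set \<Rightarrow> ('a::real_normed_vector \<Rightarrow> 'b::real_normed_vector) \<Rightarrow> bool" where
  "smooth_on S f \<longleftrightarrow> (\<forall>k. Ck_on k S f)"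


section \<open>Riemannian metrics on a global chart\<close>

text \<open>A metric is given by its matrix of components \<open>h x $ a $ b\<close> in a global chart \<open>real^'n\<close>.\<close>

definition metric_inner :: "real^'n^'n \<Rightarrow> real^'n \<Rightarrow> real^'n \<Rightarrow> real" where
  "metric_inner H v w = (\<Sum>a\<in>UNIV. \<Sum>b\<in>UNIV. H $ a $ b * v $ a * w $ b)"

definition riemannian_metric :: "(real^'n \<Rightarrow> real^'n^'n) \<Rightarrow> bool" where
  "riemannian_metric h \<longleftrightarrow>
     smooth_on UNIV h \<and>
     (\<forall>x. transpose (h x) = h x) \<and>
     (\<forall>x v. v \<noteq> 0 \<longrightarrow> metric_inner (h x) v v > 0)"

definition metric_deriv :: "(real^'n \<Rightarrow> real^'n^'n) \<Rightarrow> 'n \<Rightarrow> 'n \<Rightarrow> 'n \<Rightarrow> real^'n \<Rightarrow> real" where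
  "metric_deriv h c a b x = dir_deriv UNIV (\<lambda>y. h y $ a $ b) (axis c 1) x"

definition christoffel :: "(real^'n \<Rightarrow> real^'n^'n) \<Rightarrow> 'n \<Rightarrow> 'n \<Rightarrow> 'n \<Rightarrow> real^'n \<Rightarrow> real" where
  "christoffel h a b c x =
     (\<Sum>d\<in>UNIV. matrix_inv (h x) $ a $ d *
        (metric_deriv h b d c x + metric_deriv h c d b x - metric_deriv h d b c x)) / 2"

text \<open>The component \<open>R\<^sup>a\<^sub>b\<^sub>c\<^sub>d\<close>, with the convention that the \<open>a\<close>-component of
  \<open>R(X,Y)Z\<close> is the sum of \<open>R\<^sup>a\<^sub>b\<^sub>c\<^sub>d Z\<^sup>b X\<^sup>c Y\<^sup>d\<close>.\<close>

definition riemann_tensor ::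
  "(real^'n \<Rightarrow> real^'n^'n) \<Rightarrow> 'n \<Rightarrow> 'n \<Rightarrow> 'n \<Rightarrow> 'n \<Rightarrow> real^'n \<Rightarrow> real" where
  "riemann_tensor h a b c d x =
     dir_deriv UNIV (christoffel h a d b) (axis c 1) x
     - dir_deriv UNIV (christoffel h a c b) (axis d 1) x
     + (\<Sum>e\<in>UNIV. christoffel h a c e x * christoffel h e d b x)
     - (\<Sum>e\<in>UNIV. christoffel h a d e x * christoffel h e c b x)"

definition curvature_op ::
  "(real^'n \<Rightarrow> real^'n^'n) \<Rightarrow> real^'n \<Rightarrow> real^'n \<Rightarrow> real^'n \<Rightarrow> real^'n \<Rightarrow> real^'n" where
  "curvature_op h x X Y Z =
     (\<chi> a. \<Sum>b\<in>UNIV. \<Sum>c\<in>UNIV. \<Sum>d\<in>UNIV. riemann_tensor h a b c d x * Z $ b * X $ c * Y $ d)"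

definition sectional_curvature ::
  "(real^'n \<Rightarrow> real^'n^'n) \<Rightarrow> real^'n \<Rightarrow> real^'n \<Rightarrow> real^'n \<Rightarrow> real" where
  "sectional_curvature h x X Y =
     metric_inner (h x) (curvature_op h x X Y Y) X /
     (metric_inner (h x) X X * metric_inner (h x) Y Y - (metric_inner (h x) X Y)\<^sup>2)"

definition negatively_curved :: "(real^'n \<Rightarrow> real^'n^'n) \<Rightarrow> bool" where
  "negatively_curved h \<longleftrightarrow>
     (\<forall>x X Y. X \<noteq> Y \<and> independent {X, Y} \<longrightarrow> sectional_curvature h x X Y < 0)"


section \<open>The warped product\<close>

text \<open>The chart sends the point with polar coordinates \<open>(u, \<theta>)\<close> to \<open>x = u \<theta>\<close> and the pole to
  \<open>0\<close>, so \<open>u = norm x\<close> and \<open>\<theta> = sgn x = x / norm x\<close>. The standard metric of the sphere is the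
  Euclidean inner product of the vectors \<open>d\<theta>(v)\<close>, which yields \<open>du\<^sup>2 + g(u)\<^sup>2 d\<theta>\<^sup>2\<close> off the pole.
  For odd smooth \<open>g\<close> with \<open>g'(0) = 1\<close> the value at the pole is the only continuous extension.\<close>

definition warped_metric :: "(real \<Rightarrow> real) \<Rightarrow> real^'n \<Rightarrow> real^'n^'n" where
  "warped_metric g x =
     (if x = 0 then mat 1
      else let du = frechet_derivative norm (at x); d\<theta> = frechet_derivative sgn (at x)
           in \<chi> a b. du (axis a 1) * du (axis b 1)
                + (g (norm x))\<^sup>2 * (d\<theta> (axis a 1) \<bullet> d\<theta> (axis b 1)))"


section \<open>Wave maps\<close>

text \<open>Spacetime is \<open>real \<times> (real^'n)\<close> with points \<open>(t, x)\<close>. In the standard basis the components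
  of the inverse metric \<open>\<eta>\<^sup>\<mu>\<^sup>\<nu>\<close> coincide with those of \<open>\<eta>\<close>.\<close>

definition minkowski :: "real \<times> (real^'n) \<Rightarrow> real \<times> (real^'n) \<Rightarrow> real" where
  "minkowski p q = - (fst p * fst q) + snd p \<bullet> snd q"

text \<open>The Lagrangian as a function of a target point \<open>y\<close> and of variables \<open>p \<mu>\<close>
  standing for \<open>\<partial>\<^sub>\<mu> U\<close>, with the basis vectors as spacetime indices.\<close>

definition wave_map_lagrangian ::
  "(real^'n \<Rightarrow> real^'n^'n) \<Rightarrow> real^'n \<Rightarrow> (real \<times> (real^'n) \<Rightarrow> real^'n) \<Rightarrow> real" where
  "wave_map_lagrangian h y p =
     (\<Sum>\<mu>\<in>Basis. \<Sum>\<nu>\<in>Basis. minkowski \<mu> \<nu> * metric_inner (h y) (p \<mu>) (p \<nu>))"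

text \<open>The system \<open>\<partial>\<^sub>\<mu> (\<partial>L / \<partial>(\<partial>\<^sub>\<mu> U\<^sup>a)) = \<partial>L / \<partial>U\<^sup>a\<close>, for a Lagrangian \<open>L\<close> and a map
  \<open>U\<close> on \<open>D\<close>.\<close>

definition euler_lagrange ::
  "(real^'n \<Rightarrow> (real \<times> (real^'n) \<Rightarrow> real^'n) \<Rightarrow> real) \<Rightarrow>
     (real \<times> (real^'n)) set \<Rightarrow> (real \<times> (real^'n) \<Rightarrow> real^'n) \<Rightarrow> bool" where
  "euler_lagrange L D U \<longleftrightarrow>
     (\<forall>z\<in>D. \<forall>a.
        (\<Sum>\<mu>\<in>Basis. dir_deriv D
           (\<lambda>q. let DU = (\<lambda>\<nu>. dir_deriv D U \<nu> q)
                 in deriv (\<lambda>s. L (U q) (DU(\<mu> := DU \<mu> + s *\<^sub>R axis a 1))) 0) \<mu> z)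
        = deriv (\<lambda>s. L (U z + s *\<^sub>R axis a 1) (\<lambda>\<nu>. dir_deriv D U \<nu> z)) 0)"

definition wave_map ::
  "(real^'n \<Rightarrow> real^'n^'n) \<Rightarrow> (real \<times> (real^'n)) set \<Rightarrow> (real \<times> (real^'n) \<Rightarrow> real^'n) \<Rightarrow> bool" where
  "wave_map h D U \<longleftrightarrow> smooth_on D U \<and> euler_lagrange (wave_map_lagrangian h) D U"


section \<open>Cauchy data and singularity formation\<close>

definition smooth_compact_data :: "(real^'n \<Rightarrow> real^'n) \<Rightarrow> (real^'n \<Rightarrow> real^'n) \<Rightarrow> bool" where
  "smooth_compact_data U0 U1 \<longleftrightarrow>
     smooth_on UNIV U0 \<and> smooth_on UNIV U1 \<and>
     (\<exists>K. compact K \<and> (\<forall>x. x \<notin> K \<longrightarrow> U0 x = 0 \<and> U1 x = 0))"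

definition attains_data ::
  "(real \<times> (real^'n)) set \<Rightarrow> (real \<times> (real^'n) \<Rightarrow> real^'n) \<Rightarrow>
     (real^'n \<Rightarrow> real^'n) \<Rightarrow> (real^'n \<Rightarrow> real^'n) \<Rightarrow> bool" where
  "attains_data D U U0 U1 \<longleftrightarrow>
     (\<forall>x. U (0, x) = U0 x \<and> dir_deriv D U (1, 0) (0, x) = U1 x)"

definition blowup_domain :: "real \<Rightarrow> (real \<times> (real^'n)) set \<Rightarrow> bool" where
  "blowup_domain T D \<longleftrightarrow>
     openin (top_of_set ({0..<T} \<times> UNIV)) D \<and>
     {0} \<times> UNIV \<subseteq> D \<and>
     {(t, x). 0 \<le> t \<and> t < T \<and> norm x \<le> T - t} \<subseteq> D"

text \<open>The length of the spatial gradient, with the target metric measuring the components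
  \<open>\<partial>\<^sub>i U\<close>; hence it does not depend on the chart.\<close>

definition spatial_gradient_norm ::
  "(real^'n \<Rightarrow> real^'n^'n) \<Rightarrow> (real \<times> (real^'n)) set \<Rightarrow> (real \<times> (real^'n) \<Rightarrow> real^'n) \<Rightarrow>
     real \<times> (real^'n) \<Rightarrow> real" where
  "spatial_gradient_norm h D U z =
     sqrt (\<Sum>i\<in>UNIV. metric_inner (h (U z))
             (dir_deriv D U (0, axis i 1) z) (dir_deriv D U (0, axis i 1) z))"

definition forms_singularity ::
  "(real^'n \<Rightarrow> real^'n^'n) \<Rightarrow> (real^'n \<Rightarrow> real^'n) \<Rightarrow> (real^'n \<Rightarrow> real^'n) \<Rightarrow> bool" where
  "forms_singularity h U0 U1 \<longleftrightarrow>
     (\<exists>T>0. \<exists>D U.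
        blowup_domain T D \<and> wave_map h D U \<and> attains_data D U U0 U1 \<and>
        (\<forall>C. \<exists>\<^sub>F t in at_left T. spatial_gradient_norm h D U (t, 0) > C))"

end

theory Submission imports Defs begin

text \<open>A corotational map is \<open>U(t, x) = f(t, x) x\<close> with a radial function \<open>f(t, _)\<close>, in the chart in
  which the target metric is \<open>A \<langle>v, w\<rangle> + B \<langle>y, v\<rangle> \<langle>y, w\<rangle>\<close> with functions \<open>A\<close>, \<open>B\<close> of \<open>s = |y|\<^sup>2\<close> such
  that \<open>A + s B = 1\<close>. The wave map system for \<open>U\<close> is one semilinear wave equation for \<open>f\<close> in \<open>n + 2\<close> space
  dimensions, whose nonlinearity depends on \<open>B\<close> (\<open>corotational_wave_map\<close>).

  \<^emph>\<open>Blowup.\<close> The solution is prescribed, and the target is adapted to it. For \<open>u = \<rho> / sqrt (5/4 - \<rho>\<^sup>2)\<close> with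
  \<open>\<rho> = |x| / (1 - t)\<close> the equation determines \<open>g\<close>: it yields \<open>g\<^sup>2 = u\<^sup>2 (1 + \<alpha> u\<^sup>2 - \<beta> u\<^sup>4)\<close> for the values of
  \<open>u\<close> that are attained near the light cone \<open>\<rho> \<le> 1\<close> (\<open>selfsim_solves\<close>). The gradient at the origin is
  proportional to \<open>1 / (1 - t)\<close>.

  \<^emph>\<open>Curvature.\<close> The sectional curvatures lie between \<open>- g'' / g\<close> and \<open>(1 - g'\<^sup>2) / g\<^sup>2\<close>
  (\<open>negatively_curved_rot_metric\<close>), so convexity of \<open>g\<close> is needed. For the above \<open>g\<close> this is a cubic inequality in
  \<open>u\<^sup>2\<close> whose coefficients depend on the dimension, and it holds from dimension \<open>8\<close> on
  (\<open>convexity_polynomial\<close>). For larger \<open>u\<close> the function \<open>g\<close> is free. Writing \<open>g(u) = u p(u\<^sup>2)\<close>, convexity becomes a one-sided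
  bound on the logarithmic derivative of \<open>p'\<close>, which permits a cutoff (\<open>target_profile\<close>).

  \<^emph>\<open>Compact support.\<close> Outside the light cone the self-similar solution is cut off at time \<open>0\<close>. The error is
  repaired by a correction, which is needed only for short times and lives in a shell away from the origin. There the
  radial equation is, after multiplication with a power of \<open>r\<close>, a one-dimensional semilinear wave equation whose
  nonlinearity contains no derivatives. It is solved in null coordinates by a contraction (\<open>goursat\<close>), and finite speed of
  propagation keeps the correction out of the light cone (\<open>localised_wave\<close>, \<open>blowup_profile\<close>).\<close>


section \<open>Calculus of smooth functions\<close>

lemma dir_deriv_eq:
  assumes "open S" "x \<in> S" "(f has_derivative f') (at x)"
  shows "dir_deriv S f v x = f' v"
  using assms by (metis at_within_open dir_deriv_def frechet_derivative_at)

lemma dir_deriv_cong: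
  assumes "\<And>x. x \<in> S \<Longrightarrow> f x = g x" "x \<in> S"
  shows "dir_deriv S f v x = dir_deriv S g v x"
proof -
  have "(f has_derivative f') (at x within S) \<longleftrightarrow> (g has_derivative f') (at x within S)" for f'
    using assms by (metis has_derivative_transform)
  then show ?thesis by (simp add: dir_deriv_def frechet_derivative_def)
qed

lemma Ck_on_cong:
  assumes "\<And>x. x \<in> S \<Longrightarrow> f x = g x"
  shows "Ck_on k S f \<longleftrightarrow> Ck_on k S g"
  using assms
proof (induction k arbitrary: f g)
  case 0
  then show ?case by (simp cong: continuous_on_cong)
next
  case (Suc k)
  have "f differentiable_on S \<longleftrightarrow> g differentiable_on S"
    using Suc.prems unfolding differentiable_on_def differentiable_def
    by (metis has_derivative_transform)
  moreover have "Ck_on k S (dir_deriv S f v) \<longleftrightarrow> Ck_on k S (dir_deriv S g v)" for v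
    by (rule Suc.IH, rule dir_deriv_cong) (use Suc.prems in auto)
  ultimately show ?case by simp
qed

lemma Ck_on_SucI:
  assumes "open S" "\<And>x. x \<in> S \<Longrightarrow> (f has_derivative f' x) (at x)"
    "\<And>v. Ck_on k S (\<lambda>x. f' x v)"
  shows "Ck_on (Suc k) S f"
proof -
  have "Ck_on k S (dir_deriv S f v)" for v
    using assms(3)[of v] Ck_on_cong[of S "dir_deriv S f v" "\<lambda>x. f' x v" k]
      dir_deriv_eq[OF assms(1) _ assms(2)] by auto
  moreover have "f differentiable_on S"
    unfolding differentiable_on_def
    using assms(2) by (meson differentiable_at_withinI differentiableI)
  ultimately show ?thesis by simp
qed

lemma Ck_on_Suc_has_derivative:
  assumes "open S" "Ck_on (Suc k) S f" "x \<in> S"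
  shows "(f has_derivative (\<lambda>v. dir_deriv S f v x)) (at x)"
proof -
  have "f differentiable (at x within S)"
    using assms by (simp add: differentiable_on_def)
  then have "(f has_derivative frechet_derivative f (at x within S)) (at x within S)"
    using frechet_derivative_works by blast
  then show ?thesis using at_within_open[OF assms(3,1)] by (simp add: dir_deriv_def)
qed

lemma Ck_on_Suc_dir_deriv: "Ck_on (Suc k) S f \<Longrightarrow> Ck_on k S (dir_deriv S f v)"
  by simp

lemma Ck_on_imp_continuous_on: "Ck_on k S f \<Longrightarrow> continuous_on S f"
  by (cases k) (auto intro: differentiable_imp_continuous_on)

lemma Ck_on_Suc_imp: "Ck_on (Suc k) S f \<Longrightarrow> Ck_on k S f"
proof (induction k arbitrary: f)
  case 0
  then show ?case by (auto intro: differentiable_imp_continuous_on)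
next
  case (Suc k)
  then have "Ck_on k S (dir_deriv S f v)" for v by simp
  then show ?case using Suc by simp
qed

text \<open>On such sets derivatives within the set are unique; open sets and relatively open parts of
  a half-space are examples.\<close>

definition thick :: "'a::euclidean_space set \<Rightarrow> bool" where
  "thick S \<longleftrightarrow> (\<forall>x\<in>S. \<forall>i\<in>Basis. \<forall>e>0. \<exists>d. 0 < \<bar>d\<bar> \<and> \<bar>d\<bar> < e \<and> x + d *\<^sub>R i \<in> S)"

text \<open>A derivative in the full sense restricts to the derivative within a thick set. Solutions are
  therefore constructed on open sets, for negative times as well, and restricted to \<open>t \<ge> 0\<close> only at the end.\<close>

lemma dir_deriv_within:
  assumes "thick T" "x \<in> T" "(f has_derivative f') (at x)"
  shows "dir_deriv T f v x = f' v"
proof -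
  have 1: "(f has_derivative f') (at x within T)" using assms(3) has_derivative_at_withinI by blast
  then have "(f has_derivative frechet_derivative f (at x within T)) (at x within T)"
    using differentiableI frechet_derivative_works by blast
  from frechet_derivative_unique_within[OF 1 this] assms(1,2)
  show ?thesis unfolding thick_def dir_deriv_def by metis
qed

lemma Ck_on_thick_subset:
  assumes "open S" "T \<subseteq> S" "thick T" "Ck_on k S f"
  shows "Ck_on k T f"
  using assms(4)
proof (induction k arbitrary: f)
  case 0
  then show ?case using assms(2) by (auto intro: continuous_on_subset)
next
  case (Suc k)
  have d: "(f has_derivative (\<lambda>v. dir_deriv S f v x)) (at x)" if "x \<in> T" for x
    using Ck_on_Suc_has_derivative[OF assms(1) Suc.prems] assms(2) that by auto
  have "Ck_on k T (dir_deriv S f v)" for v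
    using Suc by simp
  moreover have "dir_deriv T f v x = dir_deriv S f v x" if "x \<in> T" for v x
    using dir_deriv_within[OF assms(3) that d[OF that]] .
  ultimately have "Ck_on k T (dir_deriv T f v)" for v
    using Ck_on_cong[of T "dir_deriv T f v" "dir_deriv S f v" k] by auto
  moreover have "f differentiable_on T"
    using d by (meson differentiable_at_imp_differentiable_on differentiableI)
  ultimately show ?case by simp
qed

lemma Ck_on_subset:
  assumes "open S" "open T" "T \<subseteq> S" "Ck_on k S f"
  shows "Ck_on k T f"
  using assms(4)
proof (induction k arbitrary: f)
  case 0
  then show ?case using assms(3) by (auto intro: continuous_on_subset)
next
  case (Suc k)
  show ?case
  proof (rule Ck_on_SucI[OF assms(2), where f' = "\<lambda>x v. dir_deriv S f v x"])
    show "(f has_derivative (\<lambda>v. dir_deriv S f v x)) (at x)" if "x \<in> T" for x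
      by (rule Ck_on_Suc_has_derivative[OF assms(1) Suc.prems]) (use assms(3) that in blast)
    show "Ck_on k T (\<lambda>x. dir_deriv S f v x)" for v
      by (rule Suc.IH[OF Ck_on_Suc_dir_deriv[OF Suc.prems]])
  qed
qed

lemma Ck_on_local:
  assumes "open S" "\<And>x. x \<in> S \<Longrightarrow> \<exists>V. open V \<and> x \<in> V \<and> Ck_on k V f"
  shows "Ck_on k S f"
  using assms(2)
proof (induction k arbitrary: f)
  case 0
  then show ?case
    by (metis Ck_on.simps(1) assms(1) continuous_at_imp_continuous_on continuous_on_eq_continuous_at)
next
  case (Suc k)
  have d: "f differentiable (at x)" if "x \<in> S" for x
    using Suc.prems[OF that] by (meson Ck_on_Suc_has_derivative differentiableI)
  have *: "dir_deriv S f v x = dir_deriv V f v x" if "open V" "x \<in> V" "x \<in> S" for v x V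
    unfolding dir_deriv_def at_within_open[OF that(2,1)] at_within_open[OF that(3) assms(1)] ..
  have "Ck_on k S (dir_deriv S f v)" for v
  proof (rule Suc.IH)
    fix x assume x: "x \<in> S"
    then obtain V where V: "open V" "x \<in> V" "Ck_on (Suc k) V f" using Suc.prems by blast
    have "Ck_on k (V \<inter> S) (dir_deriv V f v)"
      using V assms(1) by (intro Ck_on_subset[of V "V \<inter> S"]) auto
    moreover have "Ck_on k (V \<inter> S) (dir_deriv S f v) = Ck_on k (V \<inter> S) (dir_deriv V f v)"
      by (rule Ck_on_cong) (use * V in auto)
    ultimately show "\<exists>V. open V \<and> x \<in> V \<and> Ck_on k V (dir_deriv S f v)"
      using V x assms(1) by (intro exI[of _ "V \<inter> S"]) auto
  qed
  then show ?case using d by (auto intro: differentiable_at_imp_differentiable_on)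
qed

lemma Ck_on_const: "open S \<Longrightarrow> Ck_on k S (\<lambda>x. c)"
proof (induction k arbitrary: c)
  case (Suc k)
  then show ?case by (intro Ck_on_SucI[where f' = "\<lambda>x v. 0"]) auto
qed simp

lemma Ck_on_linear:
  assumes "bounded_linear L" "open S"
  shows "Ck_on k S L"
proof (cases k)
  case 0
  then show ?thesis using assms by (simp add: linear_continuous_on)
next
  case (Suc j)
  show ?thesis unfolding Suc
    by (rule Ck_on_SucI[where f' = "\<lambda>x. L"])
      (use assms in \<open>auto intro: Ck_on_const bounded_linear_imp_has_derivative\<close>)
qed

lemma Ck_on_linear_compose:
  assumes "bounded_linear L" "open S" "Ck_on k S f"
  shows "Ck_on k S (\<lambda>x. L (f x))"
  using assms(3)
proof (induction k arbitrary: f)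
  case 0
  then show ?case using assms by (auto intro: bounded_linear.continuous_on)
next
  case (Suc k)
  show ?case
  proof (rule Ck_on_SucI[OF assms(2), where f' = "\<lambda>x v. L (dir_deriv S f v x)"])
    show "((\<lambda>x. L (f x)) has_derivative (\<lambda>v. L (dir_deriv S f v x))) (at x)" if "x \<in> S" for x
      by (rule bounded_linear.has_derivative[OF assms(1)
        Ck_on_Suc_has_derivative[OF assms(2) Suc.prems that]])
    show "Ck_on k S (\<lambda>x. L (dir_deriv S f v x))" for v
      by (rule Suc.IH[OF Ck_on_Suc_dir_deriv[OF Suc.prems]])
  qed
qed

lemma Ck_on_add:
  assumes "open S" "Ck_on k S f" "Ck_on k S g"
  shows "Ck_on k S (\<lambda>x. f x + g x)"
  using assms(2,3)
proof (induction k arbitrary: f g)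
  case 0
  then show ?case by (auto intro: continuous_intros)
next
  case (Suc k)
  show ?case
  proof (rule Ck_on_SucI[OF assms(1), where f' = "\<lambda>x v. dir_deriv S f v x + dir_deriv S g v x"])
    show "((\<lambda>x. f x + g x) has_derivative (\<lambda>v. dir_deriv S f v x + dir_deriv S g v x)) (at x)"
      if "x \<in> S" for x
      by (rule has_derivative_add[OF Ck_on_Suc_has_derivative[OF assms(1) Suc.prems(1) that]
        Ck_on_Suc_has_derivative[OF assms(1) Suc.prems(2) that]])
    show "Ck_on k S (\<lambda>x. dir_deriv S f v x + dir_deriv S g v x)" for v
      by (rule Suc.IH[OF Suc.prems[THEN Ck_on_Suc_dir_deriv]])
  qed
qed

lemma Ck_on_sum:
  assumes "open S" "\<And>i. i \<in> I \<Longrightarrow> Ck_on k S (f i)"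
  shows "Ck_on k S (\<lambda>x. \<Sum>i\<in>I. f i x)"
  using assms(2)
  by (induction I rule: infinite_finite_induct) (auto intro: Ck_on_const Ck_on_add assms(1))

lemma Ck_on_bilinear:
  assumes "bounded_bilinear p" "open S" "Ck_on k S f" "Ck_on k S g"
  shows "Ck_on k S (\<lambda>x. p (f x) (g x))"
  using assms(3,4)
proof (induction k arbitrary: f g)
  case 0
  then show ?case using bounded_bilinear.continuous_on[OF assms(1)] by auto
next
  case (Suc k)
  show ?case
  proof (rule Ck_on_SucI[OF assms(2), where f' = "\<lambda>x v. p (f x) (dir_deriv S g v x) + p (dir_deriv S f v x) (g x)"])
    show "((\<lambda>x. p (f x) (g x)) has_derivative
        (\<lambda>v. p (f x) (dir_deriv S g v x) + p (dir_deriv S f v x) (g x))) (at x)" if "x \<in> S" for x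
      using bounded_bilinear.FDERIV[OF assms(1)
        Ck_on_Suc_has_derivative[OF assms(2) Suc.prems(1) that]
        Ck_on_Suc_has_derivative[OF assms(2) Suc.prems(2) that]] .
    show "Ck_on k S (\<lambda>x. p (f x) (dir_deriv S g v x) + p (dir_deriv S f v x) (g x))" for v
      by (intro Ck_on_add assms(2) Suc.IH[OF Ck_on_Suc_imp[OF Suc.prems(1)] Ck_on_Suc_dir_deriv[OF Suc.prems(2)]]
        Suc.IH[OF Ck_on_Suc_dir_deriv[OF Suc.prems(1)] Ck_on_Suc_imp[OF Suc.prems(2)]])
  qed
qed

text \<open>In coordinates the chain rule writes the derivative of the composition as a finite sum of products
  of the partial derivatives of \<open>g\<close>, composed with \<open>f\<close>, and derivatives of \<open>f\<close>; all of them are covered by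
  the induction hypothesis.\<close>

lemma Ck_on_compose:
  fixes f :: "'a::real_normed_vector \<Rightarrow> 'b::euclidean_space"
    and g :: "'b \<Rightarrow> 'c::real_normed_vector"
  assumes "open S" "open T" "f ` S \<subseteq> T" "Ck_on k S f" "Ck_on k T g"
  shows "Ck_on k S (\<lambda>x. g (f x))"
  using assms(4,5)
proof (induction k arbitrary: g)
  case 0
  then show ?case using assms(3) by (auto intro: continuous_on_compose2)
next
  case (Suc k)
  let ?f' = "\<lambda>x v. \<Sum>i\<in>Basis. (dir_deriv S f v x \<bullet> i) *\<^sub>R dir_deriv T g i (f x)"
  show ?case
  proof (rule Ck_on_SucI[OF assms(1), where f' = ?f'])
    fix x assume x: "x \<in> S"
    have g': "(g has_derivative (\<lambda>v. dir_deriv T g v (f x))) (at (f x))"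
      by (rule Ck_on_Suc_has_derivative[OF assms(2) Suc.prems(2)]) (use x assms(3) in auto)
    have lin: "linear (\<lambda>v. dir_deriv T g v (f x))"
      using g' has_derivative_linear by blast
    have "dir_deriv T g w (f x) = (\<Sum>i\<in>Basis. (w \<bullet> i) *\<^sub>R dir_deriv T g i (f x))" for w
    proof -
      have "dir_deriv T g w (f x) = dir_deriv T g (\<Sum>i\<in>Basis. (w \<bullet> i) *\<^sub>R i) (f x)"
        by (simp add: euclidean_representation)
      also have "\<dots> = (\<Sum>i\<in>Basis. (w \<bullet> i) *\<^sub>R dir_deriv T g i (f x))"
        by (simp only: linear_sum[OF lin] linear_scale[OF lin])
      finally show ?thesis .
    qed
    then have "(\<lambda>v. dir_deriv T g (dir_deriv S f v x) (f x)) = ?f' x" by blast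
    moreover have "((\<lambda>x. g (f x)) has_derivative (\<lambda>v. dir_deriv T g (dir_deriv S f v x) (f x))) (at x)"
      by (rule has_derivative_compose[OF Ck_on_Suc_has_derivative[OF assms(1) Suc.prems(1) x] g'])
    ultimately show "((\<lambda>x. g (f x)) has_derivative ?f' x) (at x)" by (simp only:)
  next
    fix v
    have "Ck_on k S (\<lambda>x. dir_deriv T g i (f x))" for i
      by (rule Suc.IH[OF Ck_on_Suc_imp[OF Suc.prems(1)] Ck_on_Suc_dir_deriv[OF Suc.prems(2)]])
    moreover have "Ck_on k S (\<lambda>x. dir_deriv S f v x \<bullet> i)" for i
      by (rule Ck_on_linear_compose[OF bounded_linear_inner_left assms(1) Ck_on_Suc_dir_deriv[OF Suc.prems(1)]])
    ultimately show "Ck_on k S (\<lambda>x. ?f' x v)"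
      by (intro Ck_on_sum assms(1) Ck_on_bilinear[OF bounded_bilinear_scaleR]) auto
  qed
qed

subsection \<open>Smooth functions on open sets\<close>

lemma smooth_on_cong: "(\<And>x. x \<in> S \<Longrightarrow> f x = g x) \<Longrightarrow> smooth_on S f \<longleftrightarrow> smooth_on S g"
  unfolding smooth_on_def using Ck_on_cong by blast

lemma smooth_on_eqI: "smooth_on S g \<Longrightarrow> (\<And>x. x \<in> S \<Longrightarrow> f x = g x) \<Longrightarrow> smooth_on S f"
  using smooth_on_cong by metis

lemma smooth_on_const [intro]: "open S \<Longrightarrow> smooth_on S (\<lambda>x. c)"
  by (simp add: smooth_on_def Ck_on_const)

lemma smooth_on_linear: "bounded_linear L \<Longrightarrow> open S \<Longrightarrow> smooth_on S L"
  by (simp add: smooth_on_def Ck_on_linear)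

lemma smooth_on_id [intro]: "open S \<Longrightarrow> smooth_on S (\<lambda>x. x)"
  by (intro smooth_on_linear bounded_linear_ident)

lemma smooth_on_linear_compose:
  "bounded_linear L \<Longrightarrow> open S \<Longrightarrow> smooth_on S f \<Longrightarrow> smooth_on S (\<lambda>x. L (f x))"
  by (simp add: smooth_on_def Ck_on_linear_compose)

lemma smooth_on_bilinear:
  "bounded_bilinear p \<Longrightarrow> open S \<Longrightarrow> smooth_on S f \<Longrightarrow> smooth_on S g \<Longrightarrow> smooth_on S (\<lambda>x. p (f x) (g x))"
  by (simp add: smooth_on_def Ck_on_bilinear)

lemma smooth_on_add [intro]: "open S \<Longrightarrow> smooth_on S f \<Longrightarrow> smooth_on S g \<Longrightarrow> smooth_on S (\<lambda>x. f x + g x)"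
  by (simp add: smooth_on_def Ck_on_add)

lemma smooth_on_uminus [intro]: "open S \<Longrightarrow> smooth_on S f \<Longrightarrow> smooth_on S (\<lambda>x. - f x)"
  by (rule smooth_on_linear_compose[OF bounded_linear_minus[OF bounded_linear_ident]])

lemma smooth_on_diff [intro]:
  assumes "open S" "smooth_on S f" "smooth_on S g" shows "smooth_on S (\<lambda>x. f x - g x)"
  using smooth_on_add[OF assms(1,2) smooth_on_uminus[OF assms(1,3)]] by simp

lemma smooth_on_sum [intro]:
  "open S \<Longrightarrow> (\<And>i. i \<in> I \<Longrightarrow> smooth_on S (f i)) \<Longrightarrow> smooth_on S (\<lambda>x. \<Sum>i\<in>I. f i x)"
  by (simp add: smooth_on_def Ck_on_sum)

lemma smooth_on_mult [intro]:
  fixes f g :: "'a::real_normed_vector \<Rightarrow> 'b::real_normed_algebra"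
  shows "open S \<Longrightarrow> smooth_on S f \<Longrightarrow> smooth_on S g \<Longrightarrow> smooth_on S (\<lambda>x. f x * g x)"
  by (rule smooth_on_bilinear[OF bounded_bilinear_mult])

lemma smooth_on_scaleR [intro]:
  "open S \<Longrightarrow> smooth_on S f \<Longrightarrow> smooth_on S g \<Longrightarrow> smooth_on S (\<lambda>x. f x *\<^sub>R g x)"
  by (rule smooth_on_bilinear[OF bounded_bilinear_scaleR])

lemma smooth_on_inner [intro]:
  fixes f g :: "'a::real_normed_vector \<Rightarrow> 'b::real_inner"
  shows "open S \<Longrightarrow> smooth_on S f \<Longrightarrow> smooth_on S g \<Longrightarrow> smooth_on S (\<lambda>x. f x \<bullet> g x)"
  by (rule smooth_on_bilinear[OF bounded_bilinear_inner])

lemma smooth_on_power [intro]: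
  fixes f :: "'a::real_normed_vector \<Rightarrow> real"
  shows "open S \<Longrightarrow> smooth_on S f \<Longrightarrow> smooth_on S (\<lambda>x. f x ^ m)"
  by (induction m) auto

lemma smooth_on_fst [intro]: "open S \<Longrightarrow> smooth_on S f \<Longrightarrow> smooth_on S (\<lambda>x. fst (f x))"
  by (rule smooth_on_linear_compose[OF bounded_linear_fst])

lemma smooth_on_snd [intro]: "open S \<Longrightarrow> smooth_on S f \<Longrightarrow> smooth_on S (\<lambda>x. snd (f x))"
  by (rule smooth_on_linear_compose[OF bounded_linear_snd])

lemma smooth_on_vec_nth [intro]: "open S \<Longrightarrow> smooth_on S f \<Longrightarrow> smooth_on S (\<lambda>x. f x $ i)"
  by (rule smooth_on_linear_compose[OF bounded_linear_vec_nth])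

lemma smooth_on_Pair [intro]:
  assumes "open S" "smooth_on S f" "smooth_on S g"
  shows "smooth_on S (\<lambda>x. (f x, g x))"
proof -
  have "smooth_on S (\<lambda>x. (f x, 0) + (0, g x))"
    by (intro smooth_on_add assms smooth_on_linear_compose[of "\<lambda>y. (y, 0)"]
      smooth_on_linear_compose[of "\<lambda>y. (0, y)"] bounded_linear_Pair bounded_linear_ident
      bounded_linear_zero)
  then show ?thesis by simp
qed

lemma smooth_on_compose:
  fixes f :: "'a::real_normed_vector \<Rightarrow> 'b::euclidean_space"
  assumes "smooth_on T g" "open S" "open T" "smooth_on S f" "\<And>x. x \<in> S \<Longrightarrow> f x \<in> T"
  shows "smooth_on S (\<lambda>x. g (f x))"
  unfolding smooth_on_def
proof
  fix k
  have "f ` S \<subseteq> T" using assms(5) by blast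
  then show "Ck_on k S (\<lambda>x. g (f x))"
    using Ck_on_compose[OF assms(2,3), of f k g] assms(1,4) by (simp only: smooth_on_def)
qed

lemma smooth_on_subset: "open S \<Longrightarrow> open T \<Longrightarrow> T \<subseteq> S \<Longrightarrow> smooth_on S f \<Longrightarrow> smooth_on T f"
  unfolding smooth_on_def using Ck_on_subset by blast

lemma smooth_on_thick_subset:
  "open S \<Longrightarrow> T \<subseteq> S \<Longrightarrow> thick T \<Longrightarrow> smooth_on S f \<Longrightarrow> smooth_on T f"
  unfolding smooth_on_def using Ck_on_thick_subset by blast

lemma smooth_on_local:
  assumes "open S" "\<And>x. x \<in> S \<Longrightarrow> \<exists>V. open V \<and> x \<in> V \<and> smooth_on V f"
  shows "smooth_on S f"
  using assms unfolding smooth_on_def by (metis Ck_on_local)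

lemma smooth_on_imp_continuous_on: "smooth_on S f \<Longrightarrow> continuous_on S f"
  unfolding smooth_on_def using Ck_on_imp_continuous_on by blast

lemma smooth_on_has_derivative:
  "open S \<Longrightarrow> smooth_on S f \<Longrightarrow> x \<in> S \<Longrightarrow> (f has_derivative (\<lambda>v. dir_deriv S f v x)) (at x)"
  unfolding smooth_on_def using Ck_on_Suc_has_derivative by blast

lemma smooth_on_dir_deriv [intro]: "smooth_on S f \<Longrightarrow> smooth_on S (dir_deriv S f v)"
  unfolding smooth_on_def using Ck_on.simps(2) by blast

subsection \<open>Functions of one real variable\<close>

lemma Ck_on_real_SucI:
  fixes f :: "real \<Rightarrow> real"
  assumes "open S" "\<And>x. x \<in> S \<Longrightarrow> (f has_real_derivative f' x) (at x)" "Ck_on k S f'"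
  shows "Ck_on (Suc k) S f"
proof (rule Ck_on_SucI[OF assms(1), where f' = "\<lambda>x v. f' x * v"])
  show "(f has_derivative (*) (f' x)) (at x)" if "x \<in> S" for x
    using assms(2)[OF that] by (simp add: has_field_derivative_def)
  show "Ck_on k S (\<lambda>x. f' x * v)" for v
    by (rule Ck_on_linear_compose[OF bounded_linear_mult_left assms(1,3)])
qed

lemma smooth_on_realI:
  fixes f :: "real \<Rightarrow> real"
  assumes "open S" "\<And>x. x \<in> S \<Longrightarrow> (f has_real_derivative f' x) (at x)" "smooth_on S f'"
  shows "smooth_on S f"
  unfolding smooth_on_def
  using Ck_on_real_SucI[OF assms(1,2)] assms(3) by (metis Ck_on_Suc_imp smooth_on_def)

lemma smooth_on_has_real_derivative:
  fixes f :: "real \<Rightarrow> real"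
  assumes "open S" "smooth_on S f" "x \<in> S"
  shows "(f has_real_derivative dir_deriv S f 1 x) (at x)"
proof -
  have d: "(f has_derivative (\<lambda>v. dir_deriv S f v x)) (at x)"
    using smooth_on_has_derivative[OF assms] .
  then have "linear (\<lambda>v. dir_deriv S f v x)" using has_derivative_linear by blast
  then have "dir_deriv S f v x = dir_deriv S f 1 x * v" for v
    using linear_scale[of "\<lambda>v. dir_deriv S f v x" v 1] by (simp add: mult.commute)
  then have "(\<lambda>v. dir_deriv S f v x) = (*) (dir_deriv S f 1 x)" by blast
  then show ?thesis using d by (simp add: has_field_derivative_def)
qed

lemma smooth_on_exp_real: "smooth_on UNIV (exp :: real \<Rightarrow> real)"
proof -
  have "Ck_on k UNIV (exp :: real \<Rightarrow> real)" for k
  proof (induction k)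
    case (Suc k)
    show ?case by (rule Ck_on_real_SucI[where f' = exp, OF _ _ Suc]) (auto intro: DERIV_exp)
  qed (auto intro!: continuous_intros)
  then show ?thesis by (simp add: smooth_on_def)
qed

text \<open>The derivatives of the reciprocal and of the square root are products of these functions
  themselves, so each order of differentiability implies the next one.\<close>

lemma smooth_on_inverse_real: "smooth_on {x::real. x \<noteq> 0} inverse"
proof -
  have o: "open {x::real. x \<noteq> 0}" by (simp add: open_Collect_neq)
  have "Ck_on k {x::real. x \<noteq> 0} inverse" for k
  proof (induction k)
    case (Suc k)
    have "Ck_on k {x::real. x \<noteq> 0} (\<lambda>x. - (inverse x * inverse x))"
      by (intro Ck_on_linear_compose[OF bounded_linear_minus[OF bounded_linear_ident] o]
        Ck_on_bilinear[OF bounded_bilinear_mult] o Suc)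
    then show ?case
      by (rule Ck_on_real_SucI[OF o, rotated]) (auto intro!: derivative_eq_intros simp: power2_eq_square simp del: Ck_on.simps)
  qed (auto intro!: continuous_intros)
  then show ?thesis by (simp add: smooth_on_def)
qed

lemma smooth_on_sqrt_real: "smooth_on {0::real<..} sqrt"
proof -
  have i: "Ck_on k {0::real<..} inverse" for k
    by (rule Ck_on_subset[of "{x. x \<noteq> 0}"])
      (use smooth_on_inverse_real in \<open>auto simp: smooth_on_def open_Collect_neq\<close>)
  have "Ck_on k {0::real<..} sqrt" for k
  proof (induction k)
    case (Suc k)
    have "Ck_on k {0::real<..} (\<lambda>x. inverse (sqrt x))"
      by (rule Ck_on_compose[OF _ _ _ Suc i]) auto
    then have "Ck_on k {0::real<..} (\<lambda>x. inverse (sqrt x) / 2)"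
      by (intro Ck_on_linear_compose[OF bounded_linear_divide]) auto
    then show ?case
      by (rule Ck_on_real_SucI[rotated 2]) (auto intro!: derivative_eq_intros simp: field_simps simp del: Ck_on.simps)
  qed (auto intro!: continuous_intros)
  then show ?thesis by (simp add: smooth_on_def)
qed

lemma smooth_on_ln_real: "smooth_on {0::real<..} ln"
  by (rule smooth_on_realI[where f' = inverse])
    (auto intro!: derivative_eq_intros smooth_on_subset[OF _ _ _ smooth_on_inverse_real]
      simp: open_Collect_neq divide_inverse)

lemma smooth_on_exp [intro]: "open S \<Longrightarrow> smooth_on S f \<Longrightarrow> smooth_on S (\<lambda>x. exp (f x :: real))"
  by (rule smooth_on_compose[OF smooth_on_exp_real]) auto

lemma smooth_on_inverse [intro]:
  "open S \<Longrightarrow> smooth_on S f \<Longrightarrow> (\<And>x. x \<in> S \<Longrightarrow> f x \<noteq> 0) \<Longrightarrow> smooth_on S (\<lambda>x. inverse (f x :: real))"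
  by (rule smooth_on_compose[OF smooth_on_inverse_real]) (auto simp: open_Collect_neq)

lemma smooth_on_divide [intro]:
  assumes "open S" "smooth_on S f" "smooth_on S g" "\<And>x. x \<in> S \<Longrightarrow> g x \<noteq> 0"
  shows "smooth_on S (\<lambda>x. f x / g x :: real)"
  using smooth_on_mult[OF assms(1,2) smooth_on_inverse[OF assms(1,3,4)]]
  by (simp add: divide_inverse)

lemma smooth_on_sqrt [intro]:
  "open S \<Longrightarrow> smooth_on S f \<Longrightarrow> (\<And>x. x \<in> S \<Longrightarrow> f x > 0) \<Longrightarrow> smooth_on S (\<lambda>x. sqrt (f x))"
  by (rule smooth_on_compose[OF smooth_on_sqrt_real]) auto

lemma smooth_on_powr [intro]:
  fixes f :: "'a::real_normed_vector \<Rightarrow> real"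
  assumes "open S" "smooth_on S f" "\<And>x. x \<in> S \<Longrightarrow> f x > 0"
  shows "smooth_on S (\<lambda>x. f x powr a)"
proof -
  have "smooth_on S (\<lambda>x. exp (a * ln (f x)))"
    by (intro smooth_on_exp smooth_on_mult smooth_on_const assms
      smooth_on_compose[OF smooth_on_ln_real]) (use assms in auto)
  moreover have "exp (a * ln (f x)) = f x powr a" if "x \<in> S" for x
    using assms(3)[OF that] by (simp add: powr_def)
  ultimately show ?thesis using smooth_on_cong by (metis (no_types, lifting))
qed

section \<open>Cutoff functions\<close>

text \<open>For \<open>x > 0\<close> this is \<open>exp (- 1 / x) / x ^ m\<close>. The negative powers are included because the
  derivative of each of these functions is a combination of two others, which makes all of them smooth at once.\<close>

definition flat :: "nat \<Rightarrow> real \<Rightarrow> real" where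
  "flat m x = (if x > 0 then exp (- inverse x) * inverse x ^ m else 0)"

lemma flat_nonneg: "flat m x \<ge> 0"
  by (simp add: flat_def)

text \<open>With \<open>N = m + 2\<close>, the inequality \<open>exp y \<ge> (1 + y / N) ^ N\<close> at \<open>y = 1 / x\<close> beats the power \<open>x ^ m\<close> in
  the denominator by two orders. A quadratic bound yields the derivative \<open>0\<close> at the origin.\<close>

lemma flat_le: "flat m x \<le> real (m + 2) ^ (m + 2) * x\<^sup>2"
proof (cases "x > 0")
  case True
  define N where "N = m + 2"
  have N: "N > 0" by (simp add: N_def)
  have "(inverse x / real N) ^ N \<le> (1 + inverse x / real N) ^ N"
    using True by (intro power_mono) auto
  also have "\<dots> \<le> exp (inverse x)"
    using True N by (intro exp_ge_one_plus_x_over_n_power_n) (auto intro: order_trans[of _ 0])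
  finally have "inverse x ^ N \<le> exp (inverse x) * real N ^ N"
    using N by (simp add: power_divide divide_le_eq del: power_inverse)
  moreover have "inverse x ^ N = inverse x ^ m * inverse (x\<^sup>2)"
    by (simp add: N_def power_add power2_eq_square)
  ultimately have "inverse x ^ m * inverse (x\<^sup>2) * x\<^sup>2 \<le> exp (inverse x) * real N ^ N * x\<^sup>2"
    by (intro mult_right_mono) simp_all
  moreover have "inverse x ^ m * inverse (x\<^sup>2) * x\<^sup>2 = inverse x ^ m"
    using True by simp
  ultimately have "inverse x ^ m \<le> exp (inverse x) * real N ^ N * x\<^sup>2"
    by (simp only:)
  then have "exp (- inverse x) * inverse x ^ m \<le> exp (- inverse x) * (exp (inverse x) * real N ^ N * x\<^sup>2)"
    by (rule mult_left_mono) simp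
  also have "\<dots> = real N ^ N * x\<^sup>2"
    by (simp flip: mult.assoc exp_add)
  finally show ?thesis using True by (simp add: flat_def N_def)
qed (simp add: flat_def)

lemma flat_has_derivative:
  "(flat m has_real_derivative (flat (m + 2) x - real m * flat (m + 1) x)) (at x)"
proof -
  consider "x > 0" | "x < 0" | "x = 0" by linarith
  then show ?thesis
  proof cases
    case 1
    have "((\<lambda>x. exp (- inverse x) * inverse x ^ m) has_real_derivative
        (flat (m + 2) x - real m * flat (m + 1) x)) (at x)"
    proof -
      have "((\<lambda>x. exp (- inverse x)) has_real_derivative exp (- inverse x) * inverse x ^ 2) (at x)"
        using 1 by (auto intro!: derivative_eq_intros simp: power2_eq_square)
      moreover have "((\<lambda>x. inverse x ^ m) has_real_derivative - real m * inverse x ^ (m + 1)) (at x)"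
      proof (cases m)
        case (Suc k)
        have "((\<lambda>x. inverse x ^ m) has_real_derivative
            real m * (- (inverse x * 1 * inverse x) * inverse x ^ (m - Suc 0))) (at x)"
          by (rule DERIV_power[OF DERIV_inverse'[OF DERIV_ident]]) (use 1 in simp)
        then show ?thesis by (simp add: Suc algebra_simps)
      qed simp
      ultimately have "((\<lambda>x. exp (- inverse x) * inverse x ^ m) has_real_derivative
          exp (- inverse x) * inverse x ^ 2 * inverse x ^ m + - real m * inverse x ^ (m + 1) * exp (- inverse x)) (at x)"
        by (rule DERIV_mult)
      then show ?thesis using 1 by (simp add: flat_def power_add algebra_simps power2_eq_square)
    qed
    then show ?thesis
      by (rule has_field_derivative_transform_within_open[of _ _ _ "{0<..}"])
        (use 1 in \<open>auto simp: flat_def\<close>)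
  next
    case 2
    have "((\<lambda>x. 0) has_real_derivative (flat (m + 2) x - real m * flat (m + 1) x)) (at x)"
      using 2 by (simp add: flat_def)
    then show ?thesis
      by (rule has_field_derivative_transform_within_open[of _ _ _ "{..<0}"])
        (use 2 in \<open>auto simp: flat_def\<close>)
  next
    case 3
    have "((\<lambda>h. (flat m (0 + h) - flat m 0) / h) \<longlongrightarrow> 0) (at 0)"
    proof (rule Lim_null_comparison)
      show "\<forall>\<^sub>F h in at 0. norm ((flat m (0 + h) - flat m 0) / h) \<le> real (m + 2) ^ (m + 2) * \<bar>h\<bar>"
      proof (rule always_eventually, rule allI)
        fix h :: real
        have "flat m h \<le> real (m + 2) ^ (m + 2) * (\<bar>h\<bar> * \<bar>h\<bar>)"
          using flat_le[of m h] by (simp add: power2_eq_square)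
        then show "norm ((flat m (0 + h) - flat m 0) / h) \<le> real (m + 2) ^ (m + 2) * \<bar>h\<bar>"
          using flat_nonneg[of m h] by (simp add: flat_def[of _ 0] divide_le_eq mult.assoc)
      qed
      show "((\<lambda>h::real. real (m + 2) ^ (m + 2) * \<bar>h\<bar>) \<longlongrightarrow> 0) (at 0)"
        by (intro tendsto_eq_intros) auto
    qed
    then show ?thesis using 3 by (simp add: DERIV_def flat_def)
  qed
qed

lemma smooth_flat: "smooth_on UNIV (flat m)"
proof -
  have "Ck_on k UNIV (flat m)" for k
  proof (induction k arbitrary: m)
    case 0
    then show ?case
      using DERIV_isCont[OF flat_has_derivative] by (auto simp: continuous_on_eq_continuous_at)
  next
    case (Suc k)
    have "Ck_on k UNIV (\<lambda>x. flat (m + 2) x + (- real m) * flat (m + 1) x)"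
      by (intro Ck_on_add Ck_on_linear_compose[OF bounded_linear_mult_right] Suc) auto
    then show ?case
      by (intro Ck_on_real_SucI[OF _ flat_has_derivative]) auto
  qed
  then show ?thesis by (simp add: smooth_on_def)
qed

text \<open>A smooth step that decreases from \<open>1\<close> on \<open>x \<le> a\<close> to \<open>0\<close> on \<open>b \<le> x\<close>.\<close>

definition step :: "real \<Rightarrow> real \<Rightarrow> real \<Rightarrow> real" where
  "step a b x = flat 0 (b - x) / (flat 0 (b - x) + flat 0 (x - a))"

lemma flat_pos: "x > 0 \<Longrightarrow> flat m x > 0"
  by (simp add: flat_def)

lemma step_denom_pos: "a < b \<Longrightarrow> flat 0 (b - x) + flat 0 (x - a) > 0"
  using flat_pos[of "b - x" 0] flat_pos[of "x - a" 0] flat_nonneg[of 0 "b - x"] flat_nonneg[of 0 "x - a"]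
  by (cases "x < b") auto

lemma smooth_step: "a < b \<Longrightarrow> smooth_on UNIV (step a b)"
  unfolding step_def using step_denom_pos[of a b]
  by (intro smooth_on_divide smooth_on_add smooth_on_compose[OF smooth_flat] smooth_on_diff)
    (auto simp: less_imp_neq[symmetric] dest: less_imp_neq)

lemma step_eq_1: "a < b \<Longrightarrow> x \<le> a \<Longrightarrow> step a b x = 1"
  using flat_pos[of "b - x" 0] by (simp add: step_def flat_def)

lemma step_eq_0: "b \<le> x \<Longrightarrow> step a b x = 0"
  by (simp add: step_def flat_def)

lemma step_bounds: "0 \<le> step a b x" "step a b x \<le> 1"
  using flat_nonneg[of 0 "b - x"] flat_nonneg[of 0 "x - a"]
  by (auto simp: step_def divide_le_eq_1)

section \<open>Antiderivatives and integrals with a parameter\<close>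

text \<open>The substitution \<open>y = x \<sigma>\<close> keeps the limits of integration fixed, and makes the integral
  from \<open>0\<close> to \<open>x\<close> signed.\<close>

definition prim :: "(real \<Rightarrow> real) \<Rightarrow> real \<Rightarrow> real" where
  "prim f x = x * integral {0..1} (\<lambda>\<sigma>. f (x * \<sigma>))"

lemma prim_0 [simp]: "prim f 0 = 0"
  by (simp add: prim_def)

text \<open>The chain rule turns the integrand \<open>x * f (x * \<sigma>)\<close> into the derivative in \<open>\<sigma>\<close> of an
  antiderivative \<open>G\<close> at \<open>x * \<sigma>\<close>, whence \<open>prim f x = G x - G 0\<close> on a bounded interval around \<open>x\<close>.\<close>

lemma prim_has_derivative:
  assumes "continuous_on UNIV f"
  shows "(prim f has_real_derivative f x) (at x)"
proof -
  define M where "M = \<bar>x\<bar> + 1"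
  obtain G where G: "\<And>y. y \<in> {-M..M} \<Longrightarrow> (G has_vector_derivative f y) (at y within {-M..M})"
    using antiderivative_continuous[of "-M" M f] assms continuous_on_subset by blast
  have eq: "prim f y = G y - G 0" if "y \<in> {-M..M}" for y
  proof -
    have sub: "(\<lambda>\<sigma>. y * \<sigma>) ` {0..1} \<subseteq> {-M..M}"
    proof safe
      fix \<sigma> :: real assume "\<sigma> \<in> {0..1}"
      then have "\<bar>y * \<sigma>\<bar> \<le> \<bar>y\<bar>" by (auto simp: abs_mult intro: mult_left_le)
      then show "y * \<sigma> \<in> {-M..M}" using that by auto
    qed
    have "((\<lambda>\<sigma>. G (y * \<sigma>)) has_vector_derivative y * f (y * \<sigma>)) (at \<sigma> within {0..1})"
      if "\<sigma> \<in> {0..1}" for \<sigma>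
    proof -
      have "((\<lambda>\<sigma>. y * \<sigma>) has_vector_derivative y) (at \<sigma> within {0..1})"
        by (auto intro!: derivative_eq_intros)
      moreover have "(G has_vector_derivative f (y * \<sigma>)) (at (y * \<sigma>) within (\<lambda>\<sigma>. y * \<sigma>) ` {0..1})"
        by (rule has_vector_derivative_within_subset[OF G sub]) (use sub that in blast)
      ultimately show ?thesis
        using vector_diff_chain_within[of "\<lambda>\<sigma>. y * \<sigma>" y \<sigma> "{0..1}" G] by (simp add: o_def)
    qed
    then have "((\<lambda>\<sigma>. y * f (y * \<sigma>)) has_integral G (y * 1) - G (y * 0)) {0..1}"
      by (intro fundamental_theorem_of_calculus) auto
    from integral_unique[OF this] show ?thesis by (simp add: prim_def)
  qed
  have "(G has_real_derivative f x) (at x)"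
  proof -
    have "- M < x" "x < M" by (auto simp: M_def)
    then show ?thesis
      using G[of x] at_within_Icc_at[of "-M" x M]
      by (simp add: has_real_derivative_iff_has_vector_derivative)
  qed
  then have "((\<lambda>y. G y - G 0) has_real_derivative f x) (at x)"
    by (auto intro!: derivative_eq_intros)
  then show ?thesis
    by (rule has_field_derivative_transform_within_open[of _ _ _ "{-M<..<M}"])
      (use eq in \<open>auto simp: M_def\<close>)
qed

lemma smooth_prim: "smooth_on UNIV f \<Longrightarrow> smooth_on UNIV (prim f)"
  by (rule smooth_on_realI[where f' = f]) (auto intro: prim_has_derivative smooth_on_imp_continuous_on)

text \<open>A primitive is constant outside the interval that carries \<open>f\<close>, so both end points may be moved
  into this interval.\<close>

lemma prim_bound:
  assumes "continuous_on UNIV f" "\<And>y. \<bar>f y\<bar> \<le> C" "\<And>y. y \<notin> {a..a + l} \<Longrightarrow> f y = 0" "l \<ge> 0"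
  shows "\<bar>prim f x\<bar> \<le> C * l"
proof -
  \<comment> \<open>the point of the interval closest to \<open>y\<close>\<close>
  define c where "c y = max a (min (a + l) y)" for y
  have D: "(prim f has_real_derivative f y) (at y)" for y
    using prim_has_derivative[OF assms(1)] .
  have cont: "continuous_on S (prim f)" for S
    using D DERIV_isCont continuous_at_imp_continuous_on by blast
  have c: "prim f (c y) = prim f y" for y
  proof -
    consider "y < a" | "y > a + l" | "a \<le> y" "y \<le> a + l" by linarith
    then show ?thesis
    proof cases
      case 1
      have "prim f y = prim f a"
        by (rule DERIV_isconst2[of y a, symmetric])
          (use 1 cont D assms(3) in \<open>auto, metis D assms(3) atLeastAtMost_iff not_le\<close>)
      then show ?thesis using 1 assms(4) by (simp add: c_def)
    next
      case 2
      have "prim f y = prim f (a + l)"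
        by (rule DERIV_isconst2[of "a + l" y])
          (use 2 cont D assms(3) in \<open>auto, metis D assms(3) atLeastAtMost_iff not_le\<close>)
      then show ?thesis using 2 assms(4) by (simp add: c_def)
    qed (simp add: c_def)
  qed
  have "\<bar>prim f x\<bar> = norm (prim f (c x) - prim f (c 0))"
    by (simp add: c)
  also have "\<dots> \<le> C * norm (c x - c 0)"
    by (rule field_differentiable_bound[of UNIV _ f]) (use D assms(2) in auto)
  also have "\<dots> \<le> C * l"
    using assms(2)[of 0] assms(4) by (intro mult_left_mono) (auto simp: c_def)
  finally show ?thesis .
qed

lemma has_derivative_partials:
  fixes f :: "real \<times> real \<Rightarrow> real"
  assumes "\<And>x y. ((\<lambda>x. f (x, y)) has_real_derivative f1 (x, y)) (at x)"
    and "\<And>x y. ((\<lambda>y. f (x, y)) has_real_derivative f2 (x, y)) (at y)"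
    and "continuous_on UNIV f2"
  shows "(f has_derivative (\<lambda>v. fst v * f1 z + snd v * f2 z)) (at z)"
proof -
  obtain x y where z: "z = (x, y)" by force
  have "((\<lambda>(x, y). f (x, y)) has_derivative
      (\<lambda>(tx, ty). f1 (x, y) * tx + blinfun_apply (f2 (x, y) *\<^sub>R id_blinfun) ty)) (at (x, y) within UNIV \<times> UNIV)"
  proof (rule has_derivative_partialsI[where fy = "\<lambda>x y. f2 (x, y) *\<^sub>R id_blinfun"])
    show "((\<lambda>x. f (x, y)) has_derivative (*) (f1 (x, y))) (at x within UNIV)"
      using assms(1)[of y x] by (simp add: has_field_derivative_def)
    show "((\<lambda>y. f (x, y)) has_derivative blinfun_apply (f2 (x, y) *\<^sub>R id_blinfun)) (at y within UNIV)" for x y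
    proof -
      have "blinfun_apply (f2 (x, y) *\<^sub>R id_blinfun) = (*) (f2 (x, y))"
        by (auto simp: blinfun.scaleR_left)
      then show ?thesis using assms(2)[of x y] by (simp add: has_field_derivative_def)
    qed
    have "continuous_on UNIV (\<lambda>p. f2 p *\<^sub>R (id_blinfun :: real \<Rightarrow>\<^sub>L real))"
      by (intro continuous_intros assms(3))
    then show "continuous (at (x, y) within UNIV \<times> UNIV) (\<lambda>(x, y). f2 (x, y) *\<^sub>R (id_blinfun :: real \<Rightarrow>\<^sub>L real))"
      by (simp add: continuous_on_eq_continuous_at split_def)
  qed auto
  then show ?thesis
    by (simp add: z split_def blinfun.scaleR_left mult.commute)
qed

lemma continuous_on_UNIV_compose:
  "continuous_on UNIV f \<Longrightarrow> continuous_on S \<phi> \<Longrightarrow> continuous_on S (\<lambda>x. f (\<phi> x))"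
  by (rule continuous_on_compose2) auto

text \<open>A derivative in the first coordinate produces a factor \<open>\<sigma>\<close>. The induction is therefore carried
  out for all weights \<open>\<sigma> ^ m\<close> simultaneously.\<close>

lemma Ck_on_param_integral:
  fixes f :: "real \<times> real \<Rightarrow> real"
  assumes "Ck_on k UNIV f"
  shows "Ck_on k UNIV (\<lambda>z. integral {0..1} (\<lambda>\<sigma>. \<sigma> ^ m * f (fst z * \<sigma>, snd z)))"
  using assms
proof (induction k arbitrary: f m)
  case 0
  have c: "continuous_on (UNIV \<times> cbox 0 1) (\<lambda>(z, \<sigma>). \<sigma> ^ m * f (fst z * \<sigma>, snd z))"
    unfolding split_def
    by (intro continuous_intros continuous_on_UNIV_compose[OF 0[unfolded Ck_on.simps]])
  show ?case
    using integral_continuous_on_param[OF c] by simp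
next
  case (Suc k)
  define D1 where "D1 = dir_deriv UNIV f (1, 0)"
  define D2 where "D2 = dir_deriv UNIV f (0, 1)"
  have Ck: "Ck_on k UNIV D1" "Ck_on k UNIV D2"
    unfolding D1_def D2_def using Suc.prems by (auto intro: Ck_on_Suc_dir_deriv)
  have f: "continuous_on UNIV f" and D: "continuous_on UNIV D1" "continuous_on UNIV D2"
    using Suc.prems Ck by (auto intro: Ck_on_imp_continuous_on simp del: Ck_on.simps)
  have fd: "(f has_derivative (\<lambda>v. fst v * D1 p + snd v * D2 p)) (at p)" for p
  proof -
    have d: "(f has_derivative (\<lambda>v. dir_deriv UNIV f v p)) (at p)"
      using Ck_on_Suc_has_derivative[OF open_UNIV Suc.prems] by simp
    have "linear (\<lambda>v. dir_deriv UNIV f v p)" using d has_derivative_linear by blast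
    note l = linear_add[OF this] linear_scale[OF this]
    have "dir_deriv UNIV f v p = fst v * D1 p + snd v * D2 p" for v
    proof -
      have "dir_deriv UNIV f v p = dir_deriv UNIV f (fst v *\<^sub>R (1, 0) + snd v *\<^sub>R (0, 1)) p"
        by simp
      also have "\<dots> = fst v * D1 p + snd v * D2 p"
        unfolding l by (simp add: D1_def D2_def)
      finally show ?thesis .
    qed
    then have "(\<lambda>v. dir_deriv UNIV f v p) = (\<lambda>v. fst v * D1 p + snd v * D2 p)" by blast
    with d show ?thesis by (simp only:)
  qed
  define I where "I m f z = integral {0..1} (\<lambda>\<sigma>. \<sigma> ^ m * f (fst z * \<sigma>, snd z))"
    for m and f :: "real \<times> real \<Rightarrow> real" and z
  have cont: "continuous_on UNIV (\<lambda>\<sigma>. \<sigma> ^ m * g (fst z * \<sigma>, snd z))"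
    if "continuous_on UNIV g" for g m and z :: "real \<times> real"
    by (intro continuous_intros continuous_on_UNIV_compose[OF that])
  have int: "(\<lambda>\<sigma>. \<sigma> ^ m * g (fst z * \<sigma>, snd z)) integrable_on {0..1}"
    if "continuous_on UNIV g" for g m and z :: "real \<times> real"
    by (rule integrable_continuous_real) (use cont[OF that] continuous_on_subset in blast)
  define fx :: "real \<times> real \<Rightarrow> real \<Rightarrow> (real \<times> real) \<Rightarrow>\<^sub>L real" where
    "fx z \<sigma> = (\<sigma> ^ Suc m * D1 (fst z * \<sigma>, snd z)) *\<^sub>R fst_blinfun + (\<sigma> ^ m * D2 (fst z * \<sigma>, snd z)) *\<^sub>R snd_blinfun"
    for z \<sigma>
  have fx_apply: "blinfun_apply (fx z \<sigma>) v =
      (\<sigma> ^ Suc m * D1 (fst z * \<sigma>, snd z)) * fst v + (\<sigma> ^ m * D2 (fst z * \<sigma>, snd z)) * snd v" for z \<sigma> v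
    by (simp add: fx_def blinfun.add_left blinfun.scaleR_left)
  have cfx: "continuous_on (UNIV \<times> cbox 0 1) (\<lambda>(z, \<sigma>). fx z \<sigma>)"
    unfolding split_def fx_def
    by (intro continuous_intros continuous_on_UNIV_compose[OF D(1)] continuous_on_UNIV_compose[OF D(2)])
  have der: "((\<lambda>z. integral (cbox 0 1) (\<lambda>\<sigma>. \<sigma> ^ m * f (fst z * \<sigma>, snd z))) has_derivative
      blinfun_apply (integral (cbox 0 1) (fx z))) (at z within UNIV)" for z
  proof (rule leibniz_rule[OF _ _ cfx])
    fix z :: "real \<times> real" and \<sigma> :: real
    have "((\<lambda>z. (fst z * \<sigma>, snd z)) has_derivative (\<lambda>v. (fst v * \<sigma>, snd v))) (at z)"
      by (auto intro!: derivative_eq_intros)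
    from has_derivative_compose[OF this fd]
    have "((\<lambda>z. \<sigma> ^ m * f (fst z * \<sigma>, snd z)) has_derivative
      (\<lambda>v. \<sigma> ^ m * (fst v * \<sigma> * D1 (fst z * \<sigma>, snd z) + snd v * D2 (fst z * \<sigma>, snd z)))) (at z)"
      by (intro has_derivative_mult_right) simp
    moreover have "blinfun_apply (fx z \<sigma>) =
      (\<lambda>v. \<sigma> ^ m * (fst v * \<sigma> * D1 (fst z * \<sigma>, snd z) + snd v * D2 (fst z * \<sigma>, snd z)))"
      by (auto simp: fx_apply algebra_simps)
    ultimately show "((\<lambda>z. \<sigma> ^ m * f (fst z * \<sigma>, snd z)) has_derivative blinfun_apply (fx z \<sigma>)) (at z within UNIV)"
      by simp
  next
    show "(\<lambda>\<sigma>. \<sigma> ^ m * f (fst z * \<sigma>, snd z)) integrable_on cbox 0 1" for z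
      using int[OF f] by simp
  qed auto
  have val: "blinfun_apply (integral (cbox 0 1) (fx z)) v = fst v * I (Suc m) D1 z + snd v * I m D2 z" for z v
  proof -
    have "continuous_on (cbox 0 1) (fx z)"
      using continuous_on_compose2[OF cfx, of "cbox 0 1" "Pair z"]
      by (simp add: image_subset_iff continuous_on_Pair continuous_on_const continuous_on_id)
    then have "fx z integrable_on cbox 0 1" by (rule integrable_continuous)
    from integral_linear[OF this bounded_linear_apply_blinfun, of v]
    have "blinfun_apply (integral (cbox 0 1) (fx z)) v = integral {0..1} (\<lambda>\<sigma>. blinfun_apply (fx z \<sigma>) v)"
      by (simp add: o_def)
    also have "\<dots> = integral {0..1} (\<lambda>\<sigma>. (\<sigma> ^ Suc m * D1 (fst z * \<sigma>, snd z)) * fst v) +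
        integral {0..1} (\<lambda>\<sigma>. (\<sigma> ^ m * D2 (fst z * \<sigma>, snd z)) * snd v)"
      unfolding fx_apply
      by (rule integral_add) (use int[OF D(1), of "Suc m" z] int[OF D(2), of m z] in
        \<open>auto intro!: integrable_on_mult_left simp del: power_Suc\<close>)
    also have "\<dots> = fst v * I (Suc m) D1 z + snd v * I m D2 z"
      unfolding I_def by (simp del: power_Suc add: mult.commute)
    finally show ?thesis .
  qed
  show ?case
  proof (rule Ck_on_SucI[where f' = "\<lambda>z v. fst v * I (Suc m) D1 z + snd v * I m D2 z"])
    show "((\<lambda>z. integral {0..1} (\<lambda>\<sigma>. \<sigma> ^ m * f (fst z * \<sigma>, snd z))) has_derivative
        (\<lambda>v. fst v * I (Suc m) D1 z + snd v * I m D2 z)) (at z)" for z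
    proof -
      have "blinfun_apply (integral (cbox 0 1) (fx z)) = (\<lambda>v. fst v * I (Suc m) D1 z + snd v * I m D2 z)"
        using val by blast
      then show ?thesis using der[of z] by simp
    qed
    have "Ck_on k UNIV (I (Suc m) D1)" "Ck_on k UNIV (I m D2)"
      unfolding I_def[abs_def] using Suc.IH Ck by blast+
    then show "Ck_on k UNIV (\<lambda>z. fst v * I (Suc m) D1 z + snd v * I m D2 z)" for v
      by (intro Ck_on_add Ck_on_linear_compose[OF bounded_linear_mult_right]) auto
  qed simp
qed

section \<open>A semilinear Goursat problem\<close>

text \<open>The integrals of \<open>h\<close> from the axes, along the first and the second coordinate.\<close>

definition prim1 :: "(real \<times> real \<Rightarrow> real) \<Rightarrow> real \<times> real \<Rightarrow> real" where
  "prim1 h z = prim (\<lambda>x. h (x, snd z)) (fst z)"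

definition prim2 :: "(real \<times> real \<Rightarrow> real) \<Rightarrow> real \<times> real \<Rightarrow> real" where
  "prim2 h z = prim (\<lambda>y. h (fst z, y)) (snd z)"

lemma Ck_on_prim1: "Ck_on k UNIV h \<Longrightarrow> Ck_on k UNIV (prim1 h)"
proof -
  assume h: "Ck_on k UNIV h"
  have "Ck_on k UNIV (\<lambda>z. fst z * integral {0..1} (\<lambda>\<sigma>. \<sigma> ^ 0 * h (fst z * \<sigma>, snd z)))"
    by (intro Ck_on_bilinear[OF bounded_bilinear_mult] Ck_on_param_integral h
      Ck_on_linear bounded_linear_fst) auto
  then show ?thesis by (simp add: prim1_def[abs_def] prim_def)
qed

lemma prim2_swap: "prim2 h = (\<lambda>z. prim1 (\<lambda>z. h (snd z, fst z)) (snd z, fst z))"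
  by (simp add: prim1_def[abs_def] prim2_def[abs_def])

lemma bounded_linear_swap: "bounded_linear (\<lambda>z. (snd z, fst z))"
  by (intro bounded_linear_Pair bounded_linear_fst bounded_linear_snd)

lemma Ck_on_prim2: "Ck_on k UNIV h \<Longrightarrow> Ck_on k UNIV (prim2 h)"
proof -
  assume h: "Ck_on k UNIV h"
  have swap: "Ck_on k UNIV (\<lambda>z :: real \<times> real. (snd z, fst z))"
    by (intro Ck_on_linear bounded_linear_swap) auto
  have "Ck_on k UNIV (prim1 (\<lambda>z. h (snd z, fst z)))"
    by (rule Ck_on_prim1[OF Ck_on_compose[OF open_UNIV open_UNIV _ swap h]]) simp
  from Ck_on_compose[OF open_UNIV open_UNIV _ swap this] show ?thesis
    unfolding prim2_swap by simp
qed

lemma continuous_slices: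
  fixes h :: "real \<times> real \<Rightarrow> real"
  assumes "continuous_on UNIV h"
  shows "continuous_on S (\<lambda>x. h (x, y))" "continuous_on S (\<lambda>y. h (x, y))"
  by (intro continuous_on_UNIV_compose[OF assms] continuous_intros)+

lemma prim2_has_derivative:
  "continuous_on UNIV h \<Longrightarrow> ((\<lambda>y. prim2 h (x, y)) has_real_derivative h (x, y)) (at y)"
  unfolding prim2_def by (auto intro: prim_has_derivative continuous_slices)

lemma prim1_has_derivative:
  "continuous_on UNIV h \<Longrightarrow> ((\<lambda>x. prim1 h (x, y)) has_real_derivative h (x, y)) (at x)"
  unfolding prim1_def by (auto intro: prim_has_derivative continuous_slices)

lemma prim1_prim2_has_derivative:
  assumes "continuous_on UNIV h"
  shows "(prim1 (prim2 h) has_derivative (\<lambda>v. fst v * prim2 h z + snd v * prim1 h z)) (at z)"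
proof (rule has_derivative_partials)
  have c2: "continuous_on UNIV (prim2 h)" and c1: "continuous_on UNIV (prim1 h)"
    using assms Ck_on_prim2[of 0] Ck_on_prim1[of 0] by auto
  show "((\<lambda>x. prim1 (prim2 h) (x, y)) has_real_derivative prim2 h (x, y)) (at x)" for x y
    by (rule prim1_has_derivative[OF c2])
  show "((\<lambda>y. prim1 (prim2 h) (x, y)) has_real_derivative prim1 h (x, y)) (at y)" for x y
  proof -
    have "((\<lambda>y. integral (cbox 0 1) (\<lambda>\<sigma>. prim2 h (x * \<sigma>, y))) has_real_derivative
        integral (cbox 0 1) (\<lambda>\<sigma>. h (x * \<sigma>, y))) (at y within UNIV)"
    proof (rule leibniz_rule_field_derivative)
      show "((\<lambda>y. prim2 h (x * t, y)) has_real_derivative h (x * t, y)) (at y within UNIV)" for t y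
        using prim2_has_derivative[OF assms] by simp
      show "(\<lambda>\<sigma>. prim2 h (x * \<sigma>, y)) integrable_on cbox 0 1" for y
        by (intro integrable_continuous continuous_on_UNIV_compose[OF c2] continuous_intros)
      show "continuous_on (UNIV \<times> cbox 0 1) (\<lambda>(y, \<sigma>). h (x * \<sigma>, y))"
        unfolding split_def by (intro continuous_on_UNIV_compose[OF assms] continuous_intros)
    qed auto
    from DERIV_cmult[OF this, of x] show ?thesis
      by (simp add: prim1_def prim_def)
  qed
  show "continuous_on UNIV (prim1 h)" by (rule c1)
qed

text \<open>In the null coordinates \<open>\<xi>\<close> and \<open>\<eta>\<close> the one-dimensional wave equation is \<open>w\<^sub>\<xi>\<^sub>\<eta> = k(\<xi>, \<eta>, w)\<close>; with
  zero data on the axes its solutions are the fixed points of the double primitive of \<open>k(_, w)\<close>. The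
  source lives in a strip of width proportional to \<open>\<tau>\<close> around a line \<open>\<xi> + \<eta> = c\<close>, that is, in a short time
  interval, and integration across the strip gives a factor \<open>\<tau>\<close>. So the operator is a contraction, and the
  solution is small. It preserves the closed set of functions that vanish where a coordinate is nonpositive,
  which is finite speed of propagation. Both null derivatives of the fixed point are primitives of
  \<open>k(_, w)\<close>, which involves no derivative of \<open>w\<close>; hence \<open>C\<^sup>k\<close> implies \<open>C\<^sup>k\<^sup>+\<^sup>1\<close>.\<close>

theorem goursat:
  fixes k :: "(real \<times> real) \<times> real \<Rightarrow> real"
  assumes smooth: "smooth_on UNIV k"
    and bound: "\<And>z y. \<bar>k (z, y)\<bar> \<le> C"
    and lip: "\<And>z y y'. \<bar>k (z, y) - k (z, y')\<bar> \<le> L * \<bar>y - y'\<bar>"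
    and strip: "\<And>z y. k (z, y) \<noteq> 0 \<Longrightarrow> \<bar>fst z + snd z - c\<bar> \<le> \<tau> \<and> \<bar>fst z\<bar> \<le> M"
    and pos: "\<tau> \<ge> 0" "M \<ge> 0" "L \<ge> 0"
    and small: "L * (2 * \<tau>) * (2 * M) < 1"
    and vanish: "\<And>z. fst z \<le> 0 \<or> snd z \<le> 0 \<Longrightarrow> k (z, 0) = 0"
  obtains w w1 w2 where
    "smooth_on UNIV w" "smooth_on UNIV w1" "smooth_on UNIV w2"
    "\<And>z. (w has_derivative (\<lambda>v. fst v * w1 z + snd v * w2 z)) (at z)"
    "\<And>x y. ((\<lambda>y. w1 (x, y)) has_real_derivative k ((x, y), w (x, y))) (at y)"
    "\<And>x y. ((\<lambda>x. w2 (x, y)) has_real_derivative k ((x, y), w (x, y))) (at x)"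
    "\<And>z. \<bar>w z\<bar> \<le> C * (2 * \<tau>) * (2 * M)"
    "\<And>z. fst z \<le> 0 \<or> snd z \<le> 0 \<Longrightarrow> w z = 0"
proof -
  define h where "h w z = k (z, w z)" for w z
  define \<Phi> where "\<Phi> w = prim1 (prim2 (h w))" for w
  have kc: "continuous_on UNIV k" by (rule smooth_on_imp_continuous_on[OF smooth])
  have hc: "continuous_on UNIV (h w)" if "continuous_on UNIV w" for w
    unfolding h_def by (intro continuous_on_UNIV_compose[OF kc] continuous_intros that)
  \<comment> \<open>The inner integral runs over the part of a line inside the strip, which has length \<open>2 \<tau>\<close>.\<close>
  have est: "\<bar>prim1 (prim2 d) z\<bar> \<le> B * (2 * \<tau>) * (2 * M)"
    if dc: "continuous_on UNIV d" and dB: "\<And>z. \<bar>d z\<bar> \<le> B"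
      and d0: "\<And>z. d z \<noteq> 0 \<Longrightarrow> \<bar>fst z + snd z - c\<bar> \<le> \<tau> \<and> \<bar>fst z\<bar> \<le> M" for d z B
  proof -
    have 2: "\<bar>prim2 d z\<bar> \<le> B * (2 * \<tau>)" for z
      unfolding prim2_def
    proof (rule prim_bound[where a = "c - fst z - \<tau>"])
      show "d (fst z, y) = 0" if "y \<notin> {c - fst z - \<tau>..c - fst z - \<tau> + 2 * \<tau>}" for y
        using d0[of "(fst z, y)"] that by (cases "d (fst z, y) = 0") (auto simp: abs_le_iff)
    qed (use dB pos dc in \<open>auto intro: continuous_slices\<close>)
    have c2: "continuous_on UNIV (prim2 d)"
      using dc Ck_on_prim2[of 0] by auto
    have 0: "prim2 d z = 0" if "\<not> \<bar>fst z\<bar> \<le> M" for z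
    proof -
      have "d (fst z, y) = 0" for y using d0[of "(fst z, y)"] that by auto
      then show ?thesis by (simp add: prim2_def prim_def)
    qed
    show ?thesis
      unfolding prim1_def
    proof (rule prim_bound[where a = "-M"])
      show "prim2 d (y, snd z) = 0" if "y \<notin> {-M..-M + 2 * M}" for y
        by (rule 0) (use that in auto)
    qed (use 2 c2 pos in \<open>auto intro: continuous_slices\<close>)
  qed
  have \<Phi>c: "continuous_on UNIV (\<Phi> w)" if "continuous_on UNIV w" for w
    unfolding \<Phi>_def using hc[OF that] Ck_on_prim2[of 0] Ck_on_prim1[of 0] by auto
  have \<Phi>b: "\<bar>\<Phi> w z\<bar> \<le> C * (2 * \<tau>) * (2 * M)" if "continuous_on UNIV w" for w z
    unfolding \<Phi>_def by (rule est[OF hc[OF that]]) (use bound strip in \<open>auto simp: h_def\<close>)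
  have \<Phi>0: "\<Phi> w z = 0" if "\<And>z. fst z \<le> 0 \<or> snd z \<le> 0 \<Longrightarrow> w z = 0" "fst z \<le> 0 \<or> snd z \<le> 0" for w z
  proof -
    have h0: "h w z = 0" if "fst z \<le> 0 \<or> snd z \<le> 0" for z
      using vanish[OF that] \<open>fst z \<le> 0 \<or> snd z \<le> 0 \<Longrightarrow> w z = 0\<close>[OF that] by (simp add: h_def)
    have p2: "prim2 (h w) z = 0" if "fst z \<le> 0 \<or> snd z \<le> 0" for z
    proof -
      have "h w (fst z, snd z * \<sigma>) = 0" if "\<sigma> \<in> {0..1}" for \<sigma>
        using that \<open>fst z \<le> 0 \<or> snd z \<le> 0\<close> by (intro h0) (auto intro: mult_nonpos_nonneg)
      then have "integral {0..1} (\<lambda>\<sigma>. h w (fst z, snd z * \<sigma>)) = integral {0..1} (\<lambda>\<sigma> :: real. 0)"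
        using Henstock_Kurzweil_Integration.integral_cong[of "{0..1}" "\<lambda>\<sigma>. h w (fst z, snd z * \<sigma>)" "\<lambda>\<sigma>. 0"] by blast
      then show ?thesis by (simp add: prim2_def prim_def)
    qed
    have "prim2 (h w) (fst z * \<sigma>, snd z) = 0" if "\<sigma> \<in> {0..1}" for \<sigma>
      using that \<open>fst z \<le> 0 \<or> snd z \<le> 0\<close> by (intro p2) (auto intro: mult_nonpos_nonneg)
    then have "integral {0..1} (\<lambda>\<sigma>. prim2 (h w) (fst z * \<sigma>, snd z)) = integral {0..1} (\<lambda>\<sigma> :: real. 0)"
      using Henstock_Kurzweil_Integration.integral_cong[of "{0..1}" "\<lambda>\<sigma>. prim2 (h w) (fst z * \<sigma>, snd z)" "\<lambda>\<sigma>. 0"] by blast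
    then show ?thesis by (simp add: \<Phi>_def prim1_def prim_def)
  qed
  define V :: "((real \<times> real) \<Rightarrow>\<^sub>C real) set" where "V = PiC {z. fst z \<le> 0 \<or> snd z \<le> 0} (\<lambda>_. {0})"
  define F :: "((real \<times> real) \<Rightarrow>\<^sub>C real) \<Rightarrow> ((real \<times> real) \<Rightarrow>\<^sub>C real)" where
    "F w = Bcontfun (\<Phi> (apply_bcontfun w))" for w
  have F: "apply_bcontfun (F w) = \<Phi> (apply_bcontfun w)" for w
    unfolding F_def
    by (intro Bcontfun_inverse bcontfun_normI[where b = "C * (2 * \<tau>) * (2 * M)"])
      (simp_all only: real_norm_def \<Phi>c \<Phi>b continuous_on_apply_bcontfun)
  have V: "w \<in> V \<longleftrightarrow> (\<forall>z. fst z \<le> 0 \<or> snd z \<le> 0 \<longrightarrow> apply_bcontfun w z = 0)" for w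
    unfolding V_def mem_PiC_iff by (auto simp: Pi_def)
  have "\<exists>!w\<in>V. F w = w"
  proof (rule Banach_fix)
    show "complete V"
      unfolding complete_eq_closed V_def by (intro closed_PiC) auto
    show "V \<noteq> {}"
      using V[of 0] by auto
    show "F ` V \<subseteq> V"
    proof
      fix w' assume "w' \<in> F ` V"
      then obtain w where w: "w' = F w" "w \<in> V" by blast
      have "apply_bcontfun w' z = 0" if "fst z \<le> 0 \<or> snd z \<le> 0" for z
        unfolding w(1) F by (rule \<Phi>0[OF _ that]) (use w(2) V in blast)
      then show "w' \<in> V" using V by blast
    qed
    show "dist (F w) (F w') \<le> L * (2 * \<tau>) * (2 * M) * dist w w'" for w w'
    proof (rule dist_bound)
      fix z
      let ?d = "\<lambda>z. h (apply_bcontfun w) z - h (apply_bcontfun w') z"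
      have c: "continuous_on UNIV (h (apply_bcontfun w))" "continuous_on UNIV (h (apply_bcontfun w'))"
        by (auto intro: hc)
      have c2: "continuous_on UNIV (prim2 (h (apply_bcontfun w)))" "continuous_on UNIV (prim2 (h (apply_bcontfun w')))"
        using c Ck_on_prim2[of 0] by auto
      have pd: "prim f x - prim g x = prim (\<lambda>x. f x - g x) x"
        if "continuous_on UNIV f" "continuous_on UNIV g" for f g x
      proof -
        have "(\<lambda>\<sigma>. f (x * \<sigma>)) integrable_on {0..1}" "(\<lambda>\<sigma>. g (x * \<sigma>)) integrable_on {0..1}"
          by (intro integrable_continuous_real continuous_on_UNIV_compose[OF that(1)]
            continuous_on_UNIV_compose[OF that(2)] continuous_intros)+
        from integral_diff[OF this] show ?thesis by (simp add: prim_def right_diff_distrib)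
      qed
      have "prim2 (h (apply_bcontfun w)) z - prim2 (h (apply_bcontfun w')) z = prim2 ?d z" for z
        unfolding prim2_def by (intro pd continuous_slices c)
      then have "\<Phi> (apply_bcontfun w) z - \<Phi> (apply_bcontfun w') z = prim1 (prim2 ?d) z"
        unfolding \<Phi>_def prim1_def using pd[OF continuous_slices(1)[OF c2(1)] continuous_slices(1)[OF c2(2)]] by simp
      moreover have "\<bar>prim1 (prim2 ?d) z\<bar> \<le> (L * dist w w') * (2 * \<tau>) * (2 * M)"
      proof (rule est)
        show "\<bar>?d z\<bar> \<le> L * dist w w'" for z
        proof -
          have "\<bar>?d z\<bar> \<le> L * dist (apply_bcontfun w z) (apply_bcontfun w' z)"
            using lip by (simp add: h_def dist_real_def)
          also have "\<dots> \<le> L * dist w w'"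
            using pos dist_bounded by (intro mult_left_mono) auto
          finally show ?thesis .
        qed
        show "\<bar>fst z + snd z - c\<bar> \<le> \<tau> \<and> \<bar>fst z\<bar> \<le> M" if "?d z \<noteq> 0" for z
          using that strip unfolding h_def by (metis diff_self)
      qed (use c in \<open>auto intro: continuous_intros\<close>)
      ultimately show "dist (apply_bcontfun (F w) z) (apply_bcontfun (F w') z) \<le> L * (2 * \<tau>) * (2 * M) * dist w w'"
        by (simp add: F dist_real_def mult_ac)
    qed
  qed (use small pos in auto)
  then obtain W where W: "W \<in> V" "F W = W" by blast
  define w where "w = apply_bcontfun W"
  have w: "w = \<Phi> w" using F[of W] W by (simp add: w_def)
  have wc: "continuous_on UNIV w" by (simp add: w_def)
  have der: "(w has_derivative (\<lambda>v. fst v * prim2 (h w) z + snd v * prim1 (h w) z)) (at z)" for z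
    using prim1_prim2_has_derivative[OF hc[OF wc]] w by (simp add: \<Phi>_def)
  have hCk: "Ck_on n UNIV (h w)" if "Ck_on n UNIV w" for n
  proof -
    have "Ck_on n UNIV (\<lambda>z. (z, 0) + (0 :: real \<times> real, w z))"
      by (intro Ck_on_add Ck_on_linear bounded_linear_Pair bounded_linear_ident bounded_linear_zero
        Ck_on_linear_compose[of "\<lambda>y. (0, y)"] that) auto
    then have "Ck_on n UNIV (\<lambda>z. (z, w z))" by simp
    then show ?thesis
      unfolding h_def
      by (rule Ck_on_compose[OF open_UNIV open_UNIV subset_UNIV _ smooth[unfolded smooth_on_def, rule_format]])
  qed
  have wCk: "Ck_on n UNIV w" for n
  proof (induction n)
    case 0
    then show ?case using wc by simp
  next
    case (Suc n)
    show ?case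
      by (rule Ck_on_SucI[OF open_UNIV der])
        (intro Ck_on_add Ck_on_linear_compose[OF bounded_linear_mult_right] Ck_on_prim1 Ck_on_prim2 hCk Suc; simp)
  qed
  show ?thesis
  proof (rule that[of w "prim2 (h w)" "prim1 (h w)"])
    show "\<bar>w z\<bar> \<le> C * (2 * \<tau>) * (2 * M)" for z using \<Phi>b[OF wc, of z] w by simp
    show "w z = 0" if "fst z \<le> 0 \<or> snd z \<le> 0" for z
      using W(1)[unfolded V] that unfolding w_def by blast
    show "((\<lambda>y. prim2 (h w) (x, y)) has_real_derivative k ((x, y), w (x, y))) (at y)" for x y
      using prim2_has_derivative[OF hc[OF wc]] by (simp add: h_def)
    show "((\<lambda>x. prim1 (h w) (x, y)) has_real_derivative k ((x, y), w (x, y))) (at x)" for x y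
      using prim1_has_derivative[OF hc[OF wc]] by (simp add: h_def)
  qed (use wCk hCk der in \<open>auto simp: smooth_on_def intro: Ck_on_prim1 Ck_on_prim2\<close>)
qed

section \<open>Curvature of rotationally symmetric metrics\<close>

text \<open>The coefficient of the Euclidean metric is \<open>A(s) = 1 - s * B s\<close> at \<open>s = x \<bullet> x\<close>. The relation \<open>A + s B = 1\<close> says
  that \<open>x\<close> has its Euclidean length, and that it is orthogonal to the spheres around the origin; so radial lines are geodesics
  with arc length parameter.\<close>

definition rot_metric :: "(real \<Rightarrow> real) \<Rightarrow> real^'n \<Rightarrow> real^'n^'n" where
  "rot_metric B x = (\<chi> a b. (1 - (x \<bullet> x) * B (x \<bullet> x)) * (if a = b then 1 else 0) + B (x \<bullet> x) * (x $ a * x $ b))"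

lemma metric_inner_rot:
  "metric_inner (rot_metric B x) v w = (1 - (x \<bullet> x) * B (x \<bullet> x)) * (v \<bullet> w) + B (x \<bullet> x) * ((x \<bullet> v) * (x \<bullet> w))"
proof -
  define b where "b = B (x \<bullet> x)"
  define A where "A = 1 - (x \<bullet> x) * b"
  have "metric_inner (rot_metric B x) v w
      = (\<Sum>i\<in>UNIV. \<Sum>j\<in>UNIV. A * (if i = j then v $ i * w $ j else 0) + b * ((x $ i * v $ i) * (x $ j * w $ j)))"
    unfolding metric_inner_def rot_metric_def A_def b_def
    by (intro sum.cong refl) (simp add: algebra_simps A_def)
  also have "\<dots> = A * (v \<bullet> w) + b * ((x \<bullet> v) * (x \<bullet> w))"
    by (simp add: sum.distrib sum_distrib_left[symmetric] inner_vec_def sum_product)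
  finally show ?thesis by (simp add: A_def b_def)
qed

lemma linear_axis_sum:
  fixes f :: "real^'n \<Rightarrow> real"
  assumes "linear f"
  shows "(\<Sum>i\<in>UNIV. v $ i * f (axis i 1)) = f v"
proof -
  have "f v = f (\<Sum>i\<in>UNIV. v $ i *\<^sub>R axis i 1)"
    by (simp add: basis_expansion[of v, unfolded scalar_mult_eq_scaleR])
  then show ?thesis by (simp add: linear_sum[OF assms] linear_scale[OF assms])
qed

lemma inner_axis1 [simp]: "(x :: real^'n) \<bullet> axis i 1 = x $ i" "axis i 1 \<bullet> x = x $ i"
  by (simp_all add: inner_axis inner_axis')

text \<open>A rotationally equivariant bilinear map; the Christoffel symbols have this form.\<close>

definition equi :: "real \<Rightarrow> real \<Rightarrow> real \<Rightarrow> real^'n \<Rightarrow> real^'n \<Rightarrow> real^'n \<Rightarrow> real^'n" where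
  "equi \<alpha> \<beta> \<gamma> x V W = \<alpha> *\<^sub>R ((x \<bullet> V) *\<^sub>R W + (x \<bullet> W) *\<^sub>R V) + (\<beta> * (V \<bullet> W) + \<gamma> * (x \<bullet> V) * (x \<bullet> W)) *\<^sub>R x"

text \<open>The derivative of \<open>equi\<close> in the direction \<open>X\<close> when the coefficients are functions of \<open>x \<bullet> x\<close> with
  derivatives \<open>\<alpha>'\<close>, \<open>\<beta>'\<close>, \<open>\<gamma>'\<close>.\<close>

definition equi_deriv ::
  "real \<Rightarrow> real \<Rightarrow> real \<Rightarrow> real \<Rightarrow> real \<Rightarrow> real \<Rightarrow> real^'n \<Rightarrow> real^'n \<Rightarrow> real^'n \<Rightarrow> real^'n \<Rightarrow> real^'n" where
  "equi_deriv \<alpha> \<beta> \<gamma> \<alpha>' \<beta>' \<gamma>' x X V W =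
     (2 * (x \<bullet> X)) *\<^sub>R equi \<alpha>' \<beta>' \<gamma>' x V W
     + \<alpha> *\<^sub>R ((X \<bullet> V) *\<^sub>R W + (X \<bullet> W) *\<^sub>R V) + (\<beta> * (V \<bullet> W) + \<gamma> * (x \<bullet> V) * (x \<bullet> W)) *\<^sub>R X
     + (\<gamma> * (X \<bullet> V) * (x \<bullet> W) + \<gamma> * (x \<bullet> V) * (X \<bullet> W)) *\<^sub>R x"

lemma matrix_inv_eqI:
  fixes H K :: "real^'n^'n"
  assumes "H ** K = mat 1"
  shows "matrix_inv H = K"
proof -
  have "K ** H = mat 1" using assms matrix_left_right_inverse by blast
  with assms have "H ** matrix_inv H = mat 1 \<and> matrix_inv H ** H = mat 1"
    unfolding matrix_inv_def by (intro someI[of "\<lambda>K. H ** K = mat 1 \<and> K ** H = mat 1"]) simp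
  then have "matrix_inv H ** H = mat 1" by simp
  then have "matrix_inv H ** (H ** K) = K"
    by (simp add: matrix_mul_assoc)
  then show ?thesis by (simp add: assms)
qed

lemma matrix_inv_rot:
  assumes "A = 1 - (x \<bullet> x) * B (x \<bullet> x)" "A \<noteq> 0"
  shows "matrix_inv (rot_metric B x) = (\<chi> a b. ((if a = b then 1 else 0) - B (x \<bullet> x) * (x $ a * x $ b)) / A)"
proof (rule matrix_inv_eqI)
  define b where "b = B (x \<bullet> x)"
  have "(\<Sum>k\<in>UNIV. (A * (if i = k then 1 else 0) + b * (x $ i * x $ k)) *
      (((if k = j then 1 else 0) - b * (x $ k * x $ j)) / A)) = (if i = j then 1 else 0)" for i j
  proof -
    have "(\<Sum>k\<in>UNIV. (A * (if i = k then 1 else 0) + b * (x $ i * x $ k)) *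
        (((if k = j then 1 else 0) - b * (x $ k * x $ j)) / A))
      = (\<Sum>k\<in>UNIV. (if i = k then (if k = j then 1 else 0) - b * (x $ k * x $ j) else 0)
         + (if k = j then b * x $ i * x $ k / A else 0) - (b * b * x $ i * x $ j / A) * (x $ k * x $ k))"
      using assms(2) by (intro sum.cong refl) (auto simp: field_simps)
    also have "\<dots> = (if i = j then 1 else 0) - b * (x $ i * x $ j) + b * x $ i * x $ j / A
        - (b * b * x $ i * x $ j / A) * (x \<bullet> x)"
      by (simp add: sum.distrib sum_subtractf sum_distrib_left sum_divide_distrib inner_vec_def)
    also have "\<dots> = (if i = j then 1 else 0) + b * x $ i * x $ j * (1 - A - b * (x \<bullet> x)) / A"
      using assms(2) by (simp add: field_simps)
    also have "\<dots> = (if i = j then 1 else 0)"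
      by (simp add: assms(1) b_def)
    finally show ?thesis .
  qed
  then show "rot_metric B x ** (\<chi> a b. ((if a = b then 1 else 0) - B (x \<bullet> x) * (x $ a * x $ b)) / A) = mat 1"
    by (simp add: rot_metric_def matrix_matrix_mult_def mat_def vec_eq_iff b_def assms(1))
qed

lemma has_derivative_norm_sq: "((\<lambda>y. y \<bullet> y) has_derivative (\<lambda>v. 2 * (x \<bullet> v))) (at x)"
  by (auto intro!: derivative_eq_intros simp: inner_commute)

lemma has_derivative_radial:
  assumes "(f has_real_derivative f') (at (x \<bullet> x))"
  shows "((\<lambda>y. f (y \<bullet> y)) has_derivative (\<lambda>v. 2 * (x \<bullet> v) * f')) (at x)"
  using has_derivative_compose[OF has_derivative_norm_sq assms[unfolded has_field_derivative_def]]
  by (simp add: mult.commute)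

text \<open>Up to positive factors, the sectional curvatures of planes tangent to the spheres
  \<open>norm x = const\<close> and of planes that contain the radial direction.\<close>

definition curv_tan :: "(real \<Rightarrow> real) \<Rightarrow> (real \<Rightarrow> real) \<Rightarrow> real \<Rightarrow> real" where
  "curv_tan B B1 s = (1 - s * B s) * B s - 2 * (1 - s * B s) * (- B s - s * B1 s) - s * (- B s - s * B1 s)\<^sup>2"

definition curv_rad :: "(real \<Rightarrow> real) \<Rightarrow> (real \<Rightarrow> real) \<Rightarrow> (real \<Rightarrow> real) \<Rightarrow> real \<Rightarrow> real" where
  "curv_rad B B1 B2 s = - (3 * (- B s - s * B1 s) + 2 * s * (- 2 * B1 s - s * B2 s)
     - s * (- B s - s * B1 s)\<^sup>2 / (1 - s * B s))"

context
  fixes B B1 B2 :: "real \<Rightarrow> real"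
  assumes B1: "\<And>s. (B has_real_derivative B1 s) (at s)"
    and B2: "\<And>s. (B1 has_real_derivative B2 s) (at s)"
    and A_pos: "\<And>s. s \<ge> 0 \<Longrightarrow> 1 - s * B s > 0"
begin

abbreviation "cA s \<equiv> 1 - s * B s"
abbreviation "cA1 s \<equiv> - B s - s * B1 s"
abbreviation "cA2 s \<equiv> - 2 * B1 s - s * B2 s"

lemma metric_deriv_rot:
  fixes x :: "real^'n"
  shows
  "metric_deriv (rot_metric B) c a b x = 2 * x $ c * (cA1 (x \<bullet> x) * (if a = b then 1 else 0) + B1 (x \<bullet> x) * (x $ a * x $ b))
    + B (x \<bullet> x) * (axis c 1 $ a * x $ b + x $ a * axis c 1 $ b)"
proof -
  have 1: "((\<lambda>y :: real^'n. 1 - (y \<bullet> y) * B (y \<bullet> y)) has_derivative (\<lambda>v. 2 * (x \<bullet> v) * cA1 (x \<bullet> x))) (at x)"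
    by (rule has_derivative_radial[of "\<lambda>s. 1 - s * B s"]) (auto intro!: derivative_eq_intros B1)
  have 2: "((\<lambda>y :: real^'n. B (y \<bullet> y)) has_derivative (\<lambda>v. 2 * (x \<bullet> v) * B1 (x \<bullet> x))) (at x)"
    by (rule has_derivative_radial[OF B1])
  have 3: "((\<lambda>y :: real^'n. y $ a * y $ b) has_derivative (\<lambda>v. x $ a * v $ b + v $ a * x $ b)) (at x)"
    by (auto intro!: derivative_eq_intros bounded_linear_imp_has_derivative)
  have "((\<lambda>y. rot_metric B y $ a $ b) has_derivative
      (\<lambda>v. 2 * (x \<bullet> v) * cA1 (x \<bullet> x) * (if a = b then 1 else 0) +
        (B (x \<bullet> x) * (x $ a * v $ b + v $ a * x $ b) + 2 * (x \<bullet> v) * B1 (x \<bullet> x) * (x $ a * x $ b)))) (at x)"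
    unfolding rot_metric_def
    using has_derivative_add[OF has_derivative_mult_left[OF 1, of "if a = b then 1 else 0"] has_derivative_mult[OF 2 3]]
    by simp
  then show ?thesis
    unfolding metric_deriv_def by (subst dir_deriv_eq[OF open_UNIV UNIV_I]) (auto simp: algebra_simps)
qed

text \<open>The coefficients of the Christoffel symbols and their derivatives.\<close>

definition "k\<alpha> s = cA1 s / cA s"
definition "k\<beta> s = B s - cA1 s"
definition "k\<gamma> s = B1 s - 2 * cA1 s * B s / cA s"
definition "k\<alpha>' s = (cA2 s * cA s - (cA1 s)\<^sup>2) / (cA s)\<^sup>2"
definition "k\<beta>' s = B1 s - cA2 s"
definition "k\<gamma>' s = B2 s - (2 * (cA2 s * B s + cA1 s * B1 s) * cA s - 2 * cA1 s * B s * cA1 s) / (cA s)\<^sup>2"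

lemma christoffel_rot:
  fixes x :: "real^'n"
  shows
  "christoffel (rot_metric B) a b c x =
     equi (k\<alpha> (x \<bullet> x)) (k\<beta> (x \<bullet> x)) (k\<gamma> (x \<bullet> x)) x (axis b 1) (axis c 1) $ a"
proof -
  define s where "s = x \<bullet> x"
  have A: "cA s \<noteq> 0" using A_pos[of s] by (simp add: s_def)
  define W where "W = cA1 s *\<^sub>R (x $ b *\<^sub>R axis c 1 + x $ c *\<^sub>R axis b 1)
     + ((B s - cA1 s) * axis b 1 $ c + B1 s * x $ b * x $ c) *\<^sub>R x"
  have br: "metric_deriv (rot_metric B) b d c x + metric_deriv (rot_metric B) c d b x - metric_deriv (rot_metric B) d b c x
     = 2 * W $ d" for d
    unfolding metric_deriv_rot W_def s_def[symmetric]
    by (auto simp: axis_def algebra_simps)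
  have "christoffel (rot_metric B) a b c x
      = (\<Sum>d\<in>UNIV. ((if a = d then 1 else 0) - B s * (x $ a * x $ d)) / cA s * W $ d)"
  proof -
    have half: "p * (2 * w) / 2 = p * w" for p w :: real by simp
    have "matrix_inv (rot_metric B x) = (\<chi> a b. ((if a = b then 1 else 0) - B s * (x $ a * x $ b)) / cA s)"
      using matrix_inv_rot[of "cA s" x B] A by (simp add: s_def)
    then show ?thesis
      unfolding christoffel_def br by (simp only: sum_divide_distrib half vec_lambda_beta)
  qed
  also have "\<dots> = (\<Sum>d\<in>UNIV. (if a = d then W $ d / cA s else 0) - (B s * x $ a / cA s) * (x $ d * W $ d))"
    by (intro sum.cong refl) (simp add: diff_divide_distrib algebra_simps)
  also have "\<dots> = (W $ a - B s * x $ a * (x \<bullet> W)) / cA s"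
    by (simp add: sum_subtractf sum_distrib_left sum_divide_distrib inner_vec_def diff_divide_distrib)
  also have "x \<bullet> W = cA1 s * (2 * x $ b * x $ c) + ((B s - cA1 s) * axis b 1 $ c + B1 s * x $ b * x $ c) * s"
    by (simp add: W_def inner_simps s_def algebra_simps)
  also have "(W $ a - B s * x $ a * (cA1 s * (2 * x $ b * x $ c) + ((B s - cA1 s) * axis b 1 $ c + B1 s * x $ b * x $ c) * s)) / cA s
     = equi (k\<alpha> s) (k\<beta> s) (k\<gamma> s) x (axis b 1) (axis c 1) $ a"
  proof -
    have gen: "(a1 * t + k * xa - bb * xa * (a1 * (2 * xb * xc) + k * s)) / aa = (a1 / aa) * t + (k - 2 * a1 * bb * (xb * xc) / aa) * xa"
      if "aa = 1 - s * bb" "aa \<noteq> 0" for a1 t k xa bb xb xc aa :: real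
    proof -
      have "a1 * t + k * xa - bb * xa * (a1 * (2 * xb * xc) + k * s) = a1 * t + k * xa * aa - 2 * a1 * bb * (xb * xc) * xa"
        by (simp add: that(1) algebra_simps)
      then have "(a1 * t + k * xa - bb * xa * (a1 * (2 * xb * xc) + k * s)) / aa
          = (a1 * t + k * xa * aa - 2 * a1 * bb * (xb * xc) * xa) / aa" by (simp only:)
      also have "\<dots> = (a1 / aa) * t + (k - 2 * a1 * bb * (xb * xc) / aa) * xa"
        using that(2) by (simp add: add_divide_distrib diff_divide_distrib left_diff_distrib)
      finally show ?thesis .
    qed
    have W: "W $ a = cA1 s * (x $ b * axis c 1 $ a + x $ c * axis b 1 $ a) + ((B s - cA1 s) * axis b 1 $ c + B1 s * x $ b * x $ c) * x $ a"
      by (simp add: W_def)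
    show ?thesis
      unfolding W gen[OF refl A] equi_def k\<alpha>_def k\<beta>_def k\<gamma>_def by (simp add: algebra_simps)
  qed
  finally show ?thesis by (simp add: s_def)
qed

lemma equi_has_derivative:
  fixes x :: "real^'n"
  assumes "(\<alpha> has_real_derivative \<alpha>') (at (x \<bullet> x))" "(\<beta> has_real_derivative \<beta>') (at (x \<bullet> x))"
    "(\<gamma> has_real_derivative \<gamma>') (at (x \<bullet> x))"
  shows "((\<lambda>y. equi (\<alpha> (y \<bullet> y)) (\<beta> (y \<bullet> y)) (\<gamma> (y \<bullet> y)) y V W $ a) has_derivative
     (\<lambda>X. equi_deriv (\<alpha> (x \<bullet> x)) (\<beta> (x \<bullet> x)) (\<gamma> (x \<bullet> x)) \<alpha>' \<beta>' \<gamma>' x X V W $ a)) (at x)"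
proof -
  note d = has_derivative_radial[OF assms(1)] has_derivative_radial[OF assms(2)] has_derivative_radial[OF assms(3)]
  have l: "((\<lambda>y. y \<bullet> V) has_derivative (\<lambda>v. v \<bullet> V)) (at x)" "((\<lambda>y. y \<bullet> W) has_derivative (\<lambda>v. v \<bullet> W)) (at x)"
    "((\<lambda>y :: real^'n. y $ a) has_derivative (\<lambda>v. v $ a)) (at x)"
    by (auto intro!: bounded_linear_imp_has_derivative bounded_linear_inner_left)
  show ?thesis
    unfolding equi_def equi_deriv_def vector_add_component vector_scaleR_component
    apply (rule has_derivative_eq_rhs)
     apply (rule d l derivative_intros)+
    apply (auto simp: fun_eq_iff algebra_simps)
    done
qed

lemma coefficients_have_derivative:
  assumes "s \<ge> 0"
  shows "(k\<alpha> has_real_derivative k\<alpha>' s) (at s)" "(k\<beta> has_real_derivative k\<beta>' s) (at s)"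
    "(k\<gamma> has_real_derivative k\<gamma>' s) (at s)"
proof -
  have A: "cA s \<noteq> 0" using A_pos[OF assms] by simp
  show "(k\<alpha> has_real_derivative k\<alpha>' s) (at s)"
    unfolding k\<alpha>_def[abs_def] k\<alpha>'_def using A
    by (auto intro!: derivative_eq_intros B1 B2 simp: divide_simps) (simp add: algebra_simps power2_eq_square)
  show "(k\<beta> has_real_derivative k\<beta>' s) (at s)"
    unfolding k\<beta>_def[abs_def] k\<beta>'_def
    by (auto intro!: derivative_eq_intros B1 B2)
  have d1: "((\<lambda>s. 2 * cA1 s * B s) has_real_derivative 2 * (cA2 s * B s + cA1 s * B1 s)) (at s)"
    by (auto intro!: derivative_eq_intros B1 B2 simp: algebra_simps)
  have d2: "(cA has_real_derivative cA1 s) (at s)"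
    by (auto intro!: derivative_eq_intros B1)
  have "((\<lambda>s. B1 s - 2 * cA1 s * B s / cA s) has_real_derivative
      B2 s - (2 * (cA2 s * B s + cA1 s * B1 s) * cA s - 2 * cA1 s * B s * cA1 s) / (cA s * cA s)) (at s)"
    by (rule DERIV_diff[OF B2 DERIV_divide[OF d1 d2 A]])
  then show "(k\<gamma> has_real_derivative k\<gamma>' s) (at s)"
    unfolding k\<gamma>_def[abs_def] k\<gamma>'_def power2_eq_square .
qed

lemma linear_equi: "linear (equi \<alpha> \<beta> \<gamma> x V)" "linear (\<lambda>V. equi \<alpha> \<beta> \<gamma> x V W)"
  by (auto intro!: linearI simp: equi_def inner_simps algebra_simps)

lemma linear_equi_deriv:
  "linear (\<lambda>X. equi_deriv \<alpha> \<beta> \<gamma> \<alpha>' \<beta>' \<gamma>' x X V W)"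
  "linear (\<lambda>V. equi_deriv \<alpha> \<beta> \<gamma> \<alpha>' \<beta>' \<gamma>' x X V W)"
  "linear (\<lambda>W. equi_deriv \<alpha> \<beta> \<gamma> \<alpha>' \<beta>' \<gamma>' x X V W)"
  by (auto intro!: linearI simp: equi_def equi_deriv_def inner_simps algebra_simps)

text \<open>The curvature operator in vector form, for the bilinear map \<open>\<Gamma>\<close> of Christoffel symbols.\<close>

definition curv :: "real^'n \<Rightarrow> real^'n \<Rightarrow> real^'n \<Rightarrow> real^'n \<Rightarrow> real^'n" where
  "curv x X Y Z =
    (let s = x \<bullet> x; \<Gamma> = equi (k\<alpha> s) (k\<beta> s) (k\<gamma> s) x; D\<Gamma> = equi_deriv (k\<alpha> s) (k\<beta> s) (k\<gamma> s) (k\<alpha>' s) (k\<beta>' s) (k\<gamma>' s) x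
     in D\<Gamma> X Y Z - D\<Gamma> Y X Z + \<Gamma> X (\<Gamma> Y Z) - \<Gamma> Y (\<Gamma> X Z))"

lemma linear_curv:
  "linear (\<lambda>X. curv x X Y Z)" "linear (\<lambda>Y. curv x X Y Z)" "linear (\<lambda>Z. curv x X Y Z)"
  unfolding curv_def Let_def
  by (intro linear_compose_add linear_compose_sub linear_equi_deriv linear_equi
    linear_compose[OF linear_equi(1) linear_equi(1), unfolded o_def]
    linear_compose[OF linear_equi(2) linear_equi(1), unfolded o_def])+

lemma linear_nth: "linear f \<Longrightarrow> linear (\<lambda>v. f v $ a)"
  by (simp add: linear_iff)

lemma riemann_tensor_rot:
  fixes x :: "real^'n"
  shows "riemann_tensor (rot_metric B) a b c d x = curv x (axis c 1) (axis d 1) (axis b 1) $ a"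
proof -
  have D: "dir_deriv UNIV (christoffel (rot_metric B) a d b) (axis c 1) x =
      equi_deriv (k\<alpha> (x \<bullet> x)) (k\<beta> (x \<bullet> x)) (k\<gamma> (x \<bullet> x)) (k\<alpha>' (x \<bullet> x)) (k\<beta>' (x \<bullet> x)) (k\<gamma>' (x \<bullet> x)) x
        (axis c 1) (axis d 1) (axis b 1) $ a" for a b c d
    unfolding christoffel_rot[abs_def]
    by (rule dir_deriv_eq[OF open_UNIV UNIV_I])
      (intro equi_has_derivative coefficients_have_derivative; simp)
  have S: "(\<Sum>e\<in>UNIV. christoffel (rot_metric B) a c e x * christoffel (rot_metric B) e d b x) =
    equi (k\<alpha> (x \<bullet> x)) (k\<beta> (x \<bullet> x)) (k\<gamma> (x \<bullet> x)) x (axis c 1)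
      (equi (k\<alpha> (x \<bullet> x)) (k\<beta> (x \<bullet> x)) (k\<gamma> (x \<bullet> x)) x (axis d 1) (axis b 1)) $ a" for a b c d
    unfolding christoffel_rot
    by (subst linear_axis_sum[OF linear_nth[OF linear_equi(1)], symmetric]) (simp add: mult.commute)
  show ?thesis
    unfolding riemann_tensor_def D S by (simp add: curv_def Let_def)
qed

lemma curvature_op_rot:
  fixes x :: "real^'n"
  shows "curvature_op (rot_metric B) x X Y Z = curv x X Y Z"
proof -
  have "(\<Sum>b\<in>UNIV. \<Sum>c\<in>UNIV. \<Sum>d\<in>UNIV. curv x (axis c 1) (axis d 1) (axis b 1) $ a * Z $ b * X $ c * Y $ d)
     = curv x X Y Z $ a" for a
  proof -
    have "(\<Sum>b\<in>UNIV. \<Sum>c\<in>UNIV. \<Sum>d\<in>UNIV. curv x (axis c 1) (axis d 1) (axis b 1) $ a * Z $ b * X $ c * Y $ d)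
       = (\<Sum>b\<in>UNIV. Z $ b * (\<Sum>c\<in>UNIV. X $ c * (\<Sum>d\<in>UNIV. Y $ d * curv x (axis c 1) (axis d 1) (axis b 1) $ a)))"
      by (simp add: sum_distrib_left mult_ac)
    also have "\<dots> = curv x X Y Z $ a"
      by (simp only: linear_axis_sum[OF linear_nth[OF linear_curv(1)]]
        linear_axis_sum[OF linear_nth[OF linear_curv(2)]] linear_axis_sum[OF linear_nth[OF linear_curv(3)]])
    finally show ?thesis .
  qed
  then show ?thesis by (simp add: curvature_op_def riemann_tensor_rot vec_eq_iff)
qed

text \<open>By equivariance the curvature form is a combination of the Gram determinant of \<open>X\<close>, \<open>Y\<close> and of
  the squared length of \<open>(x \<bullet> X) Y - (x \<bullet> Y) X\<close>. The last summand is split into two halves with separate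
  coefficients; these agree when the Christoffel symbols come from a metric. In the proof the curvature vector
  is decomposed along \<open>Y\<close>, \<open>X\<close> and \<open>x\<close>, and the inner product of \<open>x\<close> with \<open>X\<close> is Euclidean.\<close>

lemma equi_curvature_form:
  fixes x X Y :: "real^'n" and A b \<alpha> \<beta> \<gamma> \<alpha>' \<beta>' \<gamma>' :: real
  defines "s \<equiv> x \<bullet> x" and "xX \<equiv> x \<bullet> X" and "xY \<equiv> x \<bullet> Y" and "XX \<equiv> X \<bullet> X" and "XY \<equiv> X \<bullet> Y" and "YY \<equiv> Y \<bullet> Y"
  defines "\<Gamma> \<equiv> equi \<alpha> \<beta> \<gamma> x" and "D \<equiv> equi_deriv \<alpha> \<beta> \<gamma> \<alpha>' \<beta>' \<gamma>' x"
  defines "R \<equiv> D X Y Y - D Y X Y + \<Gamma> X (\<Gamma> Y Y) - \<Gamma> Y (\<Gamma> X Y)"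
  assumes A: "A = 1 - s * b"
  shows "A * (R \<bullet> X) + b * ((x \<bullet> R) * xX) =
    (A * (\<beta> - \<alpha>) + \<alpha> * \<beta> * s * A) * (XX * YY - XY\<^sup>2)
    + (2 * \<beta>' - \<gamma> - (\<alpha> - \<beta>) * b + \<alpha> * \<beta> * s * b + \<beta>\<^sup>2 + \<beta> * \<gamma> * s) * (xX\<^sup>2 * YY - xX * xY * XY)
    + A * (\<gamma> + \<alpha>\<^sup>2 + \<alpha> * \<gamma> * s - 2 * \<alpha>') * (xY\<^sup>2 * XX - xX * xY * XY)"
proof -
  define p where "p = 2 * \<alpha> * xY"
  define q where "q = \<beta> * YY + \<gamma> * xY\<^sup>2"
  define r where "r = \<beta> * XY + \<gamma> * xX * xY"
  define xW where "xW = p * xY + q * s"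
  define XW where "XW = p * XY + q * xX"
  define xV where "xV = 2 * \<alpha> * xX * xY + r * s"
  define YV where "YV = \<alpha> * xX * YY + \<alpha> * xY * XY + r * xY"
  define cY where "cY = 2 * \<alpha>' * xX * xY + (\<alpha> - \<beta>) * XY - \<gamma> * xX * xY + \<alpha> * xX * p - \<alpha> * xY * \<alpha> * xX - \<alpha> * xV"
  define cX where "cX = (\<beta> - \<alpha>) * YY + \<gamma> * xY\<^sup>2 - 2 * \<alpha>' * xY\<^sup>2 + \<alpha> * xW - \<alpha>\<^sup>2 * xY\<^sup>2"
  define cx where "cx = (2 * \<beta>' - \<gamma>) * (xX * YY - xY * XY) + \<alpha> * xX * q + \<beta> * XW + \<gamma> * xX * xW
     - \<alpha> * xY * r - \<beta> * YV - \<gamma> * xY * xV"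
  have YY1: "\<Gamma> Y Y = p *\<^sub>R Y + q *\<^sub>R x"
    by (simp add: \<Gamma>_def equi_def p_def q_def xY_def YY_def algebra_simps power2_eq_square flip: scaleR_2)
  have XY1: "\<Gamma> X Y = (\<alpha> * xX) *\<^sub>R Y + (\<alpha> * xY) *\<^sub>R X + r *\<^sub>R x"
    by (simp add: \<Gamma>_def equi_def r_def xY_def xX_def XY_def algebra_simps)
  have i: "x \<bullet> (p *\<^sub>R Y + q *\<^sub>R x) = xW" "X \<bullet> (p *\<^sub>R Y + q *\<^sub>R x) = XW"
    "x \<bullet> ((\<alpha> * xX) *\<^sub>R Y + (\<alpha> * xY) *\<^sub>R X + r *\<^sub>R x) = xV"
    "Y \<bullet> ((\<alpha> * xX) *\<^sub>R Y + (\<alpha> * xY) *\<^sub>R X + r *\<^sub>R x) = YV"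
    by (simp_all add: xW_def XW_def xV_def YV_def xX_def xY_def XY_def YY_def s_def inner_simps inner_commute algebra_simps)
  have d: "D X Y Y - D Y X Y = (2 * \<alpha>' * xX * xY + (\<alpha> - \<beta>) * XY - \<gamma> * xX * xY) *\<^sub>R Y
      + ((\<beta> - \<alpha>) * YY + \<gamma> * xY\<^sup>2 - 2 * \<alpha>' * xY\<^sup>2) *\<^sub>R X + ((2 * \<beta>' - \<gamma>) * (xX * YY - xY * XY)) *\<^sub>R x"
    unfolding D_def equi_deriv_def equi_def xX_def[symmetric] xY_def[symmetric] YY_def[symmetric] XY_def[symmetric]
      inner_commute[of Y X]
    by (simp add: vec_eq_iff power2_eq_square algebra_simps flip: xX_def xY_def YY_def XY_def)
  have R: "R = cY *\<^sub>R Y + cX *\<^sub>R X + cx *\<^sub>R x"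
    unfolding R_def YY1 XY1
    unfolding d
    unfolding \<Gamma>_def equi_def i xX_def[symmetric] xY_def[symmetric]
    by (simp add: cY_def cX_def cx_def vec_eq_iff power2_eq_square algebra_simps)
  have "A * (R \<bullet> X) + b * ((x \<bullet> R) * xX) = cY * (A * XY + b * xX * xY) + cX * (A * XX + b * xX\<^sup>2)
     + cx * xX * (A + s * b)"
    unfolding R by (simp add: inner_simps inner_commute xX_def xY_def XY_def XX_def s_def algebra_simps power2_eq_square)
  also have "A + s * b = 1" by (simp add: A)
  finally show ?thesis
    unfolding cY_def cX_def cx_def xV_def YV_def xW_def XW_def p_def q_def r_def
    by (simp add: algebra_simps power2_eq_square)
qed

text \<open>The factor \<open>x \<bullet> x\<close> clears the denominator that arises when the plane of \<open>X\<close>, \<open>Y\<close> is split into its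
  tangential and radial parts; the pole is treated separately.\<close>

lemma curvature_numerator:
  fixes x X Y :: "real^'n"
  shows "(x \<bullet> x) * metric_inner (rot_metric B x) (curv x X Y Y) X =
    curv_tan B B1 (x \<bullet> x) * ((x \<bullet> x) * ((X \<bullet> X) * (Y \<bullet> Y) - (X \<bullet> Y)\<^sup>2)
        - ((x \<bullet> X)\<^sup>2 * (Y \<bullet> Y) - 2 * (x \<bullet> X) * (x \<bullet> Y) * (X \<bullet> Y) + (x \<bullet> Y)\<^sup>2 * (X \<bullet> X)))
    + curv_rad B B1 B2 (x \<bullet> x) * ((x \<bullet> X)\<^sup>2 * (Y \<bullet> Y) - 2 * (x \<bullet> X) * (x \<bullet> Y) * (X \<bullet> Y) + (x \<bullet> Y)\<^sup>2 * (X \<bullet> X))"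
    "x = 0 \<Longrightarrow> metric_inner (rot_metric B x) (curv x X Y Y) X = curv_tan B B1 0 * ((X \<bullet> X) * (Y \<bullet> Y) - (X \<bullet> Y)\<^sup>2)"
proof -
  define s where "s = x \<bullet> x"
  have A: "cA s \<noteq> 0" using A_pos[of s] by (simp add: s_def)
  define E where "E = (X \<bullet> X) * (Y \<bullet> Y) - (X \<bullet> Y)\<^sup>2"
  define F where "F = (x \<bullet> X)\<^sup>2 * (Y \<bullet> Y) - 2 * (x \<bullet> X) * (x \<bullet> Y) * (X \<bullet> Y) + (x \<bullet> Y)\<^sup>2 * (X \<bullet> X)"
  define c1 where "c1 = cA s * (k\<beta> s - k\<alpha> s) + k\<alpha> s * k\<beta> s * s * cA s"
  define c2 where "c2 = 2 * k\<beta>' s - k\<gamma> s - (k\<alpha> s - k\<beta> s) * B s + k\<alpha> s * k\<beta> s * s * B s + (k\<beta> s)\<^sup>2 + k\<beta> s * k\<gamma> s * s"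
  define c3 where "c3 = cA s * (k\<gamma> s + (k\<alpha> s)\<^sup>2 + k\<alpha> s * k\<gamma> s * s - 2 * k\<alpha>' s)"
  have c1: "c1 = curv_tan B B1 s"
    using A by (simp add: c1_def curv_tan_def k\<alpha>_def k\<beta>_def) (simp add: field_simps power2_eq_square)
  have c23: "c2 = c3"
    using A by (simp add: c2_def c3_def k\<alpha>_def k\<beta>_def k\<gamma>_def k\<alpha>'_def k\<beta>'_def divide_simps)
      (simp add: algebra_simps power2_eq_square)
  have c12: "c1 + s * c2 = curv_rad B B1 B2 s"
    using A by (simp add: c1_def c2_def curv_rad_def k\<alpha>_def k\<beta>_def k\<gamma>_def k\<alpha>'_def k\<beta>'_def divide_simps)
      (simp add: algebra_simps power2_eq_square)
  have num: "metric_inner (rot_metric B x) (curv x X Y Y) X = c1 * E + c2 * F"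
  proof -
    have "metric_inner (rot_metric B x) (curv x X Y Y) X
      = cA s * (curv x X Y Y \<bullet> X) + B s * ((x \<bullet> curv x X Y Y) * (x \<bullet> X))"
      unfolding metric_inner_rot s_def by simp
    also have "\<dots> = c1 * E + c2 * ((x \<bullet> X)\<^sup>2 * (Y \<bullet> Y) - (x \<bullet> X) * (x \<bullet> Y) * (X \<bullet> Y))
        + c3 * ((x \<bullet> Y)\<^sup>2 * (X \<bullet> X) - (x \<bullet> X) * (x \<bullet> Y) * (X \<bullet> Y))"
      unfolding curv_def Let_def c1_def c2_def c3_def E_def s_def
      by (rule equi_curvature_form) simp
    finally show ?thesis by (simp add: c23[symmetric] F_def algebra_simps)
  qed
  have "s * (c1 * E + c2 * F) = c1 * (s * E - F) + (c1 + s * c2) * F"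
    by (simp add: algebra_simps)
  then show "(x \<bullet> x) * metric_inner (rot_metric B x) (curv x X Y Y) X =
    curv_tan B B1 (x \<bullet> x) * ((x \<bullet> x) * ((X \<bullet> X) * (Y \<bullet> Y) - (X \<bullet> Y)\<^sup>2)
        - ((x \<bullet> X)\<^sup>2 * (Y \<bullet> Y) - 2 * (x \<bullet> X) * (x \<bullet> Y) * (X \<bullet> Y) + (x \<bullet> Y)\<^sup>2 * (X \<bullet> X)))
    + curv_rad B B1 B2 (x \<bullet> x) * ((x \<bullet> X)\<^sup>2 * (Y \<bullet> Y) - 2 * (x \<bullet> X) * (x \<bullet> Y) * (X \<bullet> Y) + (x \<bullet> Y)\<^sup>2 * (X \<bullet> X))"
    unfolding s_def[symmetric] E_def[symmetric] F_def[symmetric] num c12[symmetric] c1[symmetric] .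
  show "metric_inner (rot_metric B x) (curv x X Y Y) X = curv_tan B B1 0 * ((X \<bullet> X) * (Y \<bullet> Y) - (X \<bullet> Y)\<^sup>2)"
    if "x = 0" using num c1 that by (simp add: F_def E_def s_def)
qed

text \<open>The vector \<open>(Y \<bullet> Y) X - (X \<bullet> Y) Y\<close> does not vanish, and its squared length is \<open>Y \<bullet> Y\<close> times this
  determinant.\<close>

lemma gram_pos:
  fixes X Y :: "real^'n"
  assumes "X \<noteq> Y" "independent {X, Y}"
  shows "(X \<bullet> X) * (Y \<bullet> Y) - (X \<bullet> Y)\<^sup>2 > 0"
proof -
  have Y: "Y \<noteq> 0" using assms(2) dependent_zero by blast
  define v where "v = (Y \<bullet> Y) *\<^sub>R X - (X \<bullet> Y) *\<^sub>R Y"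
  have "v \<noteq> 0"
  proof
    assume "v = 0"
    then have "X = ((X \<bullet> Y) / (Y \<bullet> Y)) *\<^sub>R Y"
      using Y by (simp add: v_def eq_vector_fraction_iff)
    then have "X \<in> span {Y}" by (metis span_base span_scale singletonI)
    moreover have "X \<notin> span {Y}"
      using assms independent_insert[of X "{Y}"] by auto
    ultimately show False by blast
  qed
  then have "v \<bullet> v > 0" by simp
  moreover have "v \<bullet> v = (Y \<bullet> Y) * ((X \<bullet> X) * (Y \<bullet> Y) - (X \<bullet> Y)\<^sup>2)"
    by (simp add: v_def inner_simps inner_commute algebra_simps power2_eq_square)
  moreover have "Y \<bullet> Y > 0" using Y by simp
  ultimately show ?thesis by (metis zero_less_mult_pos)
qed

text \<open>The difference is the Gram determinant of \<open>x\<close>, \<open>X\<close>, \<open>Y\<close>, and a positive multiple of it is the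
  squared length of a multiple of the component of \<open>x\<close> orthogonal to \<open>X\<close> and \<open>Y\<close>.\<close>

lemma gram3_nonneg:
  fixes x X Y :: "real^'n"
  assumes "(X \<bullet> X) * (Y \<bullet> Y) - (X \<bullet> Y)\<^sup>2 > 0"
  shows "(x \<bullet> X)\<^sup>2 * (Y \<bullet> Y) - 2 * (x \<bullet> X) * (x \<bullet> Y) * (X \<bullet> Y) + (x \<bullet> Y)\<^sup>2 * (X \<bullet> X)
    \<le> (x \<bullet> x) * ((X \<bullet> X) * (Y \<bullet> Y) - (X \<bullet> Y)\<^sup>2)" (is "?F \<le> (x \<bullet> x) * ?E")
proof -
  \<comment> \<open>the Gram-Schmidt vector, with denominators cleared\<close>
  define v where "v = ?E *\<^sub>R x - ((x \<bullet> X) * (Y \<bullet> Y) - (x \<bullet> Y) * (X \<bullet> Y)) *\<^sub>R X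
    - ((x \<bullet> Y) * (X \<bullet> X) - (x \<bullet> X) * (X \<bullet> Y)) *\<^sub>R Y"
  have "v \<bullet> v = ?E * ((x \<bullet> x) * ?E - ?F)"
    unfolding v_def by (simp add: inner_simps inner_commute algebra_simps power2_eq_square)
  then have "?E * ((x \<bullet> x) * ?E - ?F) \<ge> 0" by (metis inner_ge_zero)
  then show ?thesis using assms by (simp add: zero_le_mult_iff)
qed

text \<open>Numerator and denominator of the sectional curvature are combinations, with coefficients of one
  sign, of the nonnegative quantities \<open>F\<close> and \<open>s * E - F\<close>, which do not vanish together.\<close>

theorem negatively_curved_rot_metric:
  assumes "\<And>s. s \<ge> 0 \<Longrightarrow> curv_tan B B1 s < 0" "\<And>s. s \<ge> 0 \<Longrightarrow> curv_rad B B1 B2 s < 0"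
  shows "negatively_curved (rot_metric B :: real^'n \<Rightarrow> real^'n^'n)"
  unfolding negatively_curved_def
proof (intro allI impI, elim conjE)
  fix x X Y :: "real^'n" assume XY: "X \<noteq> Y" "independent {X, Y}"
  define s where "s = x \<bullet> x"
  have s0: "s \<ge> 0" by (simp add: s_def)
  define E where "E = (X \<bullet> X) * (Y \<bullet> Y) - (X \<bullet> Y)\<^sup>2"
  define F where "F = (x \<bullet> X)\<^sup>2 * (Y \<bullet> Y) - 2 * (x \<bullet> X) * (x \<bullet> Y) * (X \<bullet> Y) + (x \<bullet> Y)\<^sup>2 * (X \<bullet> X)"
  have E: "E > 0" unfolding E_def by (rule gram_pos[OF XY])
  have FE: "F \<le> s * E" unfolding E_def F_def s_def by (rule gram3_nonneg[OF gram_pos[OF XY]])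
  have F0: "F \<ge> 0"
  proof -
    define v where "v = (x \<bullet> X) *\<^sub>R Y - (x \<bullet> Y) *\<^sub>R X"
    have "v \<bullet> v = F" by (simp add: v_def F_def inner_simps inner_commute algebra_simps power2_eq_square)
    then show ?thesis by (metis inner_ge_zero)
  qed
  have A: "cA s > 0" using A_pos[OF s0] .
  define N where "N = metric_inner (rot_metric B x) (curv x X Y Y) X"
  define Dn where "Dn = metric_inner (rot_metric B x) X X * metric_inner (rot_metric B x) Y Y - (metric_inner (rot_metric B x) X Y)\<^sup>2"
  have Dn: "Dn = (cA s)\<^sup>2 * E + cA s * B s * F"
    unfolding Dn_def metric_inner_rot E_def F_def s_def
    by (simp add: algebra_simps power2_eq_square inner_commute)
  have "N < 0 \<and> Dn > 0"
  proof (cases "x = 0")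
    case True
    then have "N = curv_tan B B1 0 * E" using curvature_numerator(2)[of x] by (simp add: N_def E_def)
    then have "N < 0" using assms(1)[of 0] E by (simp add: mult_neg_pos)
    moreover have "Dn > 0" using True E by (simp add: Dn F_def s_def)
    ultimately show ?thesis ..
  next
    case False
    then have s: "s > 0" by (simp add: s_def)
    have "s * N = curv_tan B B1 s * (s * E - F) + curv_rad B B1 B2 s * F"
      unfolding N_def s_def E_def F_def by (rule curvature_numerator(1))
    moreover have "curv_tan B B1 s * (s * E - F) + curv_rad B B1 B2 s * F < 0"
    proof (cases "F = s * E")
      case True
      then show ?thesis using assms(2)[OF s0] s E by (simp add: mult_neg_pos)
    next
      case False
      then have "curv_tan B B1 s * (s * E - F) < 0" using FE assms(1)[OF s0] by (intro mult_neg_pos) auto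
      moreover have "curv_rad B B1 B2 s * F \<le> 0" using F0 assms(2)[OF s0] by (intro mult_nonpos_nonneg) auto
      ultimately show ?thesis by simp
    qed
    ultimately have "s * N < 0" by linarith
    then have "N < 0" using s by (simp add: mult_less_0_iff)
    moreover have "s * Dn = (cA s)\<^sup>2 * (s * E - F) + cA s * F"
      unfolding Dn by (simp add: algebra_simps power2_eq_square)
    moreover have "(cA s)\<^sup>2 * (s * E - F) + cA s * F > 0"
    proof (cases "F = s * E")
      case True
      then show ?thesis using A s E by simp
    next
      case False
      then have "(cA s)\<^sup>2 * (s * E - F) > 0" using FE A by (intro mult_pos_pos) auto
      moreover have "cA s * F \<ge> 0" using F0 A by simp
      ultimately show ?thesis by simp
    qed
    ultimately have "N < 0 \<and> s * Dn > 0" by linarith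
    then show ?thesis using s by (simp add: zero_less_mult_iff)
  qed
  then show "sectional_curvature (rot_metric B) x X Y < 0"
    unfolding sectional_curvature_def curvature_op_rot N_def Dn_def by (simp add: divide_neg_pos)
qed

end

section \<open>The wave map equation for corotational maps\<close>

lemma axis_component: "axis i (1 :: real) $ j = (if i = j then 1 else 0)"
  by (simp add: axis_def)

lemma sum_Basis_vec: "(\<Sum>b\<in>(Basis :: (real^'n) set). g b) = (\<Sum>i\<in>UNIV. g (axis i 1))"
proof -
  have B: "(Basis :: (real^'n) set) = range (\<lambda>i. axis i 1)"
    by (auto simp: Basis_vec_def)
  show ?thesis
    unfolding B by (subst sum.reindex) (auto simp: inj_on_def axis_eq_axis)
qed

lemma sum_Basis_spacetime:
  "(\<Sum>\<mu>\<in>(Basis :: (real \<times> (real^'n)) set). g \<mu>) = g (1, 0) + (\<Sum>i\<in>UNIV. g (0, axis i 1))"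
proof -
  have "(\<Sum>\<mu>\<in>(Basis :: (real \<times> (real^'n)) set). g \<mu>) = (\<Sum>\<mu>\<in>(\<lambda>u. (u, 0)) ` (Basis :: real set). g \<mu>) + (\<Sum>\<mu>\<in>Pair 0 ` Basis. g \<mu>)"
    unfolding Basis_prod_def by (subst sum.union_disjoint) auto
  also have "(\<Sum>\<mu>\<in>Pair 0 ` (Basis :: (real^'n) set). g \<mu>) = (\<Sum>b\<in>Basis. g (0, b))"
    by (subst sum.reindex) (auto simp: inj_on_def)
  finally show ?thesis by (simp add: sum_Basis_vec)
qed

lemma wave_map_lagrangian_eq:
  fixes y :: "real^'n"
  shows
  "wave_map_lagrangian h y p = - metric_inner (h y) (p (1, 0)) (p (1, 0))
    + (\<Sum>i\<in>UNIV. metric_inner (h y) (p (0, axis i 1)) (p (0, axis i 1)))"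
proof -
  have "minkowski (0, axis i 1 :: real^'n) (0, axis j 1) * c = (if i = j then c else 0)" for i j :: 'n and c
    by (simp add: minkowski_def) (simp add: axis_def)
  moreover have "minkowski (1, 0) (0, axis j 1 :: real^'n) = 0" "minkowski (0, axis j 1 :: real^'n) (1, 0) = 0"
    "minkowski (1, 0 :: real^'n) (1, 0) = -1" for j :: 'n
    by (simp_all add: minkowski_def)
  ultimately show ?thesis
    unfolding wave_map_lagrangian_def sum_Basis_spacetime by simp
qed

lemma metric_inner_rot_line:
  "metric_inner (rot_metric B y) (p + s *\<^sub>R v) (p + s *\<^sub>R v) =
    metric_inner (rot_metric B y) p p + 2 * s * metric_inner (rot_metric B y) p v + s\<^sup>2 * metric_inner (rot_metric B y) v v"
  unfolding metric_inner_rot by (simp add: inner_simps inner_commute algebra_simps power2_eq_square)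

lemma deriv_quadratic: "deriv (\<lambda>s. c0 + (c1 + 2 * s * c2 + s\<^sup>2 * c3 :: real)) 0 = 2 * c2"
  by (rule DERIV_imp_deriv) (auto intro!: derivative_eq_intros)

lemma deriv_lagrangian_time:
  "deriv (\<lambda>s. wave_map_lagrangian (rot_metric B) y (p((1, 0) := p (1, 0) + s *\<^sub>R v))) 0 =
    - 2 * metric_inner (rot_metric B y) (p (1, 0)) v"
proof -
  define S where "S = (\<Sum>i\<in>UNIV. metric_inner (rot_metric B y) (p (0, axis i 1)) (p (0, axis i 1)))"
  have e: "wave_map_lagrangian (rot_metric B) y (p((1, 0) := p (1, 0) + s *\<^sub>R v)) =
    S + (- metric_inner (rot_metric B y) (p (1, 0)) (p (1, 0)) + 2 * s * (- metric_inner (rot_metric B y) (p (1, 0)) v)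
       + s\<^sup>2 * (- metric_inner (rot_metric B y) v v))" for s
    unfolding wave_map_lagrangian_eq S_def by (simp add: metric_inner_rot_line)
  show ?thesis unfolding e deriv_quadratic by simp
qed

lemma deriv_lagrangian_space:
  "deriv (\<lambda>s. wave_map_lagrangian (rot_metric B) y (p((0, axis j 1) := p (0, axis j 1) + s *\<^sub>R v))) 0 =
    2 * metric_inner (rot_metric B y) (p (0, axis j 1)) v"
proof -
  let ?m = "metric_inner (rot_metric B y)"
  define S where "S = - ?m (p (1, 0)) (p (1, 0)) + (\<Sum>i\<in>UNIV - {j}. ?m (p (0, axis i 1)) (p (0, axis i 1)))"
  have e: "wave_map_lagrangian (rot_metric B) y (p((0, axis j 1) := p (0, axis j 1) + s *\<^sub>R v)) =
    S + (?m (p (0, axis j 1)) (p (0, axis j 1)) + 2 * s * ?m (p (0, axis j 1)) v + s\<^sup>2 * ?m v v)" for s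
  proof -
    let ?q = "p((0, axis j 1) := p (0, axis j 1) + s *\<^sub>R v)"
    have "(\<Sum>i\<in>UNIV. ?m (?q (0, axis i 1)) (?q (0, axis i 1)))
      = ?m (?q (0, axis j 1)) (?q (0, axis j 1)) + (\<Sum>i\<in>UNIV - {j}. ?m (?q (0, axis i 1)) (?q (0, axis i 1)))"
      by (subst sum.remove[of UNIV j]) auto
    also have "(\<Sum>i\<in>UNIV - {j}. ?m (?q (0, axis i 1)) (?q (0, axis i 1))) = (\<Sum>i\<in>UNIV - {j}. ?m (p (0, axis i 1)) (p (0, axis i 1)))"
      by (intro sum.cong refl) (auto simp: axis_eq_axis)
    finally show ?thesis
      unfolding wave_map_lagrangian_eq S_def by (simp add: metric_inner_rot_line)
  qed
  show ?thesis unfolding e deriv_quadratic by simp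
qed

lemma deriv_metric_inner_point:
  fixes y v :: "real^'n"
  assumes "\<And>s. (B has_real_derivative B1 s) (at s)"
  shows "((\<lambda>s. metric_inner (rot_metric B (y + s *\<^sub>R axis a 1)) v v) has_real_derivative
    2 * y $ a * ((- B (y \<bullet> y) - (y \<bullet> y) * B1 (y \<bullet> y)) * (v \<bullet> v) + B1 (y \<bullet> y) * (y \<bullet> v)\<^sup>2)
    + 2 * B (y \<bullet> y) * (y \<bullet> v) * v $ a) (at 0)"
proof -
  have q: "((\<lambda>s. (y + s *\<^sub>R axis a 1) \<bullet> (y + s *\<^sub>R axis a 1)) has_real_derivative 2 * y $ a) (at 0)"
  proof -
    have "((\<lambda>s. y \<bullet> y + 2 * s * y $ a + s\<^sup>2) has_real_derivative 2 * y $ a) (at 0)"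
      by (auto intro!: derivative_eq_intros)
    moreover have "(y + s *\<^sub>R axis a 1) \<bullet> (y + s *\<^sub>R axis a 1) = y \<bullet> y + 2 * s * y $ a + s\<^sup>2" for s
      by (simp add: inner_simps inner_axis_axis algebra_simps power2_eq_square)
    ultimately show ?thesis by simp
  qed
  have Bq: "((\<lambda>s. B ((y + s *\<^sub>R axis a 1) \<bullet> (y + s *\<^sub>R axis a 1))) has_real_derivative B1 (y \<bullet> y) * (2 * y $ a)) (at 0)"
    using DERIV_chain2[OF assms q] by simp
  have l: "((\<lambda>s. (y + s *\<^sub>R axis a 1) \<bullet> v) has_real_derivative v $ a) (at 0)"
  proof -
    have "((\<lambda>s. y \<bullet> v + s * v $ a) has_real_derivative v $ a) (at 0)"
      by (auto intro!: derivative_eq_intros)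
    then show ?thesis by (simp add: inner_simps)
  qed
  have e: "metric_inner (rot_metric B z) v v = (v \<bullet> v) - (z \<bullet> z) * B (z \<bullet> z) * (v \<bullet> v) + B (z \<bullet> z) * ((z \<bullet> v) * (z \<bullet> v))" for z
    by (simp add: metric_inner_rot algebra_simps)
  show ?thesis
    unfolding e
    by (rule DERIV_cong[OF DERIV_add[OF DERIV_diff[OF DERIV_const DERIV_cmult_right[OF DERIV_mult[OF q Bq]]]
        DERIV_mult[OF Bq DERIV_mult[OF l l]]]])
      (simp add: algebra_simps power2_eq_square)
qed

text \<open>All terms of the Euler-Lagrange system are multiples of \<open>x\<close>, which leaves one scalar equation.
  Since radial lines are geodesics with arc length parameter, the derivatives of \<open>f\<close> enter only through its
  wave operator: \<open>ft' z (1, 0)\<close> is \<open>f\<^sub>t\<^sub>t\<close>, and \<open>(n + 2) \<kappa> + x \<bullet> \<nabla>\<kappa>\<close> is the Laplacian of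
  \<open>f\<close> in dimension \<open>n + 2\<close>, because the gradient of \<open>f\<close> is \<open>\<kappa> x\<close>.\<close>

theorem corotational_wave_map:
  fixes f ft \<kappa> :: "real \<times> (real^'n) \<Rightarrow> real"
  assumes D: "thick D" "D \<subseteq> \<Omega>" and opn: "open \<Omega>"
    and fsm: "smooth_on \<Omega> f"
    and fd: "\<And>z. z \<in> \<Omega> \<Longrightarrow> (f has_derivative (\<lambda>v. ft z * fst v + \<kappa> z * (snd z \<bullet> snd v))) (at z)"
    and ftd: "\<And>z. z \<in> \<Omega> \<Longrightarrow> (ft has_derivative ft' z) (at z)"
    and \<kappa>d: "\<And>z. z \<in> \<Omega> \<Longrightarrow> (\<kappa> has_derivative \<kappa>' z) (at z)"
    and B1: "\<And>s. (B has_real_derivative B1 s) (at s)"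
    and pde: "\<And>z. z \<in> D \<Longrightarrow>
      ft' z (1, 0) - (real CARD('n) + 2) * \<kappa> z - \<kappa>' z (0, snd z)
      - (real CARD('n) - 1) * f z ^ 3 * (2 * B ((f z)\<^sup>2 * (snd z \<bullet> snd z))
          + (f z)\<^sup>2 * (snd z \<bullet> snd z) * B1 ((f z)\<^sup>2 * (snd z \<bullet> snd z))) = 0"
  shows "wave_map (rot_metric B) D (\<lambda>z. f z *\<^sub>R snd z)"
proof -
  define U where "U z = f z *\<^sub>R snd z" for z
  define DU where "DU z v = f z *\<^sub>R snd v + (ft z * fst v + \<kappa> z * (snd z \<bullet> snd v)) *\<^sub>R snd z" for z v
  have Ud: "(U has_derivative DU z) (at z)" if "z \<in> \<Omega>" for z
    unfolding U_def[abs_def] DU_def[abs_def]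
    by (rule has_derivative_eq_rhs[OF has_derivative_scaleR[OF fd[OF that] has_derivative_snd[OF has_derivative_ident]]])
      (simp add: fun_eq_iff)
  have dU: "dir_deriv D U v z = DU z v" if "z \<in> D" for v z
    using dir_deriv_within[OF D(1) that Ud] that D(2) by blast
  have "smooth_on D U"
    unfolding U_def
    by (rule smooth_on_thick_subset[OF opn D(2,1)]) (auto intro!: smooth_on_scaleR smooth_on_snd fsm opn)
  moreover have "euler_lagrange (wave_map_lagrangian (rot_metric B)) D U"
    unfolding euler_lagrange_def
  proof (intro ballI allI)
    fix z a assume z: "z \<in> D"
    then have zO: "z \<in> \<Omega>" using D(2) by blast
    define P where "P \<mu> q = (let DU = (\<lambda>\<nu>. dir_deriv D U \<nu> q) in
      deriv (\<lambda>s. wave_map_lagrangian (rot_metric B) (U q) (DU(\<mu> := DU \<mu> + s *\<^sub>R axis a 1))) 0)" for \<mu> q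
    define \<sigma> where "\<sigma> q = (f q)\<^sup>2 * (snd q \<bullet> snd q)" for q
    define Qi where "Qi i q = 2 * ((1 - \<sigma> q * B (\<sigma> q)) * f q * (if i = a then 1 else 0)
      + (\<kappa> q + B (\<sigma> q) * f q ^ 3) * (snd q $ i * snd q $ a))" for i q
    have UU: "U q \<bullet> U q = \<sigma> q" for q by (simp add: U_def \<sigma>_def power2_eq_square)
    have Pt: "P (1, 0) q = - 2 * (ft q * snd q $ a)" if "q \<in> D" for q
    proof -
      have "P (1, 0) q = - 2 * metric_inner (rot_metric B (U q)) (ft q *\<^sub>R snd q) (axis a 1)"
        unfolding P_def Let_def deriv_lagrangian_time dU[OF that] by (simp add: DU_def)
      also have "\<dots> = - 2 * (ft q * snd q $ a)"
        unfolding metric_inner_rot UU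
        by (simp add: U_def \<sigma>_def algebra_simps power2_eq_square)
      finally show ?thesis .
    qed
    have Pi: "P (0, axis i 1) q = Qi i q" if "q \<in> D" for q i
    proof -
      have "P (0, axis i 1) q = 2 * metric_inner (rot_metric B (U q)) (f q *\<^sub>R axis i 1 + (\<kappa> q * snd q $ i) *\<^sub>R snd q) (axis a 1)"
        unfolding P_def Let_def deriv_lagrangian_space dU[OF that] by (simp add: DU_def)
      also have "\<dots> = Qi i q"
        unfolding metric_inner_rot UU Qi_def
        by (simp add: U_def \<sigma>_def inner_simps inner_axis_axis algebra_simps power2_eq_square power3_eq_cube)
          (simp add: axis_def)
      finally show ?thesis .
    qed
    define F S K where "F = f z" and "S = snd z \<bullet> snd z" and "K = \<kappa> z"
    define b b1 where "b = B (\<sigma> z)" and "b1 = B1 (\<sigma> z)"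
    have \<sigma>z: "\<sigma> z = F\<^sup>2 * S" by (simp add: \<sigma>_def F_def S_def)
    have Dt: "dir_deriv D (P (1, 0)) (1, 0) z = - 2 * (ft' z (1, 0) * snd z $ a)"
    proof -
      have "((\<lambda>q. - 2 * (ft q * snd q $ a)) has_derivative (\<lambda>v. - 2 * (ft z * snd v $ a + ft' z v * snd z $ a))) (at z)"
        by (rule has_derivative_mult_right[OF has_derivative_mult[OF ftd[OF zO]]])
          (auto intro!: bounded_linear_imp_has_derivative bounded_linear_compose[OF bounded_linear_vec_nth bounded_linear_snd])
      from dir_deriv_within[OF D(1) z this, of "(1, 0)"]
      show ?thesis using dir_deriv_cong[OF Pt z] by simp
    qed
    define c where "c = 2 * (- b - \<sigma> z * b1) * F\<^sup>2 * (K * S + F) + (1 - \<sigma> z * b) * K + K + b * F ^ 3"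
    have Di: "dir_deriv D (P (0, axis i 1)) (0, axis i 1) z =
      2 * ((if i = a then c * snd z $ a else 0) + snd z $ a * (snd z $ i * \<kappa>' z (0, axis i 1))
        + snd z $ a * (2 * b1 * F ^ 4 * (K * S + F) + 3 * b * F\<^sup>2 * K) * (snd z $ i * snd z $ i)
        + (K + b * F ^ 3) * snd z $ a)" for i
    proof -
      define \<sigma>' where "\<sigma>' v = F\<^sup>2 * (2 * (snd z \<bullet> snd v)) + 2 * F * (ft z * fst v + K * (snd z \<bullet> snd v)) * S" for v
      have sd: "(\<sigma> has_derivative \<sigma>') (at z)"
        unfolding \<sigma>_def[abs_def] \<sigma>'_def[abs_def] F_def S_def K_def
      proof -
        have "((\<lambda>q. (f q)\<^sup>2) has_derivative (\<lambda>v. 2 * f z * (ft z * fst v + \<kappa> z * (snd z \<bullet> snd v)))) (at z)"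
          using has_derivative_power[OF fd[OF zO], of 2] by (simp add: mult_ac)
        moreover have "((\<lambda>q :: real \<times> (real^'n). snd q \<bullet> snd q) has_derivative (\<lambda>v. 2 * (snd z \<bullet> snd v))) (at z)"
          by (rule has_derivative_compose[OF has_derivative_snd[OF has_derivative_ident] has_derivative_norm_sq])
        ultimately show "((\<lambda>q. (f q)\<^sup>2 * (snd q \<bullet> snd q)) has_derivative
            (\<lambda>v. (f z)\<^sup>2 * (2 * (snd z \<bullet> snd v)) + 2 * f z * (ft z * fst v + \<kappa> z * (snd z \<bullet> snd v)) * (snd z \<bullet> snd z))) (at z)"
          by (rule has_derivative_mult)
      qed
      have Bd: "((\<lambda>q. B (\<sigma> q)) has_derivative (\<lambda>v. b1 * \<sigma>' v)) (at z)"
        using has_derivative_compose[OF sd B1[unfolded has_field_derivative_def]] by (simp add: b1_def)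
      have nd: "((\<lambda>q. snd q $ i) has_derivative (\<lambda>v. snd v $ i)) (at z)" for i
        by (auto intro!: bounded_linear_imp_has_derivative bounded_linear_compose[OF bounded_linear_vec_nth bounded_linear_snd])
      have c3: "((\<lambda>q. f q ^ 3) has_derivative (\<lambda>v. 3 * F\<^sup>2 * (ft z * fst v + K * (snd z \<bullet> snd v)))) (at z)"
        using has_derivative_power[OF fd[OF zO], of 3] by (simp add: F_def K_def algebra_simps)
      have "(Qi i has_derivative (\<lambda>v. 2 * (
          ((- (\<sigma> z * (b1 * \<sigma>' v) + \<sigma>' v * b)) * F + (1 - \<sigma> z * b) * (ft z * fst v + K * (snd z \<bullet> snd v))) * (if i = a then 1 else 0)
          + ((\<kappa>' z v + (b * (3 * F\<^sup>2 * (ft z * fst v + K * (snd z \<bullet> snd v))) + b1 * \<sigma>' v * F ^ 3)) * (snd z $ i * snd z $ a)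
            + (K + b * F ^ 3) * (snd z $ i * snd v $ a + snd v $ i * snd z $ a))))) (at z)"
        unfolding Qi_def[abs_def]
        by (rule has_derivative_eq_rhs[OF has_derivative_mult_right[OF has_derivative_add[OF
            has_derivative_mult_left[OF has_derivative_mult[OF has_derivative_diff[OF has_derivative_const has_derivative_mult[OF sd Bd]] fd[OF zO]]]
            has_derivative_mult[OF has_derivative_add[OF \<kappa>d[OF zO] has_derivative_mult[OF Bd c3]] has_derivative_mult[OF nd nd]]]]])
          (auto simp: fun_eq_iff b_def F_def K_def algebra_simps)
      from dir_deriv_within[OF D(1) z this, of "(0, axis i 1)"]
      have "dir_deriv D (P (0, axis i 1)) (0, axis i 1) z = 2 * (
          ((- (\<sigma> z * (b1 * \<sigma>' (0, axis i 1)) + \<sigma>' (0, axis i 1) * b)) * F + (1 - \<sigma> z * b) * (K * snd z $ i)) * (if i = a then 1 else 0)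
          + ((\<kappa>' z (0, axis i 1) + (b * (3 * F\<^sup>2 * (K * snd z $ i)) + b1 * \<sigma>' (0, axis i 1) * F ^ 3)) * (snd z $ i * snd z $ a)
            + (K + b * F ^ 3) * (snd z $ i * (if i = a then 1 else 0) + snd z $ a)))"
        using dir_deriv_cong[of D "P (0, axis i 1)" "Qi i", OF Pi z]
        by (simp add: axis_component[of i])
      moreover have "\<sigma>' (0, axis i 1) = 2 * F * snd z $ i * (K * S + F)"
        by (simp add: \<sigma>'_def algebra_simps power2_eq_square)
      ultimately show ?thesis
        by (auto simp: c_def algebra_simps power2_eq_square power3_eq_cube power4_eq_xxxx)
    qed
    have \<kappa>lin: "(\<Sum>i\<in>UNIV. snd z $ i * \<kappa>' z (0, axis i 1)) = \<kappa>' z (0, snd z)"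
    proof -
      have "linear (\<kappa>' z)" using \<kappa>d[OF zO] has_derivative_linear by blast
      moreover have "linear (\<lambda>v :: real^'n. (0 :: real, v))" by (auto intro: linearI)
      ultimately have "linear (\<lambda>v. \<kappa>' z (0, v))"
        using linear_compose[of "\<lambda>v. (0, v)" "\<kappa>' z"] by (simp add: o_def)
      from linear_axis_sum[OF this] show ?thesis .
    qed
    have L: "(\<Sum>\<mu>\<in>Basis. dir_deriv D (P \<mu>) \<mu> z) = 2 * snd z $ a * (- ft' z (1, 0) + c + \<kappa>' z (0, snd z)
        + (2 * b1 * F ^ 4 * (K * S + F) + 3 * b * F\<^sup>2 * K) * S + real CARD('n) * (K + b * F ^ 3))"
    proof -
      have "(\<Sum>\<mu>\<in>Basis. dir_deriv D (P \<mu>) \<mu> z) = - 2 * (ft' z (1, 0) * snd z $ a)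
        + 2 * (c * snd z $ a + snd z $ a * (\<Sum>i\<in>UNIV. snd z $ i * \<kappa>' z (0, axis i 1))
        + snd z $ a * (2 * b1 * F ^ 4 * (K * S + F) + 3 * b * F\<^sup>2 * K) * (\<Sum>i\<in>UNIV. snd z $ i * snd z $ i)
        + real CARD('n) * ((K + b * F ^ 3) * snd z $ a))"
        unfolding sum_Basis_spacetime Dt Di by (simp add: sum.distrib sum_distrib_left[symmetric])
      then show ?thesis unfolding \<kappa>lin by (simp add: S_def inner_vec_def algebra_simps)
    qed
    have R: "deriv (\<lambda>s. wave_map_lagrangian (rot_metric B) (U z + s *\<^sub>R axis a 1) (\<lambda>\<nu>. dir_deriv D U \<nu> z)) 0
      = 2 * snd z $ a * (F * (- b - \<sigma> z * b1) * (F\<^sup>2 * real CARD('n) + 2 * F * K * S + K\<^sup>2 * S\<^sup>2)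
         + F ^ 3 * b1 * S * (F + K * S)\<^sup>2 + b * F * (F + K * S)\<^sup>2)"
    proof (rule DERIV_imp_deriv)
      define dm where "dm v = 2 * U z $ a * ((- b - \<sigma> z * b1) * (v \<bullet> v) + b1 * (U z \<bullet> v)\<^sup>2) + 2 * b * (U z \<bullet> v) * v $ a" for v
      have dm: "((\<lambda>s. metric_inner (rot_metric B (U z + s *\<^sub>R axis a 1)) v v) has_real_derivative dm v) (at 0)" for v
        using deriv_metric_inner_point[OF B1, of "U z" a v] by (simp add: UU dm_def b_def b1_def)
      have "((\<lambda>s. wave_map_lagrangian (rot_metric B) (U z + s *\<^sub>R axis a 1) (\<lambda>\<nu>. dir_deriv D U \<nu> z)) has_real_derivative
        - dm (DU z (1, 0)) + (\<Sum>i\<in>UNIV. dm (DU z (0, axis i 1)))) (at 0)"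
        unfolding wave_map_lagrangian_eq dU[OF z] by (intro DERIV_add DERIV_minus DERIV_sum dm)
      moreover have "dm (DU z (1, 0)) = 0"
        by (simp add: dm_def DU_def \<sigma>z U_def F_def S_def algebra_simps power2_eq_square)
      moreover have "(\<Sum>i\<in>UNIV. dm (DU z (0, axis i 1))) = 2 * snd z $ a * (F * (- b - \<sigma> z * b1) * (F\<^sup>2 * real CARD('n) + 2 * F * K * S + K\<^sup>2 * S\<^sup>2)
         + F ^ 3 * b1 * S * (F + K * S)\<^sup>2 + b * F * (F + K * S)\<^sup>2)"
      proof -
        have 1: "DU z (0, axis i 1) \<bullet> DU z (0, axis i 1) = F\<^sup>2 + (2 * F * K + K\<^sup>2 * S) * (snd z $ i * snd z $ i)" for i
          by (simp add: DU_def F_def K_def S_def inner_simps inner_axis_axis algebra_simps power2_eq_square)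
        have 2: "U z \<bullet> DU z (0, axis i 1) = F * (F + K * S) * snd z $ i" for i
          by (simp add: DU_def U_def F_def K_def S_def inner_simps algebra_simps)
        have 3: "DU z (0, axis i 1) $ a = (if i = a then F else 0) + K * snd z $ i * snd z $ a" for i
          by (auto simp: DU_def F_def K_def axis_component)
        have "dm (DU z (0, axis i 1)) = 2 * F * snd z $ a * (- b - \<sigma> z * b1) * F\<^sup>2
          + (2 * F * snd z $ a * ((- b - \<sigma> z * b1) * (2 * F * K + K\<^sup>2 * S) + b1 * F\<^sup>2 * (F + K * S)\<^sup>2)
             + 2 * b * F * (F + K * S) * K * snd z $ a) * (snd z $ i * snd z $ i)
          + (if i = a then 2 * b * F * (F + K * S) * F * snd z $ a else 0)" for i
          unfolding dm_def 1 2 3 by (auto simp: U_def F_def[symmetric] algebra_simps power2_eq_square)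
        then have "(\<Sum>i\<in>UNIV. dm (DU z (0, axis i 1))) = real CARD('n) * (2 * F * snd z $ a * (- b - \<sigma> z * b1) * F\<^sup>2)
          + (2 * F * snd z $ a * ((- b - \<sigma> z * b1) * (2 * F * K + K\<^sup>2 * S) + b1 * F\<^sup>2 * (F + K * S)\<^sup>2)
             + 2 * b * F * (F + K * S) * K * snd z $ a) * (\<Sum>i\<in>UNIV. snd z $ i * snd z $ i)
          + 2 * b * F * (F + K * S) * F * snd z $ a"
          by (simp add: sum.distrib sum_distrib_left[symmetric])
        also have "(\<Sum>i\<in>UNIV. snd z $ i * snd z $ i) = S" by (simp add: S_def inner_vec_def)
        finally show ?thesis by (simp add: algebra_simps power2_eq_square power3_eq_cube)
      qed
      ultimately show "((\<lambda>s. wave_map_lagrangian (rot_metric B) (U z + s *\<^sub>R axis a 1) (\<lambda>\<nu>. dir_deriv D U \<nu> z)) has_real_derivative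
        2 * snd z $ a * (F * (- b - \<sigma> z * b1) * (F\<^sup>2 * real CARD('n) + 2 * F * K * S + K\<^sup>2 * S\<^sup>2)
         + F ^ 3 * b1 * S * (F + K * S)\<^sup>2 + b * F * (F + K * S)\<^sup>2)) (at 0)"
        by simp
    qed
    have pde': "ft' z (1, 0) = (real CARD('n) + 2) * K + \<kappa>' z (0, snd z)
      + (real CARD('n) - 1) * F ^ 3 * (2 * b + F\<^sup>2 * S * b1)"
      using pde[OF z] by (simp add: F_def S_def K_def b_def b1_def \<sigma>_def)
    have "(\<Sum>\<mu>\<in>Basis. dir_deriv D (P \<mu>) \<mu> z)
        = deriv (\<lambda>s. wave_map_lagrangian (rot_metric B) (U z + s *\<^sub>R axis a 1) (\<lambda>\<nu>. dir_deriv D U \<nu> z)) 0"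
      unfolding L R c_def pde' \<sigma>z
      by (simp add: algebra_simps power2_eq_square power3_eq_cube power4_eq_xxxx)
    then show "(\<Sum>\<mu>\<in>Basis. dir_deriv D (\<lambda>q. let DU = (\<lambda>\<nu>. dir_deriv D U \<nu> q) in
        deriv (\<lambda>s. wave_map_lagrangian (rot_metric B) (U q) (DU(\<mu> := DU \<mu> + s *\<^sub>R axis a 1))) 0) \<mu> z)
        = deriv (\<lambda>s. wave_map_lagrangian (rot_metric B) (U z + s *\<^sub>R axis a 1) (\<lambda>\<nu>. dir_deriv D U \<nu> z)) 0"
      unfolding P_def[abs_def] .
  qed
  ultimately show ?thesis by (simp add: wave_map_def U_def[abs_def])
qed

section \<open>The target metric\<close>

context
  fixes m :: real
  assumes m: "m \<ge> 7"
begin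

text \<open>Here \<open>m\<close> is the dimension minus one. Prescribing the self-similar solution
  \<open>\<rho> / sqrt (5/4 - \<rho>\<^sup>2)\<close> in the corotational equation determines \<open>(g u)\<^sup>2 = u\<^sup>2 * quad (u\<^sup>2)\<close>. In the light cone
  \<open>\<rho> \<le> 1\<close> this concerns \<open>u\<^sup>2 \<le> 4\<close>; the bounds \<open>41/10\<close> and \<open>83/20\<close> leave room for a neighbourhood of the cone and for a cutoff.
  Since \<open>5/4 > 1\<close>, the solution is smooth across the cone.\<close>

definition "alpha = (2 * m + 1) / (4 * m)"
definition "beta = 1 / (4 * m)"
definition "quad s = 1 + alpha * s - beta * s\<^sup>2"
definition "quad_deriv s = alpha - 2 * beta * s"

lemma beta_pos: "beta > 0" and beta_le: "beta \<le> 1 / 28" and alpha_bounds: "1 / 2 < alpha" "alpha \<le> 15 / 28"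
  using m by (auto simp: alpha_def beta_def field_simps)

lemma quad_pos: "quad s > 0" if "-1/2 < s" "s < 83/20"
proof -
  have "beta * s\<^sup>2 \<le> 1 / 28 * s\<^sup>2" using beta_le by (intro mult_right_mono) auto
  moreover have "s\<^sup>2 \<le> (83/20)\<^sup>2" using that by (intro abs_le_square_iff[THEN iffD1]) auto
  ultimately have 1: "beta * s\<^sup>2 \<le> 1 / 28 * (83/20)\<^sup>2" by simp
  show ?thesis
  proof (cases "s \<ge> 0")
    case True
    then have "alpha * s \<ge> 0" using alpha_bounds by simp
    then show ?thesis using 1 by (simp add: quad_def power2_eq_square)
  next
    case False
    have "s\<^sup>2 \<le> (1/2)\<^sup>2" using that False by (intro abs_le_square_iff[THEN iffD1]) auto
    then have "beta * s\<^sup>2 \<le> 1 / 28 * (1/2)\<^sup>2" using beta_le beta_pos by (intro mult_mono) auto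
    moreover have "alpha * s \<ge> 15/28 * s" using False alpha_bounds by (intro mult_right_mono_neg) auto
    ultimately show ?thesis using that by (simp add: quad_def power2_eq_square)
  qed
qed

lemma quad_deriv_pos: "quad_deriv s > 0" if "s < 83/20"
proof -
  have "beta * s < beta * (83/20)" using that beta_pos by (intro mult_strict_left_mono) auto
  then have "quad_deriv s > alpha - 83/10 * beta" by (simp add: quad_deriv_def)
  moreover have "alpha - 83/10 * beta \<ge> 0" using m by (simp add: alpha_def beta_def field_simps)
  ultimately show ?thesis by simp
qed

text \<open>This is \<open>g'' > 0\<close> for \<open>g u = u * sqrt (quad (u\<^sup>2))\<close>, up to positive factors. Here the dimension
  matters: for \<open>m = 6\<close> the expression is negative at \<open>s = 4\<close>, the boundary of the light cone. After the shift
  \<open>m = k + 7\<close> all coefficients of the powers of \<open>k\<close> are positive in the given range of \<open>s\<close>.\<close>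

lemma convexity_polynomial:
  assumes "0 \<le> s" "s < 83/20"
  shows "3 * quad s * quad_deriv s - 4 * beta * s * quad s - s * (quad_deriv s)\<^sup>2 > 0"
proof -
  define p where "p = 12 * m * (2 * m + 1) + (8 * m\<^sup>2 - 32 * m + 2) * s - 9 * (2 * m + 1) * s\<^sup>2 + 6 * s ^ 3"
  have "3 * quad s * quad_deriv s - 4 * beta * s * quad s - s * (quad_deriv s)\<^sup>2 = p / (16 * m\<^sup>2)"
    unfolding quad_def quad_deriv_def alpha_def beta_def p_def using m
    by (simp add: field_simps power2_eq_square power3_eq_cube)
  moreover have "p > 0"
  proof -
    define k where "k = m - 7"
    have k: "k \<ge> 0" "m = k + 7" using m by (auto simp: k_def)
    have e: "p = (24 + 8 * s) * k\<^sup>2 + (348 + 80 * s - 18 * s\<^sup>2) * k + (1260 + 170 * s - 135 * s\<^sup>2 + 6 * s ^ 3)"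
      by (simp add: p_def k(2) algebra_simps power2_eq_square power3_eq_cube)
    have s2: "s\<^sup>2 \<le> (83/20)\<^sup>2" using assms by (intro power_mono) auto
    then have "348 + 80 * s - 18 * s\<^sup>2 \<ge> 0" using assms(1) by (simp add: power2_eq_square)
    moreover have "1260 + 170 * s - 135 * s\<^sup>2 + 6 * s ^ 3 > 0"
    proof -
      have "(83/20 - s) * (135 * (83/20 + s) - 170 - 6 * (s\<^sup>2 + 83/20 * s + (83/20)\<^sup>2)) \<ge> 0"
      proof (rule mult_nonneg_nonneg)
        have "s * s \<le> 83/20 * s" using assms by (intro mult_right_mono) auto
        then show "0 \<le> 135 * (83/20 + s) - 170 - 6 * (s\<^sup>2 + 83/20 * s + (83/20)\<^sup>2)"
          using assms by (simp add: power2_eq_square)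
      qed (use assms in auto)
      moreover have "1260 + 170 * s - 135 * s\<^sup>2 + 6 * s ^ 3
        = (83/20 - s) * (135 * (83/20 + s) - 170 - 6 * (s\<^sup>2 + 83/20 * s + (83/20)\<^sup>2))
          + (1260 + 170 * (83/20) - 135 * (83/20)\<^sup>2 + 6 * (83/20) ^ 3)"
        by algebra
      moreover have "1260 + 170 * (83/20) - 135 * (83/20)\<^sup>2 + 6 * (83/20) ^ 3 > (0 :: real)"
        by (simp add: power2_eq_square power3_eq_cube)
      ultimately show ?thesis by linarith
    qed
    moreover have "(24 + 8 * s) * k\<^sup>2 \<ge> 0" using assms(1) by simp
    ultimately show ?thesis
      unfolding e using mult_nonneg_nonneg[of "348 + 80 * s - 18 * s\<^sup>2" k] k(1) by linarith
  qed
  ultimately show ?thesis using m by simp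
qed

text \<open>The logarithmic derivative of the derivative of \<open>sqrt (quad s)\<close>. For \<open>g u = u * p (u\<^sup>2)\<close> one has
  \<open>g'' u = 2 * u * (3 * p' s + 2 * s * p'' s)\<close> at \<open>s = u\<^sup>2\<close>. With \<open>p' > 0\<close>, convexity of \<open>g\<close> is thus a lower bound \<open>- 3 / (2 * s)\<close>
  for the logarithmic derivative of \<open>p'\<close>. This bound survives multiplication with a cutoff
  function, so \<open>p\<close> is obtained from the cut off slope by two integrations.\<close>

definition "quad_slope s = (- 2 * beta) / quad_deriv s - quad_deriv s / (2 * quad s)"

definition "slope_cutoff s = step (41/10) (165/40) s * (1 - step (-1/4) (-1/8) s)"

definition "slope s = (if -1/2 < s \<and> s < 83/20 then slope_cutoff s * quad_slope s else 0)"

lemma smooth_slope: "smooth_on UNIV slope"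
proof (rule smooth_on_local)
  fix s :: real
  have slope_cutoff: "smooth_on S slope_cutoff" if "open S" for S
    unfolding slope_cutoff_def by (intro smooth_on_mult smooth_on_diff smooth_on_const smooth_on_subset[OF open_UNIV that _ smooth_step] that) auto
  consider "s \<in> {-1/2<..<83/20}" | "s \<in> {..<-1/4} \<union> {165/40<..}" by fastforce
  then show "\<exists>V. open V \<and> s \<in> V \<and> smooth_on V slope"
  proof cases
    case 1
    have P: "smooth_on {-1/2<..<83/20} quad" "smooth_on {-1/2<..<83/20} quad_deriv"
      unfolding quad_def quad_deriv_def by (auto intro!: smooth_on_add smooth_on_diff smooth_on_mult smooth_on_power)
    have nz: "quad s \<noteq> 0" "quad_deriv s \<noteq> 0" if "s \<in> {-1/2<..<83/20}" for s
      using quad_pos[of s] quad_deriv_pos[of s] that by auto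
    note o = open_greaterThanLessThan[of "-1/2" "83/20 :: real"]
    have "smooth_on {-1/2<..<83/20} (\<lambda>s. - 2 * beta / quad_deriv s)"
      by (rule smooth_on_divide[OF o smooth_on_const[OF o] P(2) nz(2)])
    moreover have "smooth_on {-1/2<..<83/20} (\<lambda>s. quad_deriv s / (2 * quad s))"
      by (rule smooth_on_divide[OF o P(2) smooth_on_mult[OF o smooth_on_const[OF o] P(1)]])
        (use nz(1) in auto)
    ultimately have "smooth_on {-1/2<..<83/20} (\<lambda>s. slope_cutoff s * quad_slope s)"
      unfolding quad_slope_def by (intro smooth_on_mult slope_cutoff smooth_on_diff) auto
    then have "smooth_on {-1/2<..<83/20} slope"
      by (rule smooth_on_eqI) (simp add: slope_def)
    with 1 o show ?thesis by (intro exI[of _ "{-1/2<..<83/20}"] conjI)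
  next
    case 2
    have "smooth_on ({..<-1/4} \<union> {165/40<..}) slope"
      by (rule smooth_on_eqI[of _ "\<lambda>s. 0"]) (auto simp: slope_def slope_cutoff_def step_eq_0 step_eq_1 intro!: smooth_on_const open_Un)
    moreover have "open ({..<-1/4} \<union> {165/40<..} :: real set)" by (intro open_Un) auto
    ultimately show ?thesis using 2 by (intro exI[of _ "{..<-1/4} \<union> {165/40<..}"] conjI)
  qed
qed simp

lemma slope_bound: "3 + 2 * s * slope s > 0" if "s \<ge> 0"
proof (cases "s < 83/20")
  case True
  have pos: "quad s > 0" "quad_deriv s > 0" using quad_pos[of s] quad_deriv_pos[of s] that True by auto
  have "3 + 2 * s * quad_slope s = (3 * quad s * quad_deriv s - 4 * beta * s * quad s - s * (quad_deriv s)\<^sup>2) / (quad s * quad_deriv s)"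
    using pos by (simp add: quad_slope_def field_simps power2_eq_square)
  then have 1: "3 + 2 * s * quad_slope s > 0"
    using convexity_polynomial[OF that True] pos by simp
  have c: "0 \<le> slope_cutoff s" "slope_cutoff s \<le> 1"
    using step_bounds[of "41/10" "165/40" s] step_bounds[of "-1/4" "-1/8" s]
    by (auto simp: slope_cutoff_def intro!: mult_nonneg_nonneg mult_le_one)
  have "slope_cutoff s * (3 + 2 * s * quad_slope s) + (1 - slope_cutoff s) * 3 > 0"
  proof (cases "slope_cutoff s = 0")
    case False
    then have "slope_cutoff s * (3 + 2 * s * quad_slope s) > 0" using c 1 by (intro mult_pos_pos) auto
    then show ?thesis using c by simp
  qed simp
  moreover have "3 + 2 * s * slope s = slope_cutoff s * (3 + 2 * s * quad_slope s) + (1 - slope_cutoff s) * 3"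
    using True that by (simp add: slope_def algebra_simps)
  ultimately show ?thesis by simp
qed (simp add: slope_def)

definition "p_deriv s = exp (ln (alpha / 2) + prim slope s)"
definition "p_fun s = 1 + prim p_deriv s"

lemma smooth_p_deriv: "smooth_on UNIV p_deriv" and smooth_p_fun: "smooth_on UNIV p_fun"
proof -
  show j: "smooth_on UNIV p_deriv"
    unfolding p_deriv_def by (intro smooth_on_exp smooth_on_add smooth_on_const smooth_prim smooth_slope) auto
  show "smooth_on UNIV p_fun"
    unfolding p_fun_def by (intro smooth_on_add smooth_on_const smooth_prim j) auto
qed

lemma p_deriv_derivative: "(p_deriv has_real_derivative p_deriv s * slope s) (at s)"
  unfolding p_deriv_def
  by (auto intro!: derivative_eq_intros prim_has_derivative smooth_on_imp_continuous_on smooth_slope)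

lemma p_fun_derivative: "(p_fun has_real_derivative p_deriv s) (at s)"
  unfolding p_fun_def
  by (auto intro!: derivative_eq_intros prim_has_derivative smooth_on_imp_continuous_on smooth_p_deriv)

lemma p_deriv_pos: "p_deriv s > 0" by (simp add: p_deriv_def)

lemma quad_derivative: "(quad has_real_derivative quad_deriv s) (at s)"
  unfolding quad_def quad_deriv_def by (auto intro!: derivative_eq_intros)

lemma quad_deriv_derivative: "(quad_deriv has_real_derivative - 2 * beta) (at s)"
  unfolding quad_deriv_def by (auto intro!: derivative_eq_intros)

lemma p_fun_eq_sqrt: "p_fun s = sqrt (quad s)" if "-1/8 < s" "s < 41/10"
proof -
  have in0: "0 \<in> {-1/8<..<41/10::real}" by simp
  have range: "quad s > 0" "quad_deriv s > 0" if "s \<in> {-1/8<..<41/10}" for s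
    using quad_pos[of s] quad_deriv_pos[of s] that by auto
  have j: "p_deriv s = quad_deriv s / (2 * sqrt (quad s))" if s: "s \<in> {-1/8<..<41/10}" for s
  proof -
    define d where "d s = ln (alpha / 2) + prim slope s - (ln (quad_deriv s) - ln 2 - ln (quad s) / 2)" for s
    have "(d has_real_derivative 0) (at s)" if s: "s \<in> {-1/8<..<41/10}" for s
    proof -
      have slope: "slope s = quad_slope s" using s by (simp add: slope_def slope_cutoff_def step_eq_1 step_eq_0)
      have "(d has_real_derivative slope s - ((- 2 * beta) / quad_deriv s - quad_deriv s / quad s / 2)) (at s)"
        unfolding d_def using range[OF s]
        by (auto intro!: derivative_eq_intros prim_has_derivative smooth_on_imp_continuous_on smooth_slope
          quad_derivative quad_deriv_derivative)
      then show ?thesis by (simp add: slope quad_slope_def mult.commute)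
    qed
    then have "d s = d 0" using s in0 by (intro DERIV_isconst3[of "-1/8" "41/10" s 0 d]) auto
    also have "d 0 = 0" using alpha_bounds by (simp add: d_def quad_def quad_deriv_def ln_div)
    finally have "ln (alpha / 2) + prim slope s = ln (quad_deriv s) - ln 2 - ln (quad s) / 2" by (simp add: d_def)
    also have "\<dots> = ln (quad_deriv s / (2 * sqrt (quad s)))"
      using range[OF s] by (simp add: ln_div ln_mult ln_sqrt)
    finally show ?thesis using range[OF s] by (simp add: p_deriv_def)
  qed
  define d where "d s = p_fun s - sqrt (quad s)" for s
  have "(d has_real_derivative 0) (at s)" if s: "s \<in> {-1/8<..<41/10}" for s
  proof -
    have "(d has_real_derivative p_deriv s - quad_deriv s / (2 * sqrt (quad s))) (at s)"
      unfolding d_def using range[OF s]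
      by (auto intro!: derivative_eq_intros p_fun_derivative quad_derivative simp: field_simps)
    then show ?thesis by (simp add: j[OF s])
  qed
  then have "d s = d 0" using that in0 by (intro DERIV_isconst3[of "-1/8" "41/10" s 0 d]) auto
  also have "d 0 = 0" by (simp add: d_def p_fun_def quad_def)
  finally show ?thesis by (simp add: d_def)
qed

text \<open>Near \<open>s = 0\<close> the quotient \<open>(1 - p\<^sup>2) / s\<close> is replaced by the polynomial that it equals there.\<close>

definition "target_B s = (if s < 41/10 then - alpha + beta * s else (1 - (p_fun s)\<^sup>2) / s)"

lemma target_B_eq: "1 - s * target_B s = (p_fun s)\<^sup>2" if "-1/8 < s"
proof (cases "s < 41/10")
  case True
  then have "(p_fun s)\<^sup>2 = quad s" using p_fun_eq_sqrt[OF that True] quad_pos[of s] that by simp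
  then show ?thesis using True by (simp add: target_B_def quad_def algebra_simps power2_eq_square)
qed (simp add: target_B_def)

lemma smooth_target_B: "smooth_on UNIV target_B"
proof (rule smooth_on_local)
  fix s :: real
  consider "s \<in> {..<41/10}" | "s \<in> {0<..}" by fastforce
  then show "\<exists>V. open V \<and> s \<in> V \<and> smooth_on V target_B"
  proof cases
    case 1
    have "smooth_on {..<41/10} target_B"
      by (rule smooth_on_eqI[of _ "\<lambda>s. - alpha + beta * s"])
        (auto simp: target_B_def intro!: smooth_on_diff smooth_on_mult smooth_on_const smooth_on_id)
    with 1 show ?thesis by (intro exI[of _ "{..<41/10}"] conjI) auto
  next
    case 2
    have "smooth_on {0<..} (\<lambda>s. (1 - (p_fun s)\<^sup>2) / s)"
      by (intro smooth_on_divide smooth_on_diff smooth_on_power smooth_on_subset[OF open_UNIV _ _ smooth_p_fun]) auto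
    moreover have "target_B s = (1 - (p_fun s)\<^sup>2) / s" if "s > 0" for s
      using target_B_eq[of s] that by (simp add: field_simps)
    ultimately have "smooth_on {0<..} target_B"
      by (rule smooth_on_eqI) simp
    with 2 show ?thesis by (intro exI[of _ "{0<..}"] conjI) auto
  qed
qed simp

lemma p_fun_ge_1: "p_fun s \<ge> 1" if "s \<ge> 0"
proof -
  have "p_fun 0 \<le> p_fun s"
    by (rule DERIV_nonneg_imp_nondecreasing[OF that])
      (use p_fun_derivative p_deriv_pos less_imp_le in blast)
  then show ?thesis by (simp add: p_fun_def)
qed

end

text \<open>With \<open>A = p\<^sup>2\<close>, the radial curvature is \<open>- 2 * p * p' * (3 + 2 * s * slope s)\<close>, and all terms of the
  tangential one are nonpositive because \<open>p \<ge> 1\<close> and \<open>p' > 0\<close>.\<close>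

theorem target_profile:
  fixes m :: real
  assumes m: "m \<ge> 7"
  obtains B B1 B2 :: "real \<Rightarrow> real" where
    "smooth_on UNIV B" "smooth_on UNIV B1"
    "\<And>s. (B has_real_derivative B1 s) (at s)" "\<And>s. (B1 has_real_derivative B2 s) (at s)"
    "\<And>s. s \<ge> 0 \<Longrightarrow> 1 - s * B s > 0"
    "\<And>s. s \<ge> 0 \<Longrightarrow> curv_tan B B1 s < 0" "\<And>s. s \<ge> 0 \<Longrightarrow> curv_rad B B1 B2 s < 0"
    "\<And>s. s < 41/10 \<Longrightarrow> B s = - ((2 * m + 1) / (4 * m)) + s / (4 * m)"
proof -
  let ?B = "target_B m"
  define B1 where "B1 = dir_deriv UNIV ?B 1"
  define B2 where "B2 = dir_deriv UNIV B1 1"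
  have sB1: "smooth_on UNIV B1" unfolding B1_def by (intro smooth_on_dir_deriv smooth_target_B m)
  have B1: "(?B has_real_derivative B1 s) (at s)" for s
    unfolding B1_def by (rule smooth_on_has_real_derivative) (use smooth_target_B[OF m] in auto)
  have B2: "(B1 has_real_derivative B2 s) (at s)" for s
    unfolding B2_def by (rule smooth_on_has_real_derivative) (use sB1 in auto)
  note pd = p_fun_derivative[OF m] and jd = p_deriv_derivative[OF m]
  have A1: "- ?B s - s * B1 s = 2 * p_fun m s * p_deriv m s" if "-1/8 < s" for s
  proof -
    have "((\<lambda>s. 1 - s * ?B s) has_real_derivative - ?B s - s * B1 s) (at s)"
      by (auto intro!: derivative_eq_intros B1)
    moreover have "((\<lambda>s. (p_fun m s)\<^sup>2) has_real_derivative 2 * p_fun m s * p_deriv m s) (at s)"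
      by (auto intro!: derivative_eq_intros pd)
    then have "((\<lambda>s. 1 - s * ?B s) has_real_derivative 2 * p_fun m s * p_deriv m s) (at s)"
      by (rule has_field_derivative_transform_within_open[of _ _ _ "{-1/8<..}"]) (use that target_B_eq[OF m] in auto)
    ultimately show ?thesis by (rule DERIV_unique)
  qed
  have A2: "- 2 * B1 s - s * B2 s = 2 * (p_deriv m s)\<^sup>2 + 2 * p_fun m s * (p_deriv m s * slope m s)" if "-1/8 < s" for s
  proof -
    have "((\<lambda>s. - ?B s - s * B1 s) has_real_derivative - 2 * B1 s - s * B2 s) (at s)"
      by (auto intro!: derivative_eq_intros B1 B2)
    moreover have "((\<lambda>s. 2 * p_fun m s * p_deriv m s) has_real_derivative 2 * (p_deriv m s)\<^sup>2 + 2 * p_fun m s * (p_deriv m s * slope m s)) (at s)"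
      by (auto intro!: derivative_eq_intros pd jd simp: power2_eq_square algebra_simps)
    then have "((\<lambda>s. - ?B s - s * B1 s) has_real_derivative 2 * (p_deriv m s)\<^sup>2 + 2 * p_fun m s * (p_deriv m s * slope m s)) (at s)"
      by (rule has_field_derivative_transform_within_open[of _ _ _ "{-1/8<..}"]) (use that A1 in auto)
    ultimately show ?thesis by (rule DERIV_unique)
  qed
  have A0: "1 - s * ?B s > 0" if "s \<ge> 0" for s
    using target_B_eq[OF m, of s] that p_fun_ge_1[OF m that] by (simp add: zero_less_power)
  have pos: "p_fun m s \<ge> 1" "p_deriv m s > 0" if "s \<ge> 0" for s
    using p_fun_ge_1[OF m that] p_deriv_pos[OF m] by auto
  show ?thesis
  proof (rule that[of ?B B1 B2])
    fix s :: real assume s: "s \<ge> 0"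
    have A: "1 - s * ?B s = (p_fun m s)\<^sup>2" using target_B_eq[OF m] s by simp
    have "?B s \<le> 0"
    proof (cases "s = 0")
      case True
      then show ?thesis using alpha_bounds[OF m] by (simp add: target_B_def[OF m])
    next
      case False
      have "s * ?B s \<le> 0" using A pos[OF s] one_le_power[of "p_fun m s" 2] by linarith
      then show ?thesis using False s by (simp add: mult_le_0_iff)
    qed
    then have "(p_fun m s)\<^sup>2 * ?B s \<le> 0" by (intro mult_nonneg_nonpos) auto
    moreover have "(p_fun m s)\<^sup>2 * (2 * p_fun m s * p_deriv m s) > 0" using pos[OF s] by simp
    moreover have "s * (2 * p_fun m s * p_deriv m s)\<^sup>2 \<ge> 0" using s by simp
    moreover have "curv_tan ?B B1 s = (p_fun m s)\<^sup>2 * ?B s - 2 * ((p_fun m s)\<^sup>2 * (2 * p_fun m s * p_deriv m s)) - s * (2 * p_fun m s * p_deriv m s)\<^sup>2"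
    proof -
      have "-1/8 < s" using s by simp
      then show ?thesis unfolding curv_tan_def A A1[OF \<open>-1/8 < s\<close>] by (simp only: mult.assoc)
    qed
    ultimately show "curv_tan ?B B1 s < 0" by linarith
  next
    fix s :: real assume s: "s \<ge> 0"
    have A: "1 - s * ?B s = (p_fun m s)\<^sup>2" using target_B_eq[OF m] s by simp
    have "2 * p_fun m s * p_deriv m s * (3 + 2 * s * slope m s) > 0"
      using pos[OF s] slope_bound[OF m s] by (intro mult_pos_pos) auto
    moreover have "3 * (2 * p_fun m s * p_deriv m s) + 2 * s * (2 * (p_deriv m s)\<^sup>2 + 2 * p_fun m s * (p_deriv m s * slope m s))
        - s * (2 * p_fun m s * p_deriv m s)\<^sup>2 / (p_fun m s)\<^sup>2 = 2 * p_fun m s * p_deriv m s * (3 + 2 * s * slope m s)"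
      using pos[OF s] by (simp add: power2_eq_square field_simps)
    ultimately show "curv_rad ?B B1 B2 s < 0"
      using A A1[of s] A2[of s] s unfolding curv_rad_def by simp
  next
    show "1 - s * ?B s > 0" if "s \<ge> 0" for s by (rule A0[OF that])
    show "?B s = - ((2 * m + 1) / (4 * m)) + s / (4 * m)" if "s < 41/10" for s
      using that by (simp add: target_B_def[OF m] alpha_def[OF m] beta_def[OF m])
  qed (use smooth_target_B[OF m] sB1 B1 B2 in auto)
qed

section \<open>The radial wave operator\<close>

text \<open>For \<open>f (t, x) = F (t, x \<bullet> x)\<close> on \<open>\<real>\<^sup>1\<^sup>,\<^sup>n\<close>, the expression \<open>radial_op n F\<close> is the wave operator
  of \<open>\<real>\<^sup>1\<^sup>,\<^sup>n\<^sup>+\<^sup>2\<close> applied to \<open>f\<close>; the two additional dimensions come from the factor \<open>x\<close> in the map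
  \<open>f x\<close>.\<close>

definition pd :: "real \<times> real \<Rightarrow> (real \<times> real \<Rightarrow> real) \<Rightarrow> real \<times> real \<Rightarrow> real" where
  "pd v F z = frechet_derivative F (at z) v"

definition radial_op :: "real \<Rightarrow> (real \<times> real \<Rightarrow> real) \<Rightarrow> real \<times> real \<Rightarrow> real" where
  "radial_op n F z = pd (1, 0) (pd (1, 0) F) z - 2 * (n + 2) * pd (0, 1) F z - 4 * snd z * pd (0, 1) (pd (0, 1) F) z"

lemma pd_eqI: "(F has_derivative F') (at z) \<Longrightarrow> pd v F z = F' v"
  unfolding pd_def by (metis frechet_derivative_at)

lemma pd_dir_deriv: "open V \<Longrightarrow> z \<in> V \<Longrightarrow> pd v F z = dir_deriv V F v z"
  unfolding pd_def dir_deriv_def by (metis at_within_open)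

lemma smooth_on_pd: "open V \<Longrightarrow> smooth_on V F \<Longrightarrow> smooth_on V (pd v F)"
  using smooth_on_cong[of V "pd v F" "dir_deriv V F v"] pd_dir_deriv smooth_on_dir_deriv by metis

lemma has_derivative_pd:
  assumes "open V" "smooth_on V F" "z \<in> V"
  shows "(F has_derivative (\<lambda>v. fst v * pd (1, 0) F z + snd v * pd (0, 1) F z)) (at z)"
proof -
  have d: "(F has_derivative (\<lambda>v. pd v F z)) (at z)"
    using smooth_on_has_derivative[OF assms] pd_dir_deriv[OF assms(1,3)] by simp
  then have l: "linear (\<lambda>v. pd v F z)" using has_derivative_linear by blast
  have "pd v F z = fst v * pd (1, 0) F z + snd v * pd (0, 1) F z" for v
  proof -
    have "pd v F z = pd (fst v *\<^sub>R (1, 0) + snd v *\<^sub>R (0, 1)) F z" by simp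
    also have "\<dots> = fst v * pd (1, 0) F z + snd v * pd (0, 1) F z"
      unfolding linear_add[OF l] linear_scale[OF l] by simp
    finally show ?thesis .
  qed
  then have "(\<lambda>v. pd v F z) = (\<lambda>v. fst v * pd (1, 0) F z + snd v * pd (0, 1) F z)" by blast
  with d show ?thesis by (simp only:)
qed

lemma pd_cong:
  assumes "open V" "z \<in> V" "\<And>x. x \<in> V \<Longrightarrow> F x = G x"
  shows "pd v F z = pd v G z"
proof -
  have "dir_deriv V F v z = dir_deriv V G v z" by (rule dir_deriv_cong[OF assms(3,2)])
  then show ?thesis by (simp only: pd_dir_deriv[OF assms(1,2)])
qed

lemma radial_op_cong:
  assumes "open V" "z \<in> V" "\<And>x. x \<in> V \<Longrightarrow> F x = G x"
  shows "radial_op n F z = radial_op n G z"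
proof -
  have 1: "pd v F x = pd v G x" if "x \<in> V" for v x by (rule pd_cong[OF assms(1) that assms(3)])
  have "pd u (pd v F) z = pd u (pd v G) z" for u v by (rule pd_cong[OF assms(1,2) 1])
  then show ?thesis unfolding radial_op_def by (simp only: 1[OF assms(2)])
qed

lemma pd_add:
  assumes "open V" "smooth_on V F" "smooth_on V G" "z \<in> V"
  shows "pd v (\<lambda>z. F z + G z) z = pd v F z + pd v G z"
  unfolding pd_eqI[OF has_derivative_add[OF has_derivative_pd[OF assms(1,2,4)] has_derivative_pd[OF assms(1,3,4)]]]
  using pd_eqI[OF has_derivative_pd[OF assms(1,2,4)], of v] pd_eqI[OF has_derivative_pd[OF assms(1,3,4)], of v]
  by linarith

lemma radial_op_add:
  assumes "open V" "smooth_on V F" "smooth_on V G" "z \<in> V"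
  shows "radial_op n (\<lambda>z. F z + G z) z = radial_op n F z + radial_op n G z"
proof -
  have "pd u (pd v (\<lambda>z. F z + G z)) z = pd u (pd v F) z + pd u (pd v G) z" for u v
  proof -
    have "pd u (pd v (\<lambda>z. F z + G z)) z = pd u (\<lambda>z. pd v F z + pd v G z) z"
      by (rule pd_cong[OF assms(1,4)]) (rule pd_add[OF assms(1-3)])
    also have "\<dots> = pd u (pd v F) z + pd u (pd v G) z"
      by (rule pd_add) (use assms smooth_on_pd in auto)
    finally show ?thesis .
  qed
  then show ?thesis unfolding radial_op_def using pd_add[OF assms] by (simp add: algebra_simps)
qed

lemma radial_op_eqI:
  assumes "open V" "z \<in> V"
    and "\<And>p. p \<in> V \<Longrightarrow> (F has_derivative (\<lambda>v. fst v * Ft p + snd v * Fs p)) (at p)"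
    and "(Ft has_derivative D1) (at z)" "(Fs has_derivative D2) (at z)"
  shows "radial_op n F z = D1 (1, 0) - 2 * (n + 2) * Fs z - 4 * snd z * D2 (0, 1)"
proof -
  have "pd (1, 0) F p = Ft p" "pd (0, 1) F p = Fs p" if "p \<in> V" for p
    using pd_eqI[OF assms(3)[OF that]] by auto
  then have "pd (1, 0) (pd (1, 0) F) z = D1 (1, 0)" "pd (0, 1) (pd (0, 1) F) z = D2 (0, 1)" "pd (0, 1) F z = Fs z"
    using pd_cong[OF assms(1,2), of "pd (1, 0) F" Ft] pd_cong[OF assms(1,2), of "pd (0, 1) F" Fs]
      pd_eqI[OF assms(4)] pd_eqI[OF assms(5)] assms(2) by auto
  then show ?thesis by (simp add: radial_op_def)
qed

section \<open>The self-similar solution\<close>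

text \<open>The blowup time is \<open>1\<close>; in terms of \<open>u = norm x * selfsim (t, norm x ^ 2)\<close> this is the profile
  \<open>\<rho> / sqrt (5/4 - \<rho>\<^sup>2)\<close> with \<open>\<rho> = norm x / (1 - t)\<close>.\<close>

definition ss_denom :: "real \<times> real \<Rightarrow> real" where
  "ss_denom z = 5/4 * (1 - fst z)\<^sup>2 - snd z"

definition selfsim :: "real \<times> real \<Rightarrow> real" where
  "selfsim z = ss_denom z powr (-1/2)"

lemma ss_denom_has_derivative:
  "(ss_denom has_derivative (\<lambda>v. - 5/2 * (1 - fst z) * fst v - snd v)) (at z)"
  unfolding ss_denom_def
  by (auto intro!: derivative_eq_intros simp: fun_eq_iff power2_eq_square field_simps)

lemma open_ss_denom: "open {z. ss_denom z > 0}"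
  unfolding ss_denom_def by (intro open_Collect_less continuous_intros)

lemma smooth_ss_denom: "open S \<Longrightarrow> smooth_on S ss_denom"
  unfolding ss_denom_def
  by (intro smooth_on_diff smooth_on_mult smooth_on_const smooth_on_power smooth_on_fst smooth_on_snd smooth_on_id)

lemma smooth_selfsim: "open S \<Longrightarrow> (\<And>z. z \<in> S \<Longrightarrow> ss_denom z > 0) \<Longrightarrow> smooth_on S selfsim"
  unfolding selfsim_def by (intro smooth_on_powr smooth_ss_denom) auto

lemma ss_powr_has_derivative:
  assumes "ss_denom z > 0"
  shows "((\<lambda>z. ss_denom z powr a) has_derivative
    (\<lambda>v. a * ss_denom z powr (a - 1) * (- 5/2 * (1 - fst z) * fst v - snd v))) (at z)"
proof -
  have "((\<lambda>x. x powr a) has_derivative (*) (a * ss_denom z powr (a - 1))) (at (ss_denom z))"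
    using has_real_derivative_powr[OF assms, of a] by (simp add: has_field_derivative_def)
  from has_derivative_compose[OF ss_denom_has_derivative this] show ?thesis by simp
qed

lemma radial_op_selfsim:
  assumes "ss_denom z > 0"
  shows "radial_op n selfsim z = ss_denom z powr (-5/2) * ((1/2 - n) * ss_denom z + 3/4 * snd z)"
proof -
  define E where "E = ss_denom z"
  have pw: "E powr (-3/2) = E powr (-5/2) * E"
    using powr_add[of E "-5/2" 1] assms by (simp add: E_def powr_one)
  have "radial_op n selfsim z = (5/4 * (1 - fst z) * (-3/2 * E powr (-5/2) * (- 5/2 * (1 - fst z))) - 5/4 * E powr (-3/2))
     - 2 * (n + 2) * (1/2 * E powr (-3/2)) - 4 * snd z * (1/2 * (-3/2 * E powr (-5/2) * (- 1)))"
  proof (subst radial_op_eqI[of "{z. ss_denom z > 0}" z selfsim "\<lambda>z. 5/4 * (1 - fst z) * ss_denom z powr (-3/2)"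
        "\<lambda>z. 1/2 * ss_denom z powr (-3/2)"
        "\<lambda>v. 5/4 * (1 - fst z) * (-3/2 * E powr (-5/2) * (- 5/2 * (1 - fst z) * fst v - snd v)) - 5/4 * fst v * E powr (-3/2)"
        "\<lambda>v. 1/2 * (-3/2 * E powr (-5/2) * (- 5/2 * (1 - fst z) * fst v - snd v))"])
    show "(selfsim has_derivative (\<lambda>v. fst v * (5/4 * (1 - fst p) * ss_denom p powr (-3/2)) + snd v * (1/2 * ss_denom p powr (-3/2)))) (at p)"
      if "p \<in> {z. ss_denom z > 0}" for p
      unfolding selfsim_def[abs_def]
      by (rule has_derivative_eq_rhs[OF ss_powr_has_derivative]) (use that in \<open>auto simp: fun_eq_iff field_simps\<close>)
    have d: "((\<lambda>z. ss_denom z powr (-3/2)) has_derivative (\<lambda>v. -3/2 * E powr (-5/2) * (- 5/2 * (1 - fst z) * fst v - snd v))) (at z)"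
      using ss_powr_has_derivative[OF assms, of "-3/2"] by (simp add: E_def)
    have "((\<lambda>z. 5/4 * (1 - fst z)) has_derivative (\<lambda>v. - 5/4 * fst v)) (at z)"
      by (auto intro!: derivative_eq_intros)
    from has_derivative_mult[OF this d]
    show "((\<lambda>z. 5/4 * (1 - fst z) * ss_denom z powr (-3/2)) has_derivative
      (\<lambda>v. 5/4 * (1 - fst z) * (-3/2 * E powr (-5/2) * (- 5/2 * (1 - fst z) * fst v - snd v)) - 5/4 * fst v * E powr (-3/2))) (at z)"
      by (simp add: E_def)
    show "((\<lambda>z. 1/2 * ss_denom z powr (-3/2)) has_derivative (\<lambda>v. 1/2 * (-3/2 * E powr (-5/2) * (- 5/2 * (1 - fst z) * fst v - snd v)))) (at z)"
      by (rule has_derivative_mult_right[OF d])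
  qed (use assms open_ss_denom in \<open>auto simp: E_def\<close>)
  also have "\<dots> = E powr (-5/2) * (75/16 * (1 - fst z)\<^sup>2 - 5/4 * E - (n + 2) * E - 3 * snd z)"
  proof -
    define P where "P = E powr (-5/2)"
    show ?thesis unfolding pw P_def[symmetric] by (simp add: field_simps power2_eq_square)
  qed
  also have "75/16 * (1 - fst z)\<^sup>2 = 15/4 * (E + snd z)"
    by (simp add: E_def ss_denom_def)
  finally show ?thesis unfolding E_def by (simp add: algebra_simps)
qed

text \<open>Passing from \<open>s\<close> to \<open>r = sqrt s\<close> and dividing by \<open>r ^ K\<close> with \<open>2 * K = n + 1\<close> removes the first
  order terms of the radial wave operator in \<open>n + 2\<close> dimensions: the powers of \<open>s\<close> are chosen such that the coefficients of
  \<open>\<omega>1 - \<omega>2\<close> cancel. The mixed null derivative is a quarter of the one-dimensional wave operator.\<close>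

lemma radial_op_wave:
  fixes \<omega> \<omega>1 \<omega>2 \<omega>11 \<omega>22 k :: "real \<times> real \<Rightarrow> real"
  assumes d0: "\<And>z. (\<omega> has_derivative (\<lambda>v. fst v * \<omega>1 z + snd v * \<omega>2 z)) (at z)"
    and d1: "\<And>z. (\<omega>1 has_derivative (\<lambda>v. fst v * \<omega>11 z + snd v * k z)) (at z)"
    and d2: "\<And>z. (\<omega>2 has_derivative (\<lambda>v. fst v * k z + snd v * \<omega>22 z)) (at z)"
    and K: "2 * K = n + 1" and s: "snd z > 0"
  shows "radial_op n (\<lambda>z. snd z powr (- K / 2) * \<omega> (fst z + sqrt (snd z) - \<xi>, fst z - sqrt (snd z) - \<eta>)) z =
    snd z powr (- K / 2) * (4 * k (fst z + sqrt (snd z) - \<xi>, fst z - sqrt (snd z) - \<eta>)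
      + K * (K - 1) / snd z * \<omega> (fst z + sqrt (snd z) - \<xi>, fst z - sqrt (snd z) - \<eta>))"
proof -
  define \<theta> where "\<theta> z = (fst z + sqrt (snd z) - \<xi>, fst z - sqrt (snd z) - \<eta>)" for z :: "real \<times> real"
  have V: "open {z :: real \<times> real. snd z > 0}" by (intro open_Collect_less continuous_intros)
  have sq: "((\<lambda>z. sqrt (snd z)) has_derivative (\<lambda>v. snd v / (2 * sqrt (snd p)))) (at p)" if "snd p > 0" for p :: "real \<times> real"
    using that by (auto intro!: derivative_eq_intros simp: fun_eq_iff divide_simps)
  have \<theta>d: "(\<theta> has_derivative (\<lambda>v. (fst v + snd v / (2 * sqrt (snd p)), fst v - snd v / (2 * sqrt (snd p))))) (at p)"
    if "snd p > 0" for p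
    unfolding \<theta>_def
    by (rule has_derivative_eq_rhs[OF has_derivative_Pair[OF
        has_derivative_diff[OF has_derivative_add[OF has_derivative_fst[OF has_derivative_ident] sq[OF that]] has_derivative_const]
        has_derivative_diff[OF has_derivative_diff[OF has_derivative_fst[OF has_derivative_ident] sq[OF that]] has_derivative_const]]])
      (simp add: fun_eq_iff)
  have c: "((\<lambda>z. f (\<theta> z)) has_derivative
      (\<lambda>v. fst v * (fx (\<theta> p) + fy (\<theta> p)) + snd v * ((fx (\<theta> p) - fy (\<theta> p)) / (2 * sqrt (snd p))))) (at p)"
    if "snd p > 0" "\<And>z. (f has_derivative (\<lambda>v. fst v * fx z + snd v * fy z)) (at z)" for f fx fy :: "real \<times> real \<Rightarrow> real" and p
    by (rule has_derivative_eq_rhs[OF has_derivative_compose[OF \<theta>d[OF that(1)] that(2)]])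
      (simp add: fun_eq_iff algebra_simps diff_divide_distrib add_divide_distrib)
  have pw: "((\<lambda>z :: real \<times> real. snd z powr a) has_derivative (\<lambda>v. snd v * (a * snd p powr (a - 1)))) (at p)" if "snd p > 0" for a p
  proof -
    have "((\<lambda>x. x powr a) has_derivative (*) (a * snd p powr (a - 1))) (at (snd p))"
      using has_real_derivative_powr[OF that, of a] by (simp add: has_field_derivative_def)
    from has_derivative_compose[OF has_derivative_snd[OF has_derivative_ident] this]
    show ?thesis by (simp add: mult.commute)
  qed
  define a where "a = - K / 2"
  define Ft where "Ft p = snd p powr a * (\<omega>1 (\<theta> p) + \<omega>2 (\<theta> p))" for p
  define Fs where "Fs p = a * (snd p powr (a - 1) * \<omega> (\<theta> p)) + 1/2 * (snd p powr (a - 1/2) * (\<omega>1 (\<theta> p) - \<omega>2 (\<theta> p)))" for p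
  have sh: "s powr b / sqrt s = s powr (b - 1/2)" if "s > 0" for s b :: real
    using that by (simp add: powr_diff powr_half_sqrt)
  have F: "((\<lambda>z. snd z powr a * \<omega> (\<theta> z)) has_derivative (\<lambda>v. fst v * Ft p + snd v * Fs p)) (at p)" if "snd p > 0" for p
  proof -
    have e: "snd p powr a * ((\<omega>1 (\<theta> p) - \<omega>2 (\<theta> p)) / (2 * sqrt (snd p))) = 1/2 * (snd p powr (a - 1/2) * (\<omega>1 (\<theta> p) - \<omega>2 (\<theta> p)))"
      unfolding sh[OF that, symmetric] by simp
    have alg: "P * (t * S + u * Z) + u * (a * R) * W = t * (P * S) + u * (a * (R * W) + Y)"
      if "P * Z = Y" for P Z Y t u S R W :: real
      using that by (auto simp: algebra_simps)
    show ?thesis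
      by (rule has_derivative_eq_rhs[OF has_derivative_mult[OF pw[OF that] c[OF that d0]]])
        (rule ext, unfold Ft_def Fs_def, rule alg[OF e])
  qed
  have s12: "((\<lambda>z. \<omega>1 (\<theta> z) + \<omega>2 (\<theta> z)) has_derivative
      (\<lambda>v. fst v * (\<omega>11 (\<theta> z) + 2 * k (\<theta> z) + \<omega>22 (\<theta> z)) + snd v * ((\<omega>11 (\<theta> z) - \<omega>22 (\<theta> z)) / (2 * sqrt (snd z))))) (at z)"
    by (rule has_derivative_eq_rhs[OF has_derivative_add[OF c[OF s d1] c[OF s d2]]])
      (simp add: fun_eq_iff algebra_simps diff_divide_distrib add_divide_distrib)
  have d12: "((\<lambda>z. \<omega>1 (\<theta> z) - \<omega>2 (\<theta> z)) has_derivative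
      (\<lambda>v. fst v * (\<omega>11 (\<theta> z) - \<omega>22 (\<theta> z)) + snd v * ((\<omega>11 (\<theta> z) - 2 * k (\<theta> z) + \<omega>22 (\<theta> z)) / (2 * sqrt (snd z))))) (at z)"
    by (rule has_derivative_eq_rhs[OF has_derivative_diff[OF c[OF s d1] c[OF s d2]]])
      (simp add: fun_eq_iff algebra_simps diff_divide_distrib add_divide_distrib)
  note Ftd = has_derivative_mult[OF pw[OF s, of a] s12]
  note Fsd = has_derivative_add[OF has_derivative_mult_right[OF has_derivative_mult[OF pw[OF s, of "a - 1"] c[OF s d0]], of a]
      has_derivative_mult_right[OF has_derivative_mult[OF pw[OF s, of "a - 1/2"] d12], of "1/2"]]
  define S where "S = snd z"
  define p where "p = S powr a"
  have S: "S > 0" using s by (simp add: S_def)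
  have e1: "S powr (a - 1) = p / S" using S by (simp add: p_def powr_diff)
  have e2: "S powr (a - 1 - 1) = p / (S * S)" using S by (simp add: p_def powr_diff power2_eq_square)
  have e3: "S powr (a - 1/2) = p / sqrt S" using S sh[of S a] by (simp add: p_def)
  have e4: "S powr (a - 1/2 - 1) = p / (S * sqrt S)" using S sh[of S a] powr_diff[of S "a - 1/2" 1] by (simp add: p_def field_simps)
  have e5: "S powr (a - 2) = p / (S * S)" "S powr (a - 3/2) = p / (S * sqrt S)"
    using e2 e4 by (simp_all add: diff_diff_eq)
  have "radial_op n (\<lambda>z. snd z powr a * \<omega> (\<theta> z)) z
    = p * (\<omega>11 (\<theta> z) + 2 * k (\<theta> z) + \<omega>22 (\<theta> z)) - 2 * (n + 2) * Fs z
      - 4 * S * (a * (p / S * ((\<omega>1 (\<theta> z) - \<omega>2 (\<theta> z)) / (2 * sqrt S)) + (a - 1) * (p / (S * S)) * \<omega> (\<theta> z))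
         + 1/2 * (p / sqrt S * ((\<omega>11 (\<theta> z) - 2 * k (\<theta> z) + \<omega>22 (\<theta> z)) / (2 * sqrt S))
         + (a - 1/2) * (p / (S * sqrt S)) * (\<omega>1 (\<theta> z) - \<omega>2 (\<theta> z))))"
    by (subst radial_op_eqI[OF V _ F Ftd[folded Ft_def] Fsd[folded Fs_def]])
      (use s in \<open>auto simp: S_def[symmetric] p_def[symmetric] e1 e2 e3 e4 e5\<close>)
  also have "\<dots> = p * (4 * k (\<theta> z) + K * (K - 1) / S * \<omega> (\<theta> z))"
  proof -
    have ss: "sqrt S * sqrt S = S" "sqrt S > 0" using S by auto
    have Fs: "Fs z = a * (p / S * \<omega> (\<theta> z)) + 1/2 * (p / sqrt S * (\<omega>1 (\<theta> z) - \<omega>2 (\<theta> z)))"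
      by (simp add: Fs_def S_def[symmetric] e1 e3)
    have n: "n = 2 * K - 1" using K by simp
    define r where "r = sqrt S"
    have r: "r > 0" "S = r * r" using ss by (auto simp: r_def)
    show ?thesis
      unfolding Fs a_def n r_def[symmetric] unfolding r(2) using r(1)
      by (simp add: field_simps)
  qed
  finally show ?thesis by (simp add: \<theta>_def S_def p_def a_def)
qed

section \<open>Localised data\<close>

lemma compact_support_bound:
  fixes f :: "'a::euclidean_space \<Rightarrow> real"
  assumes "continuous_on UNIV f" "compact K" "\<And>x. x \<notin> K \<Longrightarrow> f x = 0"
  obtains C where "C \<ge> 0" "\<And>x. \<bar>f x\<bar> \<le> C"
proof -
  have "compact (f ` K)" using assms(1,2) compact_continuous_image continuous_on_subset by blast
  then obtain C where C: "\<And>x. x \<in> K \<Longrightarrow> norm (f x) \<le> C"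
    using compact_imp_bounded bounded_iff by (metis imageI)
  have "\<bar>f x\<bar> \<le> max C 0" for x
  proof (cases "x \<in> K")
    case True
    then show ?thesis using C[OF True] by simp
  next
    case False
    then show ?thesis using assms(3)[OF False] by simp
  qed
  then show ?thesis using that[of "max C 0"] by simp
qed

lemma compact_support_Lipschitz:
  fixes f :: "(real \<times> real) \<times> real \<Rightarrow> real"
  assumes "smooth_on UNIV f" "compact K" "\<And>x. x \<notin> K \<Longrightarrow> f x = 0"
  obtains L where "L \<ge> 0" "\<And>z y y'. \<bar>f (z, y) - f (z, y')\<bar> \<le> L * \<bar>y - y'\<bar>"
proof -
  define g where "g = dir_deriv UNIV f (0, 1)"
  have fd: "(f has_derivative (\<lambda>v. dir_deriv UNIV f v x)) (at x)" for x
    using smooth_on_has_derivative[OF open_UNIV assms(1)] by simp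
  have "g x = 0" if "x \<notin> K" for x
  proof -
    have o: "open (- K)" using assms(2) compact_imp_closed by blast
    have "((\<lambda>x. 0) has_derivative (\<lambda>v. 0)) (at x)" by simp
    then have "(f has_derivative (\<lambda>v. 0)) (at x)"
      by (rule has_derivative_transform_within_open[OF _ o]) (use that assms(3) in auto)
    then show ?thesis unfolding g_def using dir_deriv_eq[OF open_UNIV UNIV_I] by blast
  qed
  moreover have "continuous_on UNIV g"
    unfolding g_def by (intro smooth_on_imp_continuous_on smooth_on_dir_deriv assms(1))
  ultimately obtain L where L: "L \<ge> 0" "\<And>x. \<bar>g x\<bar> \<le> L"
    using compact_support_bound[OF _ assms(2), of g] by metis
  have "\<bar>f (z, y) - f (z, y')\<bar> \<le> L * \<bar>y - y'\<bar>" for z y y'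
  proof -
    have "((\<lambda>y. f (z, y)) has_real_derivative g (z, y)) (at y)" for y
    proof -
      have l: "linear (\<lambda>v. dir_deriv UNIV f v (z, y))" using fd has_derivative_linear by blast
      have "((\<lambda>y. (z, y)) has_derivative (\<lambda>v. (0, v))) (at y)"
        by (auto intro!: derivative_eq_intros)
      from has_derivative_compose[OF this fd]
      have "((\<lambda>y. f (z, y)) has_derivative (\<lambda>v. dir_deriv UNIV f (0, v) (z, y))) (at y)" .
      moreover have "dir_deriv UNIV f (0, v) (z, y) = g (z, y) * v" for v
        using linear_scale[OF l, of v "(0, 1)"] by (simp add: g_def mult.commute)
      ultimately show ?thesis by (simp add: has_field_derivative_def)
    qed
    then have "norm (f (z, y) - f (z, y')) \<le> L * norm (y - y')"
      by (intro field_differentiable_bound[of UNIV "\<lambda>y. f (z, y)" "\<lambda>y. g (z, y)"]) (use L in auto)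
    then show ?thesis by simp
  qed
  then show ?thesis using that L(1) by blast
qed

lemma has_derivative_partial2:
  assumes "smooth_on UNIV f" "\<And>x y. ((\<lambda>y. f (x, y)) has_real_derivative k (x, y)) (at y)"
  shows "(f has_derivative (\<lambda>v. fst v * pd (1, 0) f z + snd v * k z)) (at z)"
proof -
  obtain x y where z: "z = (x, y)" by force
  have d: "(f has_derivative (\<lambda>v. fst v * pd (1, 0) f z + snd v * pd (0, 1) f z)) (at z)"
    by (rule has_derivative_pd[OF open_UNIV assms(1) UNIV_I])
  have "((\<lambda>y. (x, y)) has_derivative (\<lambda>v. (0, v))) (at y)" by (auto intro!: derivative_eq_intros)
  from has_derivative_compose[OF this d[unfolded z]]
  have "((\<lambda>y. f (x, y)) has_real_derivative pd (0, 1) f z) (at y)"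
    by (simp add: has_field_derivative_def z mult.commute[of _ "pd (0, 1) f (x, y)"])
  then have "pd (0, 1) f z = k z" using assms(2)[of x y] DERIV_unique z by blast
  then show ?thesis using d by simp
qed

lemma has_derivative_partial1:
  assumes "smooth_on UNIV f" "\<And>x y. ((\<lambda>x. f (x, y)) has_real_derivative k (x, y)) (at x)"
  shows "(f has_derivative (\<lambda>v. fst v * k z + snd v * pd (0, 1) f z)) (at z)"
proof -
  obtain x y where z: "z = (x, y)" by force
  have d: "(f has_derivative (\<lambda>v. fst v * pd (1, 0) f z + snd v * pd (0, 1) f z)) (at z)"
    by (rule has_derivative_pd[OF open_UNIV assms(1) UNIV_I])
  have "((\<lambda>x. (x, y)) has_derivative (\<lambda>v. (v, 0))) (at x)" by (auto intro!: derivative_eq_intros)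
  from has_derivative_compose[OF this d[unfolded z]]
  have "((\<lambda>x. f (x, y)) has_real_derivative pd (1, 0) f z) (at x)"
    by (simp add: has_field_derivative_def z mult.commute[of _ "pd (1, 0) f (x, y)"])
  then have "pd (1, 0) f z = k z" using assms(2)[of y x] DERIV_unique z by blast
  then show ?thesis using d by simp
qed

text \<open>The right-hand side of the scalar equation, with \<open>s = x \<bullet> x\<close> and \<open>y = f\<close>.\<close>

definition nonlin :: "real \<Rightarrow> (real \<Rightarrow> real) \<Rightarrow> (real \<Rightarrow> real) \<Rightarrow> real \<Rightarrow> real \<Rightarrow> real" where
  "nonlin n B B1 s y = (n - 1) * y ^ 3 * (2 * B (y\<^sup>2 * s) + y\<^sup>2 * s * B1 (y\<^sup>2 * s))"

text \<open>The cutoff acts strictly outside the light cone \<open>s \<le> 1\<close> of the blowup point at time \<open>0\<close>. The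
  case distinction keeps away from the singularity of \<open>selfsim\<close> at \<open>s = 5/4\<close>.\<close>

definition cutdata :: "real \<times> real \<Rightarrow> real" where
  "cutdata z = (if snd z < 11/10 then step (501/500) (251/250) (snd z) * selfsim z else 0)"

text \<open>A short slab around \<open>t = 0\<close> and, for later times, a cone slightly wider than the light cone. The
  aperture is smaller than the radius where the cutoff begins, so the cone stays inside the region in which the
  solution in the slab is still self-similar. Negative times are included to have an open set.\<close>

definition wave_domain :: "real \<Rightarrow> (real \<times> real) set" where
  "wave_domain \<delta> = {z. \<bar>fst z\<bar> < \<delta>} \<union> {z. \<delta> / 2 < fst z \<and> fst z < 1 \<and> snd z < 1001/1000 * (1 - fst z)\<^sup>2}"

lemma open_time_slab: "open {z :: real \<times> real. \<bar>fst z\<bar> < c}"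
  by (intro open_Collect_less continuous_intros)

lemma ss_denom_early: "ss_denom z > 49900/40000 - snd z" if "\<bar>fst z\<bar> < 1/1000"
proof -
  have "(999/1000)\<^sup>2 < (1 - fst z)\<^sup>2" using that by (intro power_strict_mono) auto
  then show ?thesis by (simp add: ss_denom_def power2_eq_square)
qed

lemma smooth_cutdata: "smooth_on {z. \<bar>fst z\<bar> < 1/1000} cutdata"
proof (rule smooth_on_local[OF open_time_slab])
  fix z :: "real \<times> real" assume z: "z \<in> {z. \<bar>fst z\<bar> < 1/1000}"
  define V1 :: "(real \<times> real) set" where "V1 = {z. \<bar>fst z\<bar> < 1/1000} \<inter> {z. snd z < 11/10}"
  define V2 :: "(real \<times> real) set" where "V2 = {z. snd z > 251/250}"
  have o1: "open V1" unfolding V1_def by (intro open_Int open_time_slab open_Collect_less continuous_intros)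
  have o2: "open V2" unfolding V2_def by (intro open_Collect_less continuous_intros)
  have "smooth_on V1 (\<lambda>z. step (501/500) (251/250) (snd z) * selfsim z)"
  proof (rule smooth_on_mult[OF o1 _ smooth_selfsim[OF o1]])
    show "smooth_on V1 (\<lambda>z. step (501/500) (251/250) (snd z))"
      by (rule smooth_on_compose[OF smooth_step o1 open_UNIV smooth_on_snd[OF o1 smooth_on_id[OF o1]]]) auto
    show "ss_denom z > 0" if "z \<in> V1" for z using ss_denom_early[of z] that by (simp add: V1_def)
  qed
  then have s1: "smooth_on V1 cutdata"
    by (rule smooth_on_eqI) (simp add: cutdata_def V1_def)
  have s2: "smooth_on V2 cutdata"
    by (rule smooth_on_eqI[OF smooth_on_const[OF o2, of 0]]) (simp add: cutdata_def V2_def step_eq_0)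
  show "\<exists>V. open V \<and> z \<in> V \<and> smooth_on V cutdata"
  proof (cases "snd z < 11/10")
    case True
    then show ?thesis using z o1 s1 by (intro exI[of _ V1]) (auto simp: V1_def)
  next
    case False
    then show ?thesis using o2 s2 by (intro exI[of _ V2]) (auto simp: V2_def)
  qed
qed

lemma smooth_on_radial_op:
  assumes "open V" "smooth_on V F"
  shows "smooth_on V (radial_op n F)"
  unfolding radial_op_def
  by (intro smooth_on_diff smooth_on_mult smooth_on_const smooth_on_snd smooth_on_id smooth_on_pd assms)

context
  fixes n :: real and B B1 :: "real \<Rightarrow> real"
  assumes n: "n \<ge> 8" and sB: "smooth_on UNIV B" and sB1: "smooth_on UNIV B1"
    and B1: "\<And>s. (B has_real_derivative B1 s) (at s)"
    and Beq: "\<And>s. s < 41/10 \<Longrightarrow> B s = - ((2 * (n - 1) + 1) / (4 * (n - 1))) + s / (4 * (n - 1))"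
begin

abbreviation "nl \<equiv> nonlin n B B1"

lemma B1_eq: "B1 s = 1 / (4 * (n - 1))" if "s < 41/10"
proof -
  have "((\<lambda>s. - ((2 * (n - 1) + 1) / (4 * (n - 1))) + s / (4 * (n - 1))) has_real_derivative 1 / (4 * (n - 1))) (at s)"
    using n by (auto intro!: derivative_eq_intros)
  then have "(B has_real_derivative 1 / (4 * (n - 1))) (at s)"
    by (rule has_field_derivative_transform_within_open[of _ _ _ "{..<41/10}"]) (use that Beq in auto)
  then show ?thesis using B1 DERIV_unique by blast
qed

text \<open>The condition says that \<open>u\<^sup>2 < 41/10\<close>, where the target metric is the one determined by the
  self-similar solution.\<close>

lemma selfsim_solves:
  assumes "ss_denom z > 0" "snd z < 41/10 * ss_denom z"
  shows "radial_op n selfsim z = nl (snd z) (selfsim z)"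
proof -
  define E where "E = ss_denom z"
  define P where "P = E powr (-5/2)"
  define y where "y = selfsim z"
  define m where "m = n - 1"
  have m: "m > 0" using n by (simp add: m_def)
  have E: "E > 0" using assms by (simp add: E_def)
  have y2p: "y\<^sup>2 = E powr (-1)" using E by (simp add: y_def selfsim_def E_def power2_eq_square flip: powr_add)
  then have y2: "y\<^sup>2 = 1 / E" using E by (simp add: powr_minus_divide)
  have "y ^ 3 = y * y\<^sup>2" by (simp add: power3_eq_cube power2_eq_square)
  also have "\<dots> = E powr (-1/2) * E powr (-1)"
    by (simp only: y2p) (simp add: y_def selfsim_def E_def)
  also have "\<dots> = E powr (-5/2) * E powr 1" by (simp only: powr_add[symmetric]) simp
  finally have y3: "y ^ 3 = P * E" using E by (simp add: P_def)
  have \<sigma>: "y\<^sup>2 * snd z < 41/10" using assms E by (simp add: y2 E_def divide_less_eq)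
  have "nl (snd z) y = m * (P * E) * (2 * (- ((2 * m + 1) / (4 * m)) + (snd z / E) / (4 * m)) + (snd z / E) * (1 / (4 * m)))"
    unfolding nonlin_def y3 Beq[OF \<sigma>] B1_eq[OF \<sigma>] unfolding y2 m_def by simp
  also have "\<dots> = P * (- (m + 1/2) * E + 3/4 * snd z)"
    using m E by (simp add: field_simps)
  also have "\<dots> = radial_op n selfsim z"
    unfolding radial_op_selfsim[OF assms(1)] by (simp add: P_def E_def m_def algebra_simps)
  finally show ?thesis by (simp add: y_def)
qed

lemma smooth_nl:
  fixes f g :: "'a::real_normed_vector \<Rightarrow> real"
  assumes "open S" "smooth_on S f" "smooth_on S g"
  shows "smooth_on S (\<lambda>z. nl (f z) (g z))"
proof -
  have "smooth_on S (\<lambda>z. (g z)\<^sup>2 * f z)" by (intro smooth_on_mult smooth_on_power assms)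
  then show ?thesis
    unfolding nonlin_def
    by (intro smooth_on_mult smooth_on_add smooth_on_const smooth_on_power assms
      smooth_on_compose[OF sB assms(1) open_UNIV] smooth_on_compose[OF sB1 assms(1) open_UNIV]) auto
qed

lemma nl_0 [simp]: "nl s 0 = 0"
  by (simp add: nonlin_def)

definition "rexp = (n + 1) / 2"

text \<open>The unknown \<open>w\<close> is \<open>r powr rexp\<close> times the difference between the solution and \<open>cutdata\<close>; it has to
  solve \<open>w\<^sub>t\<^sub>t - w\<^sub>r\<^sub>r = source\<close>.\<close>

definition source :: "(real \<times> real) \<times> real \<Rightarrow> real" where
  "source p = (case p of ((t, r), w) \<Rightarrow>
     r powr rexp * (nl (r\<^sup>2) (cutdata (t, r\<^sup>2) + r powr (- rexp) * w) - radial_op n cutdata (t, r\<^sup>2))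
     - rexp * (rexp - 1) / r\<^sup>2 * w)"

lemma smooth_source: "smooth_on {p. \<bar>fst (fst p)\<bar> < 1/1000 \<and> snd (fst p) > 0} source"
proof -
  define Sd where "Sd = {p :: (real \<times> real) \<times> real. \<bar>fst (fst p)\<bar> < 1/1000 \<and> snd (fst p) > 0}"
  have o: "open Sd" unfolding Sd_def by (intro open_Collect_conj open_Collect_less continuous_intros)
  have c: "smooth_on Sd (\<lambda>p. F (fst (fst p), (snd (fst p))\<^sup>2))" if "smooth_on {z. \<bar>fst z\<bar> < 1/1000} F" for F :: "real \<times> real \<Rightarrow> real"
    by (rule smooth_on_compose[OF that o open_time_slab])
      (intro smooth_on_Pair smooth_on_power smooth_on_fst smooth_on_snd smooth_on_id o, simp add: Sd_def)
  have r: "smooth_on Sd (\<lambda>p. snd (fst p))" by (intro smooth_on_fst smooth_on_snd smooth_on_id o)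
  have pw: "smooth_on Sd (\<lambda>p. snd (fst p) powr a)" for a
    by (rule smooth_on_powr[OF o r]) (simp add: Sd_def)
  have "smooth_on Sd source"
    unfolding source_def split_def
    by (intro smooth_on_diff smooth_on_mult smooth_on_add smooth_nl smooth_on_divide smooth_on_power smooth_on_const o pw r
        c smooth_cutdata smooth_on_radial_op open_time_slab smooth_on_snd smooth_on_id) (simp add: Sd_def)
  then show ?thesis by (simp only: Sd_def)
qed

text \<open>Where the cutoff is constant, \<open>cutdata\<close> is either the self-similar solution or zero, and both solve
  the equation.\<close>

lemma source_0:
  assumes "\<bar>t\<bar> < 1/1000" "r > 0" "r\<^sup>2 < 501/500 \<or> 251/250 < r\<^sup>2"
  shows "source ((t, r), 0) = 0"
proof -
  have "radial_op n cutdata (t, r\<^sup>2) = nl (r\<^sup>2) (cutdata (t, r\<^sup>2))"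
    using assms(3)
  proof
    assume r: "r\<^sup>2 < 501/500"
    let ?V = "{z :: real \<times> real. snd z < 501/500}"
    have o: "open ?V" by (intro open_Collect_less continuous_intros)
    have eq: "cutdata z = selfsim z" if "z \<in> ?V" for z using that by (simp add: cutdata_def step_eq_1)
    have e: "ss_denom (t, r\<^sup>2) > 49900/40000 - r\<^sup>2" using ss_denom_early[of "(t, r\<^sup>2)"] assms(1) by simp
    have "radial_op n cutdata (t, r\<^sup>2) = radial_op n selfsim (t, r\<^sup>2)"
      by (rule radial_op_cong[OF o _ eq]) (use r in auto)
    also have "\<dots> = nl (r\<^sup>2) (selfsim (t, r\<^sup>2))"
      using selfsim_solves[of "(t, r\<^sup>2)"] e r by simp
    finally show ?thesis using eq[of "(t, r\<^sup>2)"] r by simp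
  next
    assume r: "251/250 < r\<^sup>2"
    let ?V = "{z :: real \<times> real. 251/250 < snd z}"
    have o: "open ?V" by (intro open_Collect_less continuous_intros)
    have eq: "cutdata z = 0" if "z \<in> ?V" for z using that by (simp add: cutdata_def step_eq_0)
    have "radial_op n cutdata (t, r\<^sup>2) = radial_op n (\<lambda>z. 0) (t, r\<^sup>2)"
      by (rule radial_op_cong[OF o _ eq]) (use r in auto)
    also have "\<dots> = 0"
      by (subst radial_op_eqI[OF open_UNIV UNIV_I, where Ft = "\<lambda>z. 0" and Fs = "\<lambda>z. 0" and ?D1.0 = "\<lambda>v. 0" and ?D2.0 = "\<lambda>v. 0"]) auto
    finally show ?thesis using eq[of "(t, r\<^sup>2)"] r by simp
  qed
  then show ?thesis by (simp add: source_def)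
qed

text \<open>The cutoffs in \<open>t\<close>, \<open>r\<close> and \<open>w\<close> make the source bounded and Lipschitz on the whole space. They are
  inactive for the solution: it is supported near \<open>r = 1\<close>, and it is small for short times. The factor
  \<open>1/4\<close> comes from the null coordinates.\<close>

definition cut_source :: "(real \<times> real) \<times> real \<Rightarrow> real" where
  "cut_source p = (if \<bar>fst (fst p)\<bar> < 1/1000 \<and> snd (fst p) > 0 then
     1/4 * (step 1 4 ((3000 * fst (fst p))\<^sup>2) * step (1/16) (1/4) ((snd (fst p) - 1)\<^sup>2) * step 1 4 ((snd p)\<^sup>2) * source p) else 0)"

lemma smooth_cut_source: "smooth_on UNIV cut_source"
proof (rule smooth_on_local[OF open_UNIV])
  fix p :: "(real \<times> real) \<times> real"
  define V1 where "V1 = {p :: (real \<times> real) \<times> real. \<bar>fst (fst p)\<bar> < 1/1000 \<and> snd (fst p) > 0}"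
  define V2 where "V2 = {p :: (real \<times> real) \<times> real. 4 < (3000 * fst (fst p))\<^sup>2 \<or> 1/4 < (snd (fst p) - 1)\<^sup>2}"
  have o1: "open V1" unfolding V1_def by (intro open_Collect_conj open_Collect_less continuous_intros)
  have o2: "open V2" unfolding V2_def by (intro open_Collect_disj open_Collect_less continuous_intros)
  have st: "smooth_on V1 (\<lambda>p. step a b (g p))" if "a < b" "smooth_on V1 g" for a b and g :: "(real \<times> real) \<times> real \<Rightarrow> real"
    by (rule smooth_on_compose[OF smooth_step[OF that(1)] o1 open_UNIV that(2)]) auto
  have "smooth_on V1 (\<lambda>p. 1/4 * (step 1 4 ((3000 * fst (fst p))\<^sup>2) * step (1/16) (1/4) ((snd (fst p) - 1)\<^sup>2) * step 1 4 ((snd p)\<^sup>2) * source p))"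
    by (intro smooth_on_mult st smooth_on_power smooth_on_diff smooth_on_const smooth_on_fst smooth_on_snd smooth_on_id o1
      smooth_source[folded V1_def]) auto
  then have s1: "smooth_on V1 cut_source"
    by (rule smooth_on_eqI) (simp add: cut_source_def V1_def)
  have s2: "smooth_on V2 cut_source"
    by (rule smooth_on_eqI[OF smooth_on_const[OF o2, of 0]]) (auto simp: cut_source_def V2_def step_eq_0)
  have "p \<in> V1 \<or> p \<in> V2"
  proof -
    have "p \<in> V2" if "\<not> \<bar>fst (fst p)\<bar> < 1/1000"
    proof -
      have "(3::real)\<^sup>2 \<le> (3000 * fst (fst p))\<^sup>2" using that by (intro abs_le_square_iff[THEN iffD1]) auto
      then show ?thesis by (simp add: V2_def)
    qed
    moreover have "p \<in> V2" if "\<not> snd (fst p) > 0"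
    proof -
      have "(1::real)\<^sup>2 \<le> (snd (fst p) - 1)\<^sup>2" using that by (intro abs_le_square_iff[THEN iffD1]) auto
      then show ?thesis by (simp add: V2_def)
    qed
    ultimately show ?thesis by (auto simp: V1_def)
  qed
  then show "\<exists>V. open V \<and> p \<in> V \<and> smooth_on V cut_source" using o1 o2 s1 s2 by metis
qed

lemma cut_source_support:
  assumes "cut_source ((t, r), y) \<noteq> 0"
  shows "\<bar>t\<bar> < 1/1000 \<and> 1/2 \<le> r \<and> r \<le> 3/2 \<and> \<bar>y\<bar> \<le> 2"
proof -
  have a: "\<bar>t\<bar> < 1/1000" using assms by (auto simp: cut_source_def split: if_splits)
  have "\<not> 1/4 \<le> (r - 1)\<^sup>2" "\<not> 4 \<le> y\<^sup>2" using assms step_eq_0 by (auto simp: cut_source_def split: if_splits)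
  then have "(r - 1)\<^sup>2 \<le> (1/2)\<^sup>2" "y\<^sup>2 \<le> 2\<^sup>2" by (auto simp: power2_eq_square)
  then have "\<bar>r - 1\<bar> \<le> 1/2" "\<bar>y\<bar> \<le> 2" unfolding abs_le_square_iff[symmetric] by auto
  with a show ?thesis by (intro conjI; linarith)
qed

lemma cut_source_0:
  assumes "r\<^sup>2 < 501/500 \<or> 251/250 < r\<^sup>2"
  shows "cut_source ((t, r), 0) = 0"
  using source_0[of t r] assms by (simp add: cut_source_def)

lemma cut_source_eq:
  assumes "\<bar>t\<bar> \<le> 1/3000" "\<bar>r - 1\<bar> \<le> 1/4" "\<bar>y\<bar> \<le> 1"
  shows "4 * cut_source ((t, r), y) = source ((t, r), y)"
proof -
  have "(3000 * t)\<^sup>2 \<le> 1\<^sup>2" "(r - 1)\<^sup>2 \<le> (1/4)\<^sup>2" "y\<^sup>2 \<le> 1\<^sup>2"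
    unfolding abs_le_square_iff[symmetric] using assms by (auto simp: abs_mult)
  moreover have "r > 0" using assms(2) by linarith
  ultimately show ?thesis using assms by (simp add: cut_source_def step_eq_1 power2_eq_square)
qed

text \<open>The bounds \<open>C\<close> and \<open>L\<close> of the cut off source do not depend on the length \<open>\<tau>\<close> of the time interval,
  which is chosen afterwards. A further cutoff in time confines the source to \<open>\<bar>t\<bar> < 2 * \<tau>\<close>. The origin of the null
  coordinates is such that both axes miss the support of the source at \<open>w = 0\<close>: points with \<open>\<xi> \<le> 0\<close> in this time
  interval lie in the self-similar region, those with \<open>\<eta> \<le> 0\<close> in the region where the data vanish.\<close>

theorem localised_wave:
  obtains \<tau> \<omega> \<omega>1 \<omega>2 \<omega>11 \<omega>22 k \<xi> \<eta> where
    "0 < \<tau>" "\<tau> \<le> 1/10000" "smooth_on UNIV \<omega>"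
    "\<And>z. (\<omega> has_derivative (\<lambda>v. fst v * \<omega>1 z + snd v * \<omega>2 z)) (at z)"
    "\<And>z. (\<omega>1 has_derivative (\<lambda>v. fst v * \<omega>11 z + snd v * k z)) (at z)"
    "\<And>z. (\<omega>2 has_derivative (\<lambda>v. fst v * k z + snd v * \<omega>22 z)) (at z)"
    "\<And>t r. \<bar>t\<bar> < \<tau> \<Longrightarrow> r > 0 \<Longrightarrow> 4 * k (t + r - \<xi>, t - r - \<eta>) = source ((t, r), \<omega> (t + r - \<xi>, t - r - \<eta>))"
    "\<And>t r. \<bar>t\<bar> < \<tau> \<Longrightarrow> r \<le> 10005/10000 \<or> 11/10 \<le> r \<Longrightarrow> \<omega> (t + r - \<xi>, t - r - \<eta>) = 0"
proof -
  define Kc :: "((real \<times> real) \<times> real) set" where "Kc = cbox ((-1, 0), -2) ((1, 2), 2)"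
  have Kc: "compact Kc" unfolding Kc_def by (rule compact_cbox)
  have supp: "cut_source p = 0" if "p \<notin> Kc" for p
  proof (rule ccontr)
    assume "cut_source p \<noteq> 0"
    then have "\<bar>fst (fst p)\<bar> < 1/1000 \<and> 1/2 \<le> snd (fst p) \<and> snd (fst p) \<le> 3/2 \<and> \<bar>snd p\<bar> \<le> 2"
      using cut_source_support[of "fst (fst p)" "snd (fst p)" "snd p"] by simp
    then have "p \<in> Kc" by (cases p, cases "fst p") (auto simp: Kc_def mem_box Basis_prod_def)
    then show False using that by simp
  qed
  obtain C where C: "C \<ge> 0" "\<And>p. \<bar>cut_source p\<bar> \<le> C"
    using compact_support_bound[OF smooth_on_imp_continuous_on[OF smooth_cut_source] Kc supp] by metis
  obtain L where L: "L \<ge> 0" "\<And>z y y'. \<bar>cut_source (z, y) - cut_source (z, y')\<bar> \<le> L * \<bar>y - y'\<bar>"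
    using compact_support_Lipschitz[OF smooth_cut_source Kc supp] by metis
  \<comment> \<open>\<open>64 * C * \<tau>\<close> bounds the solution and \<open>64 * L * \<tau>\<close> is the contraction constant; both are below \<open>1\<close>.
    The bound \<open>1/10000\<close> keeps the wave, which spreads by at most \<open>4 * \<tau>\<close>, out of the cone of \<open>wave_domain\<close>.\<close>
  define \<tau> where "\<tau> = 1 / (10000 + 128 * (C + L))"
  have D: "10000 + 128 * (C + L) > 0" using C L by simp
  have \<tau>: "0 < \<tau>" "\<tau> \<le> 1/10000" using C L by (auto simp: \<tau>_def field_simps)
  have small: "128 * (C + L) * \<tau> < 1" using D by (simp add: \<tau>_def divide_less_eq)
  have CL: "C * \<tau> \<le> 1/128" "L * \<tau> < 1/128"
  proof -
    have "C * \<tau> \<ge> 0" "L * \<tau> \<ge> 0" using C L \<tau> by auto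
    then show "C * \<tau> \<le> 1/128" "L * \<tau> < 1/128" using small by (auto simp: algebra_simps)
  qed
  define R1 where "R1 = sqrt (501/500)"
  define R2 where "R2 = sqrt (251/250)"
  have R1: "10009/10000 \<le> R1" "R1 \<le> 11/10" "R1\<^sup>2 = 501/500"
    unfolding R1_def
    by (rule real_le_rsqrt, simp add: power2_eq_square, rule real_le_lsqrt, simp_all add: power2_eq_square)
  have R2: "R2 \<le> 1002/1000" "R2\<^sup>2 = 251/250" "R2 > 0"
    unfolding R2_def by (rule real_le_lsqrt, simp_all add: power2_eq_square)
  define \<xi> where "\<xi> = R1 - 3 * \<tau>"
  define \<eta> where "\<eta> = - R2 - 3 * \<tau>"
  define T where "T z = (fst z + snd z + \<xi> + \<eta>) / 2" for z :: "real \<times> real"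
  define R where "R z = (fst z - snd z + \<xi> - \<eta>) / 2" for z :: "real \<times> real"
  define k where "k p = step 1 4 ((T (fst p) / \<tau>)\<^sup>2) * cut_source ((T (fst p), R (fst p)), snd p)" for p :: "(real \<times> real) \<times> real"
  have TR: "T (t + r - \<xi>, t - r - \<eta>) = t" "R (t + r - \<xi>, t - r - \<eta>) = r" for t r
    by (simp_all add: T_def R_def)
  have k_le: "\<bar>step a b x * c\<bar> \<le> \<bar>c\<bar>" for a b x c
    using step_bounds[of a b x] by (simp add: abs_mult mult_left_le_one_le)
  have T_small: "\<bar>T z\<bar> < 2 * \<tau>" if "step 1 4 ((T z / \<tau>)\<^sup>2) \<noteq> 0" for z
  proof -
    have "\<not> 4 \<le> (T z / \<tau>)\<^sup>2" using that step_eq_0 by blast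
    then have "(T z / \<tau>)\<^sup>2 < 2\<^sup>2" by simp
    then have "\<bar>T z / \<tau>\<bar> < 2" using abs_le_square_iff[of 2 "T z / \<tau>"] by fastforce
    then show ?thesis using \<tau> by (simp add: abs_divide divide_less_eq)
  qed
  obtain w w1 w2 where w: "smooth_on UNIV w" "smooth_on UNIV w1" "smooth_on UNIV w2"
    "\<And>z. (w has_derivative (\<lambda>v. fst v * w1 z + snd v * w2 z)) (at z)"
    "\<And>x y. ((\<lambda>y. w1 (x, y)) has_real_derivative k ((x, y), w (x, y))) (at y)"
    "\<And>x y. ((\<lambda>x. w2 (x, y)) has_real_derivative k ((x, y), w (x, y))) (at x)"
    "\<And>z. \<bar>w z\<bar> \<le> C * (2 * (4 * \<tau>)) * (2 * 4)"
    "\<And>z. fst z \<le> 0 \<or> snd z \<le> 0 \<Longrightarrow> w z = 0"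
  proof (rule goursat[of k C L "- \<xi> - \<eta>" "4 * \<tau>" 4])
    have sT: "smooth_on UNIV (\<lambda>p :: (real \<times> real) \<times> real. T (fst p))" and sR: "smooth_on UNIV (\<lambda>p :: (real \<times> real) \<times> real. R (fst p))"
      unfolding T_def R_def divide_inverse
      by (intro smooth_on_mult smooth_on_add smooth_on_diff smooth_on_const smooth_on_fst smooth_on_snd smooth_on_id open_UNIV)+
    have "smooth_on UNIV (\<lambda>p :: (real \<times> real) \<times> real. step 1 4 ((T (fst p) / \<tau>)\<^sup>2))"
      by (rule smooth_on_compose[OF smooth_step open_UNIV open_UNIV])
        (auto intro!: smooth_on_power smooth_on_divide sT smooth_on_const simp: \<tau> less_imp_neq[OF \<tau>(1), symmetric])
    moreover have "smooth_on UNIV (\<lambda>p :: (real \<times> real) \<times> real. cut_source ((T (fst p), R (fst p)), snd p))"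
      by (rule smooth_on_compose[OF smooth_cut_source open_UNIV open_UNIV])
        (auto intro!: smooth_on_Pair sT sR smooth_on_snd smooth_on_id)
    ultimately show "smooth_on UNIV k" unfolding k_def by (intro smooth_on_mult open_UNIV)
    show "\<bar>k (z, y)\<bar> \<le> C" for z y
      unfolding k_def by (rule order_trans[OF k_le C(2)])
    show "\<bar>k (z, y) - k (z, y')\<bar> \<le> L * \<bar>y - y'\<bar>" for z y y'
    proof -
      have "k (z, y) - k (z, y') = step 1 4 ((T z / \<tau>)\<^sup>2) * (cut_source ((T z, R z), y) - cut_source ((T z, R z), y'))"
        by (simp add: k_def right_diff_distrib)
      then show ?thesis using order_trans[OF k_le L(2)] by simp
    qed
    show "\<bar>fst z + snd z - (- \<xi> - \<eta>)\<bar> \<le> 4 * \<tau> \<and> \<bar>fst z\<bar> \<le> 4" if "k (z, y) \<noteq> 0" for z y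
    proof -
      have 1: "\<bar>T z\<bar> < 2 * \<tau>" by (rule T_small) (use that in \<open>auto simp: k_def\<close>)
      have 2: "1/2 \<le> R z" "R z \<le> 3/2" using cut_source_support[of "T z" "R z" y] that by (auto simp: k_def)
      have "fst z = T z + R z - \<xi>" by (simp add: T_def R_def field_simps)
      then have "\<bar>fst z\<bar> \<le> 4" using 1 2 \<tau> R1 by (simp add: \<xi>_def abs_le_iff abs_less_iff)
      moreover have "fst z + snd z - (- \<xi> - \<eta>) = 2 * T z" by (simp add: T_def)
      ultimately show ?thesis using 1 by simp
    qed
    show "k (z, 0) = 0" if z: "fst z \<le> 0 \<or> snd z \<le> 0" for z
    proof (cases "step 1 4 ((T z / \<tau>)\<^sup>2) = 0")
      case False
      then have 1: "\<bar>T z\<bar> < 2 * \<tau>" by (rule T_small)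
      have "cut_source ((T z, R z), 0) = 0"
      proof (cases "R z > 0")
        case True
        have "(R z)\<^sup>2 < 501/500 \<or> 251/250 < (R z)\<^sup>2"
          using z
        proof
          assume "fst z \<le> 0"
          moreover have "fst z = T z + R z - \<xi>" by (simp add: T_def R_def field_simps)
          ultimately have "R z < R1" using 1 \<tau> by (simp add: \<xi>_def abs_less_iff)
          then have "(R z)\<^sup>2 < R1\<^sup>2" using True by (intro power_strict_mono) auto
          then show ?thesis by (simp add: R1)
        next
          assume "snd z \<le> 0"
          moreover have "snd z = T z - R z - \<eta>" by (simp add: T_def R_def field_simps)
          ultimately have "R2 < R z" using 1 \<tau> by (simp add: \<eta>_def abs_less_iff)
          then have "R2\<^sup>2 < (R z)\<^sup>2" using R2 by (intro power_strict_mono) auto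
          then show ?thesis by (simp add: R2)
        qed
        then show ?thesis by (rule cut_source_0)
      next
        case False
        then show ?thesis using cut_source_support[of "T z" "R z" 0] by force
      qed
      then show ?thesis by (simp add: k_def)
    qed (simp add: k_def)
  qed (use \<tau> L CL in auto)
  define kk where "kk z = k (z, w z)" for z
  have w0: "w (t + r - \<xi>, t - r - \<eta>) = 0" if "\<bar>t\<bar> < \<tau>" "r \<le> 10005/10000 \<or> 11/10 \<le> r" for t r
  proof (rule w(8))
    show "fst (t + r - \<xi>, t - r - \<eta>) \<le> 0 \<or> snd (t + r - \<xi>, t - r - \<eta>) \<le> 0"
      using that(2)
    proof
      assume "r \<le> 10005/10000"
      then show ?thesis using that(1) \<tau> R1 by (simp add: \<xi>_def abs_less_iff)
    next
      assume "11/10 \<le> r"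
      then show ?thesis using that(1) \<tau> R2 by (simp add: \<eta>_def abs_less_iff)
    qed
  qed
  show ?thesis
  proof (rule that[of \<tau> w w1 w2 "pd (1, 0) w1" kk "pd (0, 1) w2" \<xi> \<eta>])
    show "(w1 has_derivative (\<lambda>v. fst v * pd (1, 0) w1 z + snd v * kk z)) (at z)" for z
      by (rule has_derivative_partial2[OF w(2)]) (simp add: kk_def w(5))
    show "(w2 has_derivative (\<lambda>v. fst v * kk z + snd v * pd (0, 1) w2 z)) (at z)" for z
      by (rule has_derivative_partial1[OF w(3)]) (simp add: kk_def w(6))
    fix t r :: real assume t: "\<bar>t\<bar> < \<tau>" and r: "r > 0"
    let ?z = "(t + r - \<xi>, t - r - \<eta>)"
    have "(t / \<tau>)\<^sup>2 \<le> 1\<^sup>2" using t \<tau> by (intro abs_le_square_iff[THEN iffD1]) (simp add: abs_divide divide_le_eq)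
    then have kk: "kk ?z = cut_source ((t, r), w ?z)"
      by (simp add: kk_def k_def TR step_eq_1)
    show "4 * kk ?z = source ((t, r), w ?z)"
    proof (cases "\<bar>r - 1\<bar> \<le> 1/4")
      case True
      have "\<bar>w ?z\<bar> \<le> 1" using w(7)[of ?z] CL(1) by simp
      then show ?thesis unfolding kk by (intro cut_source_eq True) (use t \<tau> in auto)
    next
      case False
      then have r': "r \<le> 3/4 \<or> 5/4 \<le> r" by (cases "1 \<le> r") auto
      then have z: "w ?z = 0" using w0[OF t] by force
      have "r\<^sup>2 < 501/500 \<or> 251/250 < r\<^sup>2"
        using r'
      proof
        assume "r \<le> 3/4"
        then have "r\<^sup>2 \<le> (3/4)\<^sup>2" using r by (intro power_mono) auto
        then show ?thesis by (simp add: power2_eq_square)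
      next
        assume "5/4 \<le> r"
        then have "(5/4)\<^sup>2 \<le> r\<^sup>2" by (intro power_mono) auto
        then show ?thesis by (simp add: power2_eq_square)
      qed
      then show ?thesis unfolding kk z using source_0[of t r] cut_source_0[of r t] t \<tau> r by simp
    qed
  qed (use \<tau> w w0 in auto)
qed

text \<open>The solution is self-similar inside, \<open>cutdata\<close> plus the correction near the cutoff region, and the
  three descriptions agree where they overlap.\<close>

theorem blowup_profile:
  obtains \<delta> F where "0 < \<delta>" "\<delta> < 1" "smooth_on (wave_domain \<delta>) F"
    "\<And>z. z \<in> wave_domain \<delta> \<Longrightarrow> snd z \<ge> 0 \<Longrightarrow> radial_op n F z = nl (snd z) (F z)"
    "\<And>z. \<bar>fst z\<bar> < \<delta> \<Longrightarrow> 2 < snd z \<Longrightarrow> F z = 0"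
    "\<And>z. \<delta> \<le> fst z \<Longrightarrow> F z = selfsim z"
proof -
  obtain \<tau> \<omega> \<omega>1 \<omega>2 \<omega>11 \<omega>22 k \<xi> \<eta> where \<tau>: "0 < \<tau>" "\<tau> \<le> 1/10000" and s\<omega>: "smooth_on UNIV \<omega>" and
    d0: "\<And>z. (\<omega> has_derivative (\<lambda>v. fst v * \<omega>1 z + snd v * \<omega>2 z)) (at z)" and
    d1: "\<And>z. (\<omega>1 has_derivative (\<lambda>v. fst v * \<omega>11 z + snd v * k z)) (at z)" and
    d2: "\<And>z. (\<omega>2 has_derivative (\<lambda>v. fst v * k z + snd v * \<omega>22 z)) (at z)" and
    keq: "\<And>t r. \<bar>t\<bar> < \<tau> \<Longrightarrow> r > 0 \<Longrightarrow> 4 * k (t + r - \<xi>, t - r - \<eta>) = source ((t, r), \<omega> (t + r - \<xi>, t - r - \<eta>))" and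
    \<omega>0: "\<And>t r. \<bar>t\<bar> < \<tau> \<Longrightarrow> r \<le> 10005/10000 \<or> 11/10 \<le> r \<Longrightarrow> \<omega> (t + r - \<xi>, t - r - \<eta>) = 0"
    by (rule localised_wave) (rule that; assumption)
  define \<theta> where "\<theta> z = (fst z + sqrt (snd z) - \<xi>, fst z - sqrt (snd z) - \<eta>)" for z :: "real \<times> real"
  define \<phi>0 where "\<phi>0 z = snd z powr (- rexp / 2) * \<omega> (\<theta> z)" for z
  define \<phi> where "\<phi> z = (if snd z > 1/2 then \<phi>0 z else 0)" for z
  define F where "F z = (if fst z < \<tau> then cutdata z + \<phi> z else selfsim z)" for z
  define S where "S = {z :: real \<times> real. \<bar>fst z\<bar> < \<tau>}"
  define S1 where "S1 = S \<inter> {z. snd z < 1001/1000}"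
  define S2 where "S2 = S \<inter> {z. snd z > 1/2}"
  define Q where "Q = {z :: real \<times> real. \<tau> / 2 < fst z \<and> fst z < 1 \<and> snd z < 1001/1000 * (1 - fst z)\<^sup>2}"
  have oS: "open S" unfolding S_def by (rule open_time_slab)
  have oS1: "open S1" unfolding S1_def by (intro open_Int oS open_Collect_less continuous_intros)
  have oS2: "open S2" unfolding S2_def by (intro open_Int oS open_Collect_less continuous_intros)
  have oQ: "open Q" unfolding Q_def by (intro open_Collect_conj open_Collect_less continuous_intros)
  have \<phi>_0: "\<phi> z = 0" if "z \<in> S1" for z
  proof (cases "snd z > 1/2")
    case True
    have "sqrt (snd z) \<le> 10005/10000"
      using that True by (intro real_le_lsqrt) (auto simp: S1_def power2_eq_square)
    then have "\<omega> (\<theta> z) = 0" unfolding \<theta>_def using that by (intro \<omega>0) (auto simp: S1_def S_def)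
    then show ?thesis by (simp add: \<phi>_def \<phi>0_def)
  qed (simp add: \<phi>_def)
  have F_S1: "F z = selfsim z" if "z \<in> S1" for z
    using that \<phi>_0[OF that] by (auto simp: F_def S1_def cutdata_def step_eq_1)
  have F_Q: "F z = selfsim z" if "z \<in> Q" for z
  proof (cases "fst z < \<tau>")
    case True
    have "(1 - fst z)\<^sup>2 \<le> 1\<^sup>2" using that \<tau> by (intro power_mono) (auto simp: Q_def)
    then have "z \<in> S1" using that True \<tau> by (auto simp: Q_def S1_def S_def)
    then show ?thesis by (rule F_S1)
  qed (simp add: F_def)
  have F_S2: "F z = cutdata z + \<phi>0 z" if "z \<in> S2" for z
    using that by (auto simp: F_def \<phi>_def S2_def S_def)
  have denomQ: "ss_denom z > 0" "snd z < 41/10 * ss_denom z" if "z \<in> Q" for z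
  proof -
    define Y where "Y = (1 - fst z)\<^sup>2"
    have Y: "Y > 0" "snd z < 1001/1000 * Y" using that by (auto simp: Q_def Y_def)
    then show "ss_denom z > 0" unfolding ss_denom_def Y_def[symmetric] by linarith
    show "snd z < 41/10 * ss_denom z" unfolding ss_denom_def Y_def[symmetric] using Y by (simp add: algebra_simps)
  qed
  have denomS1: "ss_denom z > 0" "snd z < 41/10 * ss_denom z" if "z \<in> S1" for z
    using ss_denom_early[of z] that \<tau> by (auto simp: S1_def S_def)
  have cS: "smooth_on S2 cutdata"
    by (rule smooth_on_subset[OF open_time_slab oS2 _ smooth_cutdata]) (use \<tau> in \<open>auto simp: S2_def S_def\<close>)
  have pS: "smooth_on S2 \<phi>0"
  proof -
    have sq: "smooth_on S2 (\<lambda>z. sqrt (snd z))"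
      by (intro smooth_on_sqrt smooth_on_snd smooth_on_id oS2) (auto simp: S2_def)
    have "smooth_on S2 (\<lambda>z. \<omega> (\<theta> z))"
      unfolding \<theta>_def
      by (rule smooth_on_compose[OF s\<omega> oS2 open_UNIV])
        (auto intro!: smooth_on_Pair smooth_on_add smooth_on_diff sq smooth_on_const smooth_on_fst smooth_on_id oS2)
    then show ?thesis
      unfolding \<phi>0_def by (intro smooth_on_mult smooth_on_powr smooth_on_snd smooth_on_id oS2) (auto simp: S2_def)
  qed
  have dom: "wave_domain \<tau> = S1 \<union> S2 \<union> Q"
    by (auto simp: wave_domain_def S1_def S2_def S_def Q_def)
  have sF1: "smooth_on S1 F" by (rule smooth_on_eqI[OF smooth_selfsim[OF oS1]]) (use denomS1 F_S1 in auto)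
  have sFQ: "smooth_on Q F" by (rule smooth_on_eqI[OF smooth_selfsim[OF oQ]]) (use denomQ F_Q in auto)
  have sF2: "smooth_on S2 F" by (rule smooth_on_eqI[OF smooth_on_add[OF oS2 cS pS]]) (rule F_S2)
  show ?thesis
  proof (rule that[of \<tau> F])
    show "smooth_on (wave_domain \<tau>) F"
    proof (rule smooth_on_local)
      show "open (wave_domain \<tau>)" unfolding dom by (intro open_Un oS1 oS2 oQ)
      fix z assume "z \<in> wave_domain \<tau>"
      then consider "z \<in> S1" | "z \<in> S2" | "z \<in> Q" using dom by blast
      then show "\<exists>V. open V \<and> z \<in> V \<and> smooth_on V F"
        using oS1 oS2 oQ sF1 sF2 sFQ by cases metis+
    qed
    show "radial_op n F z = nl (snd z) (F z)" if z: "z \<in> wave_domain \<tau>" "snd z \<ge> 0" for z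
    proof -
      consider "z \<in> S1" | "z \<in> Q" | "z \<in> S2" using dom z by blast
      then show ?thesis
      proof cases
        case 1
        have "radial_op n F z = radial_op n selfsim z" by (rule radial_op_cong[OF oS1 1 F_S1])
        then show ?thesis using selfsim_solves[OF denomS1[OF 1]] F_S1[OF 1] by simp
      next
        case 2
        have "radial_op n F z = radial_op n selfsim z" by (rule radial_op_cong[OF oQ 2 F_Q])
        then show ?thesis using selfsim_solves[OF denomQ[OF 2]] F_Q[OF 2] by simp
      next
        case 3
        define t s r where "t = fst z" and "s = snd z" and "r = sqrt s"
        have s: "s > 0" and t: "\<bar>t\<bar> < \<tau>" using 3 by (auto simp: S2_def S_def s_def t_def)
        have r: "r > 0" "r\<^sup>2 = s" using s by (auto simp: r_def)
        have \<theta>z: "\<theta> z = (t + r - \<xi>, t - r - \<eta>)" by (simp add: \<theta>_def t_def r_def s_def)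
        have rK: "r powr rexp = s powr (rexp / 2)" "r powr (- rexp) = s powr (- rexp / 2)"
          using s by (auto simp: r_def powr_half_sqrt[symmetric] powr_powr)
        have inv: "s powr (- rexp / 2) * s powr (rexp / 2) = 1" using s by (simp flip: powr_add)
        have zz: "(t, s) = z" by (simp add: t_def s_def)
        have "radial_op n F z = radial_op n (\<lambda>z. cutdata z + \<phi>0 z) z"
          by (rule radial_op_cong[OF oS2 3 F_S2])
        also have "\<dots> = radial_op n cutdata z + radial_op n \<phi>0 z"
          by (rule radial_op_add[OF oS2 cS pS 3])
        also have "radial_op n \<phi>0 z = s powr (- rexp / 2) * (4 * k (\<theta> z) + rexp * (rexp - 1) / s * \<omega> (\<theta> z))"
          unfolding \<phi>0_def[abs_def] \<theta>_def s_def
          by (rule radial_op_wave[OF d0 d1 d2]) (use s in \<open>auto simp: rexp_def s_def\<close>)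
        also have "4 * k (\<theta> z) = source ((t, r), \<omega> (\<theta> z))" unfolding \<theta>z by (rule keq[OF t r(1)])
        also have "source ((t, r), \<omega> (\<theta> z)) = s powr (rexp / 2) * (nl s (F z) - radial_op n cutdata z) - rexp * (rexp - 1) / s * \<omega> (\<theta> z)"
          by (simp only: source_def prod.case r(2) rK zz F_S2[OF 3] \<phi>0_def s_def[symmetric])
        also have "radial_op n cutdata z + s powr (- rexp / 2) *
            (s powr (rexp / 2) * (nl s (F z) - radial_op n cutdata z) - rexp * (rexp - 1) / s * \<omega> (\<theta> z) + rexp * (rexp - 1) / s * \<omega> (\<theta> z))
            = radial_op n cutdata z + s powr (- rexp / 2) * s powr (rexp / 2) * (nl s (F z) - radial_op n cutdata z)"
          by (simp add: mult.assoc)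
        finally show ?thesis unfolding inv by (simp add: s_def)
      qed
    qed
    show "F z = 0" if "\<bar>fst z\<bar> < \<tau>" "2 < snd z" for z
    proof -
      have "11/10 \<le> sqrt (snd z)" using that by (intro real_le_rsqrt) (auto simp: power2_eq_square)
      then have "\<omega> (\<theta> z) = 0" unfolding \<theta>_def using that by (intro \<omega>0) auto
      then show ?thesis using that by (simp add: F_def cutdata_def \<phi>_def \<phi>0_def)
    qed
    show "F z = selfsim z" if "\<tau> \<le> fst z" for z using that by (simp add: F_def)
  qed (use \<tau> in auto)
qed

end

section \<open>The warped product in Cartesian coordinates\<close>

lemma smooth_on_vec:
  fixes f :: "'a::real_normed_vector \<Rightarrow> 'b::euclidean_space^'n"
  assumes "open S" "\<And>i. smooth_on S (\<lambda>x. f x $ i)"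
  shows "smooth_on S f"
proof -
  have "linear (axis i :: 'b \<Rightarrow> 'b^'n)" for i
    by (auto intro!: linearI simp: axis_def vec_eq_iff)
  then have "bounded_linear (axis i :: 'b \<Rightarrow> 'b^'n)" for i
    using linear_conv_bounded_linear by blast
  then have "smooth_on S (\<lambda>x. \<Sum>i\<in>UNIV. axis i (f x $ i))"
    by (rule smooth_on_sum[OF assms(1) smooth_on_linear_compose[OF _ assms]])
  moreover have "(\<Sum>i\<in>UNIV. axis i (v $ i)) = v" for v :: "'b^'n"
    by (simp add: vec_eq_iff axis_def)
  ultimately show ?thesis by simp
qed

text \<open>The derivative of \<open>sgn\<close> is the projection orthogonal to \<open>x\<close> divided by \<open>norm x\<close>, which gives
  \<open>A = (g r / r)\<^sup>2\<close>; the radial direction keeps its Euclidean length.\<close>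

lemma warped_metric_eq:
  fixes x :: "real^'n"
  assumes g: "\<And>u. (g u)\<^sup>2 = u\<^sup>2 * (1 - u\<^sup>2 * B (u\<^sup>2))"
  shows "warped_metric g x = rot_metric B x"
proof (cases "x = 0")
  case True
  then show ?thesis by (simp add: warped_metric_def rot_metric_def mat_def vec_eq_iff)
next
  case False
  define r where "r = norm x"
  have r: "r > 0" "x \<bullet> x = r\<^sup>2" using False by (auto simp: r_def dot_square_norm)
  have dn: "(norm has_derivative (\<lambda>v. (x \<bullet> v) / r)) (at x)"
    using has_derivative_norm[OF False] by (simp add: r_def sgn_div_norm inner_commute divide_inverse mult.commute)
  have du: "frechet_derivative norm (at x) = (\<lambda>v. (x \<bullet> v) / r)"
    using frechet_derivative_at[OF dn] by simp
  have "((\<lambda>y. inverse (norm y) *\<^sub>R y) has_derivative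
      (\<lambda>v. inverse r *\<^sub>R v + (- (inverse r * ((x \<bullet> v) / r) * inverse r)) *\<^sub>R x)) (at x)"
    using has_derivative_scaleR[OF Deriv.has_derivative_inverse[OF _ dn] has_derivative_ident] False
    by (simp add: r_def)
  then have ds: "(sgn has_derivative (\<lambda>v. inverse r *\<^sub>R v + (- (inverse r * ((x \<bullet> v) / r) * inverse r)) *\<^sub>R x)) (at x)"
    by (simp add: sgn_div_norm[abs_def])
  have d\<theta>: "frechet_derivative sgn (at x) = (\<lambda>v. inverse r *\<^sub>R v + (- (inverse r * ((x \<bullet> v) / r) * inverse r)) *\<^sub>R x)"
    using frechet_derivative_at[OF ds] by simp
  have "warped_metric g x $ a $ b = rot_metric B x $ a $ b" for a b
  proof -
    have 1: "(inverse r *\<^sub>R axis a 1 + (- (inverse r * ((x \<bullet> axis a 1) / r) * inverse r)) *\<^sub>R x) \<bullet>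
        (inverse r *\<^sub>R axis b 1 + (- (inverse r * ((x \<bullet> axis b 1) / r) * inverse r)) *\<^sub>R x)
      = ((if a = b then 1 else 0) - x $ a * x $ b / r\<^sup>2) / r\<^sup>2"
      using r by (simp add: inner_simps axis_component field_simps power2_eq_square)
    have "warped_metric g x $ a $ b = ((x \<bullet> axis a 1) / r) * ((x \<bullet> axis b 1) / r)
        + (g r)\<^sup>2 * (((if a = b then 1 else 0) - x $ a * x $ b / r\<^sup>2) / r\<^sup>2)"
      using False
      by (simp only: warped_metric_def if_False Let_def du d\<theta> vec_lambda_beta r_def[symmetric] 1)
    also have "\<dots> = rot_metric B x $ a $ b"
      unfolding g[of r] rot_metric_def vec_lambda_beta r(2) inner_axis1 using r(1)
      by (simp add: field_simps power2_eq_square)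
    finally show ?thesis .
  qed
  then show ?thesis by (simp add: vec_eq_iff)
qed

lemma riemannian_rot_metric:
  assumes "smooth_on UNIV B" and pos: "\<And>s. s \<ge> 0 \<Longrightarrow> 1 - s * B s > 0"
  shows "riemannian_metric (rot_metric B :: real^'n \<Rightarrow> real^'n^'n)"
  unfolding riemannian_metric_def
proof (intro conjI allI impI)
  have "smooth_on UNIV (\<lambda>x :: real^'n. B (x \<bullet> x))"
    by (rule smooth_on_compose[OF assms(1) open_UNIV open_UNIV]) (auto intro!: smooth_on_inner smooth_on_id)
  then show "smooth_on UNIV (rot_metric B :: real^'n \<Rightarrow> real^'n^'n)"
    by (intro smooth_on_vec open_UNIV)
      (simp only: rot_metric_def vec_lambda_beta, intro smooth_on_add smooth_on_mult smooth_on_diff smooth_on_const smooth_on_inner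
        smooth_on_id smooth_on_vec_nth open_UNIV)
  show "transpose (rot_metric B x) = rot_metric B x" for x :: "real^'n"
    by (auto simp: transpose_def rot_metric_def vec_eq_iff)
  fix x v :: "real^'n" assume v: "v \<noteq> 0"
  define s where "s = x \<bullet> x"
  have s: "s \<ge> 0" by (simp add: s_def)
  have vv: "v \<bullet> v > 0" using v by simp
  have "(1 - s * B s) * (v \<bullet> v) + B s * ((x \<bullet> v) * (x \<bullet> v)) > 0"
  proof (cases "B s \<ge> 0")
    case True
    have "(1 - s * B s) * (v \<bullet> v) > 0" using pos[OF s] vv by simp
    moreover have "B s * ((x \<bullet> v) * (x \<bullet> v)) \<ge> 0" using True by simp
    ultimately show ?thesis by simp
  next
    case False
    have "(x \<bullet> v) * (x \<bullet> v) \<le> s * (v \<bullet> v)"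
      using Cauchy_Schwarz_ineq[of x v] by (simp add: s_def power2_eq_square)
    then have "B s * (s * (v \<bullet> v)) \<le> B s * ((x \<bullet> v) * (x \<bullet> v))"
      using False by (intro mult_left_mono_neg) auto
    moreover have "(1 - s * B s) * (v \<bullet> v) = v \<bullet> v - B s * (s * (v \<bullet> v))"
      by (simp add: algebra_simps)
    ultimately show ?thesis using vv by linarith
  qed
  then show "metric_inner (rot_metric B x) v v > 0" by (simp add: metric_inner_rot s_def)
qed

section \<open>Singularity formation\<close>

definition emb :: "real \<times> (real^'n) \<Rightarrow> real \<times> real" where
  "emb z = (fst z, snd z \<bullet> snd z)"

lemma emb_has_derivative: "(emb has_derivative (\<lambda>v. (fst v, 2 * (snd z \<bullet> snd v)))) (at z)"
  unfolding emb_def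
  by (intro has_derivative_Pair has_derivative_fst has_derivative_ident
    has_derivative_compose[OF has_derivative_snd[OF has_derivative_ident] has_derivative_norm_sq])

lemma smooth_emb: "open S \<Longrightarrow> smooth_on S emb"
  unfolding emb_def by (intro smooth_on_Pair smooth_on_fst smooth_on_inner smooth_on_snd smooth_on_id)

lemma has_derivative_emb_compose:
  assumes "open V" "smooth_on V F" "emb z \<in> V"
  shows "((\<lambda>z. F (emb z)) has_derivative
    (\<lambda>v. fst v * pd (1, 0) F (emb z) + 2 * (snd z \<bullet> snd v) * pd (0, 1) F (emb z))) (at z)"
  using has_derivative_compose[OF emb_has_derivative has_derivative_pd[OF assms]] by simp

lemma open_wave_domain: "open (wave_domain \<delta>)"
  unfolding wave_domain_def
  by (intro open_Un open_Collect_conj open_Collect_less continuous_intros)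

text \<open>From a point of the slab, moving forward in time or along a spatial axis is possible.\<close>

lemma thick_slab:
  fixes \<Omega> :: "(real \<times> 'a::euclidean_space) set"
  assumes "open \<Omega>"
  shows "thick (({0..<T} \<times> UNIV) \<inter> \<Omega>)"
  unfolding thick_def
proof (intro ballI allI impI)
  fix z i :: "real \<times> 'a" and e
  assume z: "z \<in> ({0..<T} \<times> UNIV) \<inter> \<Omega>" and i: "i \<in> Basis" and e: "(0::real) < e"
  obtain \<rho> where \<rho>: "\<rho> > 0" "ball z \<rho> \<subseteq> \<Omega>" using assms z open_contains_ball by blast
  define d where "d = min (min e \<rho>) (T - fst z) / 2"
  have T: "0 \<le> fst z" "fst z < T" using z by auto
  have d: "0 < d" "d < e" "d < \<rho>" "d < T - fst z" using e \<rho> T by (auto simp: d_def)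
  have "dist z (z + d *\<^sub>R i) < \<rho>" using d i by (simp add: dist_norm)
  then have "z + d *\<^sub>R i \<in> \<Omega>" using \<rho> by auto
  moreover have "fst i = 0 \<or> fst i = 1" using i by (auto simp: Basis_prod_def)
  then have "0 \<le> fst (z + d *\<^sub>R i)" "fst (z + d *\<^sub>R i) < T" using d T by auto
  ultimately show "\<exists>d. 0 < \<bar>d\<bar> \<and> \<bar>d\<bar> < e \<and> z + d *\<^sub>R i \<in> ({0..<T} \<times> UNIV) \<inter> \<Omega>"
    using d by (intro exI[of _ d]) (auto simp: mem_Times_iff)
qed

lemma selfsim_origin_ge: "t < 1 \<Longrightarrow> selfsim (t, 0) \<ge> 1 / (2 * (1 - t))"
proof -
  assume t: "t < 1"
  have "(2 * (1 - t))\<^sup>2 = 4 * (1 - t)\<^sup>2" by (simp only: power_mult_distrib) simp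
  then have "5/4 * (1 - t)\<^sup>2 \<le> (2 * (1 - t))\<^sup>2" using zero_le_power2[of "1 - t"] by linarith
  then have "(2 * (1 - t))\<^sup>2 powr (-1/2) \<le> (5/4 * (1 - t)\<^sup>2) powr (-1/2)"
    using t by (intro powr_mono2') auto
  moreover have "(2 * (1 - t))\<^sup>2 powr (-1/2) = 1 / (2 * (1 - t))"
    using t by (simp add: powr_minus_divide powr_half_sqrt)
  ultimately show ?thesis by (simp add: selfsim_def ss_denom_def)
qed

context
  fixes B B1 :: "real \<Rightarrow> real" and F :: "real \<times> real \<Rightarrow> real" and \<delta> :: real
  assumes B1: "\<And>s. (B has_real_derivative B1 s) (at s)"
    and \<delta>: "0 < \<delta>" "\<delta> < 1" and sF: "smooth_on (wave_domain \<delta>) F"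
    and eq: "\<And>z. z \<in> wave_domain \<delta> \<Longrightarrow> snd z \<ge> 0 \<Longrightarrow> radial_op (real CARD('n::finite)) F z = nonlin (real CARD('n)) B B1 (snd z) (F z)"
    and F0: "\<And>z. \<bar>fst z\<bar> < \<delta> \<Longrightarrow> 2 < snd z \<Longrightarrow> F z = 0"
    and Fs: "\<And>z. \<delta> \<le> fst z \<Longrightarrow> F z = selfsim z"
begin

definition \<Omega> :: "(real \<times> (real^'n)) set" where "\<Omega> = {z. emb z \<in> wave_domain \<delta>}"
definition blowup_dom :: "(real \<times> (real^'n)) set" where "blowup_dom = ({0..<1} \<times> UNIV) \<inter> \<Omega>"
definition blowup_map :: "real \<times> (real^'n) \<Rightarrow> real^'n" where "blowup_map z = F (emb z) *\<^sub>R snd z"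

lemma open_\<Omega>: "open \<Omega>"
proof -
  have "continuous_on UNIV (emb :: real \<times> (real^'n) \<Rightarrow> _)"
    by (rule smooth_on_imp_continuous_on[OF smooth_emb]) simp
  then have "open (emb -` wave_domain \<delta> :: (real \<times> (real^'n)) set)"
    using open_wave_domain by (simp add: continuous_on_open_vimage)
  then show ?thesis by (simp add: \<Omega>_def vimage_def)
qed

lemma blowup_dom: "thick blowup_dom" "blowup_dom \<subseteq> \<Omega>"
  unfolding blowup_dom_def using thick_slab[OF open_\<Omega>] by auto

lemma smooth_blowup_map: "smooth_on \<Omega> blowup_map"
  unfolding blowup_map_def
  by (intro smooth_on_scaleR smooth_on_snd smooth_on_id open_\<Omega>
    smooth_on_compose[OF sF open_\<Omega> open_wave_domain smooth_emb[OF open_\<Omega>]]) (simp add: \<Omega>_def)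

lemma wave_map_blowup_map: "wave_map (rot_metric B) blowup_dom blowup_map"
proof -
  let ?p = "\<lambda>v F z. pd v F (emb z)"
  note o = open_wave_domain[of \<delta>]
  have "wave_map (rot_metric B) blowup_dom (\<lambda>z. F (emb z) *\<^sub>R snd z)"
  proof (rule corotational_wave_map[OF blowup_dom open_\<Omega>, where ft = "\<lambda>z. pd (1, 0) F (emb z)" and \<kappa> = "\<lambda>z. 2 * pd (0, 1) F (emb z)"
      and ft' = "\<lambda>z v. fst v * pd (1, 0) (pd (1, 0) F) (emb z) + 2 * (snd z \<bullet> snd v) * pd (0, 1) (pd (1, 0) F) (emb z)"
      and \<kappa>' = "\<lambda>z v. 2 * (fst v * pd (1, 0) (pd (0, 1) F) (emb z) + 2 * (snd z \<bullet> snd v) * pd (0, 1) (pd (0, 1) F) (emb z))"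
      and ?B1.0 = B1])
    show "smooth_on \<Omega> (\<lambda>z. F (emb z))"
      by (rule smooth_on_compose[OF sF open_\<Omega> o smooth_emb[OF open_\<Omega>]]) (simp add: \<Omega>_def)
    fix z :: "real \<times> (real^'n)"
    assume "z \<in> \<Omega>"
    then have z: "emb z \<in> wave_domain \<delta>" by (simp add: \<Omega>_def)
    show "((\<lambda>z. F (emb z)) has_derivative (\<lambda>v. pd (1, 0) F (emb z) * fst v + 2 * pd (0, 1) F (emb z) * (snd z \<bullet> snd v))) (at z)"
      by (rule has_derivative_eq_rhs[OF has_derivative_emb_compose[OF o sF z]]) (simp add: fun_eq_iff)
    show "((\<lambda>z. pd (1, 0) F (emb z)) has_derivative
        (\<lambda>v. fst v * pd (1, 0) (pd (1, 0) F) (emb z) + 2 * (snd z \<bullet> snd v) * pd (0, 1) (pd (1, 0) F) (emb z))) (at z)"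
      by (rule has_derivative_emb_compose[OF o smooth_on_pd[OF o sF] z])
    show "((\<lambda>z. 2 * pd (0, 1) F (emb z)) has_derivative
        (\<lambda>v. 2 * (fst v * pd (1, 0) (pd (0, 1) F) (emb z) + 2 * (snd z \<bullet> snd v) * pd (0, 1) (pd (0, 1) F) (emb z)))) (at z)"
      by (rule has_derivative_mult_right[OF has_derivative_emb_compose[OF o smooth_on_pd[OF o sF] z]])
  next
    fix z :: "real \<times> (real^'n)"
    assume "z \<in> blowup_dom"
    then have z: "emb z \<in> wave_domain \<delta>" using blowup_dom(2) by (auto simp: \<Omega>_def)
    have "radial_op (real CARD('n)) F (emb z) = nonlin (real CARD('n)) B B1 (snd (emb z)) (F (emb z))"
      by (rule eq[OF z]) (simp add: emb_def)
    then show "fst (1, 0) * pd (1, 0) (pd (1, 0) F) (emb z) + 2 * (snd z \<bullet> snd (1, 0)) * pd (0, 1) (pd (1, 0) F) (emb z)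
      - (real CARD('n) + 2) * (2 * pd (0, 1) F (emb z))
      - 2 * (fst (0, snd z) * pd (1, 0) (pd (0, 1) F) (emb z) + 2 * (snd z \<bullet> snd (0, snd z)) * pd (0, 1) (pd (0, 1) F) (emb z))
      - (real CARD('n) - 1) * F (emb z) ^ 3 * (2 * B ((F (emb z))\<^sup>2 * (snd z \<bullet> snd z))
          + (F (emb z))\<^sup>2 * (snd z \<bullet> snd z) * B1 ((F (emb z))\<^sup>2 * (snd z \<bullet> snd z))) = 0"
      unfolding radial_op_def nonlin_def by (simp add: emb_def algebra_simps)
  qed (rule B1)
  then show ?thesis by (simp add: blowup_map_def[abs_def])
qed

lemma blowup_domain_blowup_dom: "blowup_domain 1 blowup_dom"
proof -
  have "{0} \<times> UNIV \<subseteq> blowup_dom"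
    using \<delta> by (auto simp: blowup_dom_def \<Omega>_def emb_def wave_domain_def)
  moreover have "z \<in> blowup_dom" if "z \<in> {(t, x). 0 \<le> t \<and> t < 1 \<and> norm x \<le> 1 - t}" for z :: "real \<times> (real^'n)"
  proof -
    obtain t x where z: "z = (t, x)" by force
    with that have tx: "z = (t, x)" "0 \<le> t" "t < 1" "norm x \<le> 1 - t" by auto
    have "x \<bullet> x \<le> (1 - t)\<^sup>2"
      using tx(4) power_mono[OF tx(4) norm_ge_zero, of 2] by (simp add: dot_square_norm)
    moreover have "(1 - t)\<^sup>2 > 0" using tx by simp
    ultimately have "x \<bullet> x < 1001/1000 * (1 - t)\<^sup>2" by linarith
    then show ?thesis
      using tx \<delta> by (cases "t < \<delta>") (auto simp: blowup_dom_def \<Omega>_def emb_def wave_domain_def)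
  qed
  moreover have "openin (top_of_set ({0..<1} \<times> UNIV)) blowup_dom"
    unfolding blowup_dom_def by (rule openin_open_Int[OF open_\<Omega>])
  ultimately show ?thesis unfolding blowup_domain_def by blast
qed

lemma blowup_map_dir_deriv:
  assumes "z \<in> blowup_dom"
  shows "dir_deriv blowup_dom blowup_map v z = dir_deriv \<Omega> blowup_map v z"
  by (rule dir_deriv_within[OF blowup_dom(1) assms smooth_on_has_derivative[OF open_\<Omega> smooth_blowup_map]])
    (use blowup_dom(2) assms in blast)

lemma slice: "(0, x) \<in> blowup_dom" "(0, x) \<in> \<Omega>"
  using blowup_domain_blowup_dom blowup_dom(2) unfolding blowup_domain_def by auto

lemma compact_data: "smooth_compact_data (\<lambda>x. blowup_map (0, x)) (\<lambda>x. dir_deriv blowup_dom blowup_map (1, 0) (0, x))"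
proof -
  have i: "smooth_on UNIV (\<lambda>x :: real^'n. (0 :: real, x))"
    by (intro smooth_on_linear bounded_linear_Pair bounded_linear_zero bounded_linear_ident) auto
  have "smooth_on UNIV (\<lambda>x. blowup_map (0, x))"
    by (rule smooth_on_compose[OF smooth_blowup_map open_UNIV open_\<Omega> i slice(2)])
  moreover have "smooth_on UNIV (\<lambda>x. dir_deriv blowup_dom blowup_map (1, 0) (0, x))"
    unfolding blowup_map_dir_deriv[OF slice(1)]
    by (rule smooth_on_compose[OF smooth_on_dir_deriv[OF smooth_blowup_map] open_UNIV open_\<Omega> i slice(2)])
  moreover have "blowup_map (0, x) = 0 \<and> dir_deriv blowup_dom blowup_map (1, 0) (0, x) = 0" if x: "x \<notin> cball 0 2" for x
  proof -
    let ?V = "{z :: real \<times> (real^'n). \<bar>fst z\<bar> < \<delta> \<and> 2 < snd z \<bullet> snd z}"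
    have o: "open ?V" by (intro open_Collect_conj open_Collect_less continuous_intros)
    have z: "blowup_map z = 0" if "z \<in> ?V" for z using that F0[of "emb z"] by (simp add: blowup_map_def emb_def)
    have "2\<^sup>2 < (norm x)\<^sup>2" using x by (intro power_strict_mono) auto
    then have xV: "(0, x) \<in> ?V" using \<delta> by (simp add: dot_square_norm)
    have "((\<lambda>z. 0) has_derivative (\<lambda>v. 0)) (at (0, x))" by simp
    then have "(blowup_map has_derivative (\<lambda>v. 0)) (at (0, x))"
      by (rule has_derivative_transform_within_open[OF _ o xV]) (simp add: z)
    then have "dir_deriv blowup_dom blowup_map (1, 0) (0, x) = 0"
      by (rule dir_deriv_within[OF blowup_dom(1) slice(1)])
    with z[OF xV] show ?thesis by simp
  qed
  ultimately show ?thesis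
    unfolding smooth_compact_data_def by (intro conjI exI[of _ "cball 0 2"]) auto
qed

text \<open>At the origin all partial derivatives have length \<open>selfsim (t, 0)\<close>, which grows like \<open>1 / (1 - t)\<close>.\<close>

lemma gradient_blowup: "\<exists>\<^sub>F t in at_left 1. spatial_gradient_norm (rot_metric B) blowup_dom blowup_map (t, 0) > C"
proof -
  define t0 where "t0 = max \<delta> (1 - 1 / (2 * (\<bar>C\<bar> + 1)))"
  have t0: "t0 < 1" using \<delta> by (auto simp: t0_def)
  have "spatial_gradient_norm (rot_metric B) blowup_dom blowup_map (t, 0) > C" if t: "t \<in> {t0<..<1}" for t
  proof -
    have tb: "\<delta> < t" "t < 1" "1 - 1 / (2 * (\<bar>C\<bar> + 1)) < t" using t by (auto simp: t0_def)
    have D: "(t, 0) \<in> blowup_dom" using blowup_domain_blowup_dom tb \<delta> unfolding blowup_domain_def by auto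
    then have z: "emb (t, 0 :: real^'n) \<in> wave_domain \<delta>" using blowup_dom(2) by (auto simp: \<Omega>_def)
    have ft: "F (emb (t, 0 :: real^'n)) = selfsim (t, 0)" using Fs tb by (simp add: emb_def)
    have "(blowup_map has_derivative (\<lambda>v. F (emb (t, 0 :: real^'n)) *\<^sub>R snd v + (fst v * pd (1, 0) F (emb (t, 0 :: real^'n))
       + 2 * (snd (t, 0 :: real^'n) \<bullet> snd v) * pd (0, 1) F (emb (t, 0 :: real^'n))) *\<^sub>R snd (t, 0 :: real^'n))) (at (t, 0))"
      unfolding blowup_map_def[abs_def]
      by (rule has_derivative_scaleR[OF has_derivative_emb_compose[OF open_wave_domain sF z] has_derivative_snd[OF has_derivative_ident]])
    from dir_deriv_within[OF blowup_dom(1) D this]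
    have "dir_deriv blowup_dom blowup_map (0, axis i 1) (t, 0) = selfsim (t, 0) *\<^sub>R axis i 1" for i
      by (simp add: ft)
    then have n: "spatial_gradient_norm (rot_metric B) blowup_dom blowup_map (t, 0) = sqrt (real CARD('n) * (selfsim (t, 0))\<^sup>2)"
      unfolding spatial_gradient_norm_def
      by (simp add: metric_inner_rot blowup_map_def inner_axis_axis power2_eq_square)
    have "\<bar>C\<bar> < 1 / (2 * (1 - t))"
    proof -
      have "2 * (1 - t) * (\<bar>C\<bar> + 1) < 1" using tb by (simp add: field_simps)
      moreover have "0 < 2 * (1 - t)" using tb by simp
      ultimately show ?thesis by (simp add: field_simps)
    qed
    also have "\<dots> \<le> selfsim (t, 0)" by (rule selfsim_origin_ge) (use tb in simp)
    finally have s: "\<bar>C\<bar> < selfsim (t, 0)" .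
    have "(selfsim (t, 0))\<^sup>2 \<le> real CARD('n) * (selfsim (t, 0))\<^sup>2"
      using mult_right_mono[of 1 "real CARD('n)" "(selfsim (t, 0))\<^sup>2"] by simp
    then have "sqrt ((selfsim (t, 0))\<^sup>2) \<le> sqrt (real CARD('n) * (selfsim (t, 0))\<^sup>2)" by (rule real_sqrt_le_mono)
    then show ?thesis unfolding n using s by simp
  qed
  from eventually_mono[OF eventually_at_left_real[OF t0] this]
  have "\<forall>\<^sub>F t in at_left 1. spatial_gradient_norm (rot_metric B) blowup_dom blowup_map (t, 0) > C" .
  then show ?thesis by (rule eventually_frequently[rotated]) simp
qed

text \<open>The data are read off from the solution; their support is compact because the solution vanishes for
  \<open>x \<bullet> x > 2\<close> and small times.\<close>

theorem forms_singularity_rot_metric: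
  "\<exists>U0 U1 :: real^'n \<Rightarrow> real^'n. smooth_compact_data U0 U1 \<and> forms_singularity (rot_metric B) U0 U1"
proof (intro exI conjI)
  show "smooth_compact_data (\<lambda>x. blowup_map (0, x)) (\<lambda>x. dir_deriv blowup_dom blowup_map (1, 0) (0, x))" by (rule compact_data)
  show "forms_singularity (rot_metric B) (\<lambda>x. blowup_map (0, x)) (\<lambda>x. dir_deriv blowup_dom blowup_map (1, 0) (0, x))"
    unfolding forms_singularity_def
    by (intro exI[of _ 1] conjI exI[of _ blowup_dom] exI[of _ blowup_map])
      (simp_all add: blowup_domain_blowup_dom wave_map_blowup_map attains_data_def gradient_blowup)
qed

end

theorem theorem2p2:
  assumes "CARD('n::finite) \<ge> 8"
  shows "\<exists>g :: real \<Rightarrow> real.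
           smooth_on UNIV g \<and> (\<forall>u. g (- u) = - g u) \<and> deriv g 0 = 1 \<and> (\<forall>u>0. g u > 0) \<and>
           riemannian_metric (warped_metric g :: real^'n \<Rightarrow> real^'n^'n) \<and>
           negatively_curved (warped_metric g :: real^'n \<Rightarrow> real^'n^'n) \<and>
           (\<exists>U0 U1 :: real^'n \<Rightarrow> real^'n.
              smooth_compact_data U0 U1 \<and> forms_singularity (warped_metric g) U0 U1)"
proof -
  define n where "n = real CARD('n)"
  have n: "n \<ge> 8" using assms by (simp add: n_def)
  then have m: "n - 1 \<ge> 7" by simp
  obtain B B1 B2 where sB: "smooth_on UNIV B" and sB1: "smooth_on UNIV B1"
    and B1: "\<And>s. (B has_real_derivative B1 s) (at s)" and B2: "\<And>s. (B1 has_real_derivative B2 s) (at s)"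
    and A: "\<And>s. s \<ge> 0 \<Longrightarrow> 1 - s * B s > 0"
    and tan: "\<And>s. s \<ge> 0 \<Longrightarrow> curv_tan B B1 s < 0" and rad: "\<And>s. s \<ge> 0 \<Longrightarrow> curv_rad B B1 B2 s < 0"
    and Beq: "\<And>s. s < 41/10 \<Longrightarrow> B s = - ((2 * (n - 1) + 1) / (4 * (n - 1))) + s / (4 * (n - 1))"
    by (rule target_profile[OF m]) blast
  obtain \<delta> F where \<delta>: "0 < \<delta>" "\<delta> < 1" and sF: "smooth_on (wave_domain \<delta>) F"
    and eq: "\<And>z. z \<in> wave_domain \<delta> \<Longrightarrow> snd z \<ge> 0 \<Longrightarrow> radial_op n F z = nonlin n B B1 (snd z) (F z)"
    and F0: "\<And>z. \<bar>fst z\<bar> < \<delta> \<Longrightarrow> 2 < snd z \<Longrightarrow> F z = 0"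
    and Fs: "\<And>z. \<delta> \<le> fst z \<Longrightarrow> F z = selfsim z"
    by (rule blowup_profile[OF n sB sB1 B1 Beq]) blast+
  define q where "q u = sqrt (1 - u\<^sup>2 * B (u\<^sup>2))" for u :: real
  define g where "g u = u * q u" for u :: real
  have q_pos: "q u > 0" for u using A[of "u\<^sup>2"] by (simp add: q_def)
  have sq: "smooth_on UNIV q"
    unfolding q_def
    by (intro smooth_on_sqrt smooth_on_diff smooth_on_mult smooth_on_const smooth_on_power smooth_on_id
      smooth_on_compose[OF sB open_UNIV open_UNIV] open_UNIV UNIV_I A) simp
  have g2: "(g u)\<^sup>2 = u\<^sup>2 * (1 - u\<^sup>2 * B (u\<^sup>2))" for u
    using A[of "u\<^sup>2"] by (simp add: g_def q_def power_mult_distrib)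
  have W: "warped_metric g = (rot_metric B :: real^'n \<Rightarrow> real^'n^'n)"
    by (rule ext) (rule warped_metric_eq[OF g2])
  have "deriv g 0 = 1"
  proof (rule DERIV_imp_deriv)
    have "(g has_real_derivative 1 * q 0 + dir_deriv UNIV q 1 0 * 0) (at 0)"
      unfolding g_def
      by (rule DERIV_mult[OF DERIV_ident smooth_on_has_real_derivative[OF open_UNIV sq UNIV_I]])
    then show "(g has_real_derivative 1) (at 0)" by (simp add: q_def)
  qed
  moreover have "smooth_on UNIV g" unfolding g_def by (intro smooth_on_mult smooth_on_id sq open_UNIV)
  moreover have "\<forall>u. g (- u) = - g u" by (simp add: g_def q_def)
  moreover have "\<forall>u>0. g u > 0" using q_pos by (simp add: g_def)
  moreover have "riemannian_metric (rot_metric B :: real^'n \<Rightarrow> real^'n^'n)"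
    by (rule riemannian_rot_metric[OF sB A])
  moreover have "negatively_curved (rot_metric B :: real^'n \<Rightarrow> real^'n^'n)"
    by (rule negatively_curved_rot_metric[OF B1 B2 A tan rad])
  moreover have "\<exists>U0 U1 :: real^'n \<Rightarrow> real^'n. smooth_compact_data U0 U1 \<and> forms_singularity (rot_metric B) U0 U1"
    by (rule forms_singularity_rot_metric[OF B1 \<delta> sF eq[unfolded n_def] F0 Fs])
  ultimately show ?thesis unfolding W[symmetric] by (intro exI[of _ g] conjI)
qed

end
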